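(* Let $X \subset \mathbb{R}^N$, $N \in \mathbb{N}$, be a compact set, $\mu$ a Borel probability measure on $X$ and $T\colon X \to X$ a Lipschitz map. Let $\overline{D}$ and $\underline{D}$ be the upper and lower box-counting dimensions of $X$, respectively. Then there is a prevalent set $\mathcal S$ of Lipschitz observables $h \colon X \to \mathbb{R}$ (prevalent in $\mathrm{Lip}(X)$) such that for every $h \in \mathcal S$, $k \in \mathbb{N}$, $\delta, \theta > 0$, there exist $C, \varepsilon_0 > 0$ such that for the $k$-delay coordinate map $\phi(x)=(h(x),h(Tx),\dots,h(T^{k-1}x))$ and every $0 < \varepsilon < \varepsilon_0$, the following hold. (i) If $k > \overline{D}$, then $$\mu\left( \{ x \in X : \sigma_{\varepsilon}(\phi(x)) > \delta \} \right) \leq C \varepsilon^{k - \overline{D} - \theta}.$$ (ii) If $k > 2\underline{D}$ or $\phi$ is injective, then $$\{ x \in X : \sigma_{\varepsilon}(\phi(x)) > \delta \} = \emptyset.$$ Here $\{x\in X:\sigma_\varepsilon(\phi(x))>\delta\}$ consists of those $x$ for which $\sigma_\varepsilon(\phi(x))$ is defined and exceeds $\delta$.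
   Context: $\mathbb{N}=\{1,2,\dots\}$; $\|\cdot\|$ is the Euclidean norm; $B(y,\varepsilon)$ is the open ball. For bounded $X$, with $N(X,\delta)$ the minimal number of balls of diameter at most $\delta$ needed to cover $X$, the lower/upper box-counting dimension is the $\liminf$/$\limsup$ as $\delta\to0$ of $\log N(X,\delta)/(-\log\delta)$. Prediction error: for $y\in\mathbb{R}^k$ and $\varepsilon>0$ with $\mu(\phi^{-1}(B(y,\varepsilon)))>0$ let $$\chi_\varepsilon(y)=\frac{1}{\mu(\phi^{-1}(B(y,\varepsilon)))}\int_{\phi^{-1}(B(y,\varepsilon))}\phi\circ T\,d\mu,\qquad \sigma_\varepsilon(y)=\Big(\frac{1}{\mu(\phi^{-1}(B(y,\varepsilon)))}\int_{\phi^{-1}(B(y,\varepsilon))}\|\phi(T(x))-\chi_\varepsilon(y)\|^2d\mu(x)\Big)^{1/2}.$$ Prevalence: $\mathrm{Lip}(X)$ is the Banach space of Lipschitz functions $h\colon X\to\mathbb{R}$ with norm $\sup_{x}|h(x)|+\sup_{x\ne y}|h(x)-h(y)|/\|x-y\|$. A Borel set $\mathcal S\subset V=\mathrm{Lip}(X)$ is prevalent if there is a Borel measure $\nu$ on $V$, positive and finite on some compact subset of $V$, such that for every $v\in V$ we have $v+e\in\mathcal S$ for $\nu$-almost every $e\in V$. A non-Borel subset of $V$ is prevalent if it contains a prevalent Borel subset. *)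

theory Defs
  imports "HOL-Analysis.Analysis" "HOL-Probability.Probability"
begin

subsection \<open>Box-counting dimension\<close>

definition covering_number :: "'a::metric_space set \<Rightarrow> real \<Rightarrow> nat" where
  "covering_number X \<delta> =
     (LEAST n. \<exists>\<B>. finite \<B> \<and> card \<B> = n \<and> X \<subseteq> \<Union>\<B> \<and>
        (\<forall>B\<in>\<B>. (\<exists>c r. B = ball c r) \<and> diameter B \<le> \<delta>))"

definition lower_box_dim :: "'a::metric_space set \<Rightarrow> ereal" where
  "lower_box_dim X =
     Liminf (at_right 0) (\<lambda>\<delta>. ereal (ln (real (covering_number X \<delta>)) / (- ln \<delta>)))"

definition upper_box_dim :: "'a::metric_space set \<Rightarrow> ereal" where
  "upper_box_dim X =
     Limsup (at_right 0) (\<lambda>\<delta>. ereal (ln (real (covering_number X \<delta>)) / (- ln \<delta>)))"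

text \<open>The dimensions are extended reals. As they are nonnegative, \<open>upper_box_dim X < k\<close> for a real
  \<open>k\<close> forces finiteness, so \<^const>\<open>real_of_ereal\<close> then returns the genuine value.\<close>

lemma lower_box_dim_nonneg: "0 \<le> lower_box_dim X"
  unfolding lower_box_dim_def
proof (rule Liminf_bounded)
  have "\<forall>\<^sub>F \<delta> in at_right (0::real). \<delta> \<in> {0<..<1}"
    by (rule eventually_at_right_real) simp
  then show "\<forall>\<^sub>F \<delta> in at_right 0.
      0 \<le> ereal (ln (real (covering_number X \<delta>)) / (- ln \<delta>))"
  proof eventually_elim
    case (elim \<delta>)
    have "0 \<le> ln (real (covering_number X \<delta>))"
      by (cases "covering_number X \<delta>") auto
    moreover have "0 \<le> - ln \<delta>" using elim by simp
    ultimately have "0 \<le> ln (real (covering_number X \<delta>)) / (- ln \<delta>)"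
      by (rule divide_nonneg_nonneg)
    then show ?case by simp
  qed
qed

lemma lower_le_upper_box_dim: "lower_box_dim X \<le> upper_box_dim X"
  unfolding lower_box_dim_def upper_box_dim_def
  by (rule Liminf_le_Limsup) simp

lemma upper_box_dim_nonneg: "0 \<le> upper_box_dim X"
  using lower_box_dim_nonneg lower_le_upper_box_dim by (rule order_trans)


subsection \<open>Lipschitz observables and prevalence\<close>

text \<open>A function on \<open>X\<close> is represented by its extension by zero. The vector space operations
  of \<open>Lip X\<close> are then the pointwise ones.\<close>

definition Lip :: "'a::metric_space set \<Rightarrow> ('a \<Rightarrow> real) set" where
  "Lip X = {h. (\<forall>x. x \<notin> X \<longrightarrow> h x = 0) \<and> (\<exists>L. L-lipschitz_on X h)}"

text \<open>Both suprema are of nonnegative quantities. Inserting 0 gives the empty supremum (second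
  summand, \<open>X\<close> a singleton) the value 0.\<close>

definition lip_norm :: "'a::metric_space set \<Rightarrow> ('a \<Rightarrow> real) \<Rightarrow> real" where
  "lip_norm X h =
     Sup (insert 0 {\<bar>h x\<bar> | x. x \<in> X}) +
     Sup (insert 0 {\<bar>h x - h y\<bar> / dist x y | x y. x \<in> X \<and> y \<in> X \<and> x \<noteq> y})"

text \<open>The locale \<^locale>\<open>Metric_space\<close> requires nonnegativity of the distance off the carrier
  too, where the suprema in \<^const>\<open>lip_norm\<close> may be unspecified.\<close>

definition lip_dist :: "'a::metric_space set \<Rightarrow> ('a \<Rightarrow> real) \<Rightarrow> ('a \<Rightarrow> real) \<Rightarrow> real" where
  "lip_dist X g h =
     (if g \<in> Lip X \<and> h \<in> Lip X then lip_norm X (\<lambda>x. g x - h x) else 0)"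

definition Lip_topology :: "'a::metric_space set \<Rightarrow> ('a \<Rightarrow> real) topology" where
  "Lip_topology X = Metric_space.mtopology (Lip X) (lip_dist X)"

definition Lip_borel :: "'a::metric_space set \<Rightarrow> ('a \<Rightarrow> real) measure" where
  "Lip_borel X = sigma (Lip X) {U. openin (Lip_topology X) U}"

definition prevalent_borel :: "'a::metric_space set \<Rightarrow> ('a \<Rightarrow> real) set \<Rightarrow> bool" where
  "prevalent_borel X S \<longleftrightarrow>
     S \<in> sets (Lip_borel X) \<and>
     (\<exists>\<nu>. sets \<nu> = sets (Lip_borel X) \<and>
          (\<exists>K. compactin (Lip_topology X) K \<and> 0 < emeasure \<nu> K \<and> emeasure \<nu> K < \<infinity>) \<and>
          (\<forall>v\<in>Lip X. AE e in \<nu>. (\<lambda>x. v x + e x) \<in> S))"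

definition prevalent :: "'a::metric_space set \<Rightarrow> ('a \<Rightarrow> real) set \<Rightarrow> bool" where
  "prevalent X S \<longleftrightarrow> S \<subseteq> Lip X \<and> (\<exists>S'\<subseteq>S. prevalent_borel X S')"

lemma Lip_bdd_above:
  assumes X: "bounded X" and h: "h \<in> Lip X"
  shows "bdd_above (insert 0 {\<bar>h x\<bar> | x. x \<in> X})"
    and "bdd_above (insert 0 {\<bar>h x - h y\<bar> / dist x y | x y. x \<in> X \<and> y \<in> X \<and> x \<noteq> y})"
proof -
  obtain L where L: "L-lipschitz_on X h" using h by (auto simp: Lip_def)
  obtain a e where e: "\<And>y. y \<in> X \<Longrightarrow> dist a y \<le> e" using X by (auto simp: bounded_def)
  have "\<exists>B. \<forall>x\<in>X. \<bar>h x\<bar> \<le> B"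
  proof (cases "X = {}")
    case False
    then obtain z where z: "z \<in> X" by blast
    have "\<bar>h x\<bar> \<le> \<bar>h z\<bar> + L * (2 * e)" if x: "x \<in> X" for x
    proof -
      have "dist x z \<le> 2 * e" using e[OF x] e[OF z] dist_triangle3[of x z a] by linarith
      then have "L * dist x z \<le> L * (2 * e)"
        using lipschitz_on_nonneg[OF L] by (rule mult_left_mono)
      then show ?thesis using lipschitz_onD[OF L x z] by (simp add: dist_real_def)
    qed
    then show ?thesis by blast
  qed simp
  then obtain B where "\<forall>x\<in>X. \<bar>h x\<bar> \<le> B" by blast
  then show "bdd_above (insert 0 {\<bar>h x\<bar> | x. x \<in> X})"
    unfolding bdd_above_insert by (intro bdd_aboveI[of _ B]) auto
  have "\<bar>h x - h y\<bar> / dist x y \<le> L" if "x \<in> X" "y \<in> X" "x \<noteq> y" for x y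
    using lipschitz_onD[OF L that(1,2)] that(3) by (simp add: dist_real_def divide_le_eq)
  then show "bdd_above (insert 0 {\<bar>h x - h y\<bar> / dist x y | x y. x \<in> X \<and> y \<in> X \<and> x \<noteq> y})"
    unfolding bdd_above_insert by (intro bdd_aboveI[of _ L]) auto
qed

lemma Lip_diff:
  assumes "g \<in> Lip X" "h \<in> Lip X"
  shows "(\<lambda>x. g x - h x) \<in> Lip X"
proof -
  obtain L M where "L-lipschitz_on X g" "M-lipschitz_on X h" using assms by (auto simp: Lip_def)
  then have "(L + M)-lipschitz_on X (\<lambda>x. g x - h x)" by (rule lipschitz_on_diff)
  then show ?thesis using assms by (auto simp: Lip_def)
qed

lemma lip_norm_triangle:
  assumes X: "bounded X" and f: "f \<in> Lip X" and g: "g \<in> Lip X"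
  shows "lip_norm X (\<lambda>x. f x + g x) \<le> lip_norm X f + lip_norm X g"
proof -
  let ?A = "\<lambda>h. insert 0 {\<bar>h x\<bar> | x. x \<in> X}"
  let ?B = "\<lambda>h. insert 0 {\<bar>h x - h y\<bar> / dist x y | x y. x \<in> X \<and> y \<in> X \<and> x \<noteq> y}"
  note bdd = Lip_bdd_above[OF X f] Lip_bdd_above[OF X g]
  have up: "a \<le> Sup (?A f)" if "a \<in> ?A f" for a using that bdd(1) by (rule cSup_upper)
  have up': "a \<le> Sup (?A g)" if "a \<in> ?A g" for a using that bdd(3) by (rule cSup_upper)
  have uq: "a \<le> Sup (?B f)" if "a \<in> ?B f" for a using that bdd(2) by (rule cSup_upper)
  have uq': "a \<le> Sup (?B g)" if "a \<in> ?B g" for a using that bdd(4) by (rule cSup_upper)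
  have "Sup (?A (\<lambda>x. f x + g x)) \<le> Sup (?A f) + Sup (?A g)"
  proof (rule cSup_least)
    fix a assume "a \<in> ?A (\<lambda>x. f x + g x)"
    then consider "a = 0" | x where "x \<in> X" "a = \<bar>f x + g x\<bar>" by auto
    then show "a \<le> Sup (?A f) + Sup (?A g)"
    proof cases
      case 1
      then show ?thesis using up[of 0] up'[of 0] by simp
    next
      case (2 x)
      then have "\<bar>f x\<bar> \<le> Sup (?A f)" "\<bar>g x\<bar> \<le> Sup (?A g)"
        by (intro up up'; blast)+
      then show ?thesis unfolding 2(2) by linarith
    qed
  qed simp
  moreover have "Sup (?B (\<lambda>x. f x + g x)) \<le> Sup (?B f) + Sup (?B g)"
  proof (rule cSup_least)
    fix a assume "a \<in> ?B (\<lambda>x. f x + g x)"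
    then consider "a = 0" | x y where "x \<in> X" "y \<in> X" "x \<noteq> y"
      "a = \<bar>(f x + g x) - (f y + g y)\<bar> / dist x y" by auto
    then show "a \<le> Sup (?B f) + Sup (?B g)"
    proof cases
      case 1
      then show ?thesis using uq[of 0] uq'[of 0] by simp
    next
      case (2 x y)
      then have "\<bar>f x - f y\<bar> / dist x y \<le> Sup (?B f)" "\<bar>g x - g y\<bar> / dist x y \<le> Sup (?B g)"
        by (intro uq uq'; blast)+
      moreover have "a \<le> \<bar>f x - f y\<bar> / dist x y + \<bar>g x - g y\<bar> / dist x y"
        unfolding 2(4) add_divide_distrib[symmetric] by (rule divide_right_mono) auto
      ultimately show ?thesis by linarith
    qed
  qed simp
  ultimately show ?thesis unfolding lip_norm_def by linarith
qed

lemma lip_norm_minus: "lip_norm X (\<lambda>x. g x - h x) = lip_norm X (\<lambda>x. h x - g x)"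
proof -
  have "\<bar>(g x - h x) - (g y - h y)\<bar> = \<bar>(h x - g x) - (h y - g y)\<bar>" for x y by linarith
  moreover have "\<bar>g x - h x\<bar> = \<bar>h x - g x\<bar>" for x by linarith
  ultimately show ?thesis unfolding lip_norm_def by simp
qed

lemma lip_norm_ge:
  assumes X: "bounded X" and h: "h \<in> Lip X"
  shows "0 \<le> lip_norm X h" and "x \<in> X \<Longrightarrow> \<bar>h x\<bar> \<le> lip_norm X h"
proof -
  have *: "0 \<le> Sup (insert 0 {\<bar>h x - h y\<bar> / dist x y | x y. x \<in> X \<and> y \<in> X \<and> x \<noteq> y})"
    by (rule cSup_upper) (use Lip_bdd_above[OF X h] in auto)
  have "0 \<le> Sup (insert 0 {\<bar>h x\<bar> | x. x \<in> X})"
    by (rule cSup_upper) (use Lip_bdd_above[OF X h] in auto)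
  with * show "0 \<le> lip_norm X h" unfolding lip_norm_def by linarith
  assume "x \<in> X"
  then have "\<bar>h x\<bar> \<le> Sup (insert 0 {\<bar>h x\<bar> | x. x \<in> X})"
    by (intro cSup_upper) (use Lip_bdd_above[OF X h] in auto)
  with * show "\<bar>h x\<bar> \<le> lip_norm X h" unfolding lip_norm_def by linarith
qed

lemma Metric_space_Lip:
  assumes X: "bounded X"
  shows "Metric_space (Lip X) (lip_dist X)"
proof
  show "0 \<le> lip_dist X g h" for g h
    using lip_norm_ge(1)[OF X Lip_diff] by (simp add: lip_dist_def)
  show "lip_dist X g h = lip_dist X h g" for g h
    unfolding lip_dist_def using lip_norm_minus[of X g h] by auto
  show "lip_dist X g h = 0 \<longleftrightarrow> g = h" if "g \<in> Lip X" "h \<in> Lip X" for g h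
  proof
    assume eq: "lip_dist X g h = 0"
    show "g = h"
    proof
      fix x
      show "g x = h x"
      proof (cases "x \<in> X")
        case True
        then show ?thesis
          using lip_norm_ge(2)[OF X Lip_diff[OF that] True] eq that by (simp add: lip_dist_def)
      next
        case False
        then show ?thesis using that by (simp add: Lip_def)
      qed
    qed
  next
    have "insert 0 {\<bar>0::real\<bar> | x. x \<in> X} = {0}"
      and "insert 0 {\<bar>0 - 0::real\<bar> / dist x y | x y. x \<in> X \<and> y \<in> X \<and> x \<noteq> y} = {0}"
      by auto
    then have "lip_norm X (\<lambda>_. 0) = 0"
      unfolding lip_norm_def by (simp only: cSup_singleton)
    moreover assume "g = h"
    ultimately show "lip_dist X g h = 0" by (simp add: lip_dist_def)
  qed
  show "lip_dist X f h \<le> lip_dist X f g + lip_dist X g h"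
    if "f \<in> Lip X" "g \<in> Lip X" "h \<in> Lip X" for f g h
    using lip_norm_triangle[OF X Lip_diff[OF that(1,2)] Lip_diff[OF that(2,3)]] that
    by (simp add: lip_dist_def)
qed


subsection \<open>Delay coordinates and prediction error\<close>

text \<open>As \<open>k\<close> is quantified after the prevalent set, \<open>\<real>\<^sup>k\<close> cannot be a type here. It is the
  carrier of \<^term>\<open>Euclidean_space k\<close>, i.e. the sequences vanishing from index \<open>k\<close> on.\<close>

definition euclid_norm :: "nat \<Rightarrow> (nat \<Rightarrow> real) \<Rightarrow> real" where
  "euclid_norm k z = L2_set z {..<k}"

definition euclid_ball :: "nat \<Rightarrow> (nat \<Rightarrow> real) \<Rightarrow> real \<Rightarrow> (nat \<Rightarrow> real) set" where
  "euclid_ball k y \<epsilon> =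
     {z \<in> topspace (Euclidean_space k). euclid_norm k (\<lambda>i. z i - y i) < \<epsilon>}"

definition delay_map :: "('a \<Rightarrow> real) \<Rightarrow> ('a \<Rightarrow> 'a) \<Rightarrow> nat \<Rightarrow> 'a \<Rightarrow> nat \<Rightarrow> real" where
  "delay_map h T k x = (\<lambda>i. if i < k then h ((T ^^ i) x) else 0)"

lemma delay_map_in_Euclidean_space: "delay_map h T k x \<in> topspace (Euclidean_space k)"
  by (simp add: delay_map_def topspace_Euclidean_space)

definition fibre ::
    "'a measure \<Rightarrow> nat \<Rightarrow> ('a \<Rightarrow> nat \<Rightarrow> real) \<Rightarrow> real \<Rightarrow> (nat \<Rightarrow> real) \<Rightarrow> 'a set" where
  "fibre \<mu> k \<phi> \<epsilon> y = \<phi> -` euclid_ball k y \<epsilon> \<inter> space \<mu>"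

text \<open>The \<open>\<real>\<^sup>k\<close>-valued integral is taken coordinatewise.\<close>

definition pred_mean ::
    "'a measure \<Rightarrow> ('a \<Rightarrow> 'a) \<Rightarrow> nat \<Rightarrow> ('a \<Rightarrow> nat \<Rightarrow> real) \<Rightarrow> real \<Rightarrow> (nat \<Rightarrow> real) \<Rightarrow> nat \<Rightarrow> real"
  where
  "pred_mean \<mu> T k \<phi> \<epsilon> y =
     (\<lambda>i. 1 / measure \<mu> (fibre \<mu> k \<phi> \<epsilon> y) * (LINT x:fibre \<mu> k \<phi> \<epsilon> y|\<mu>. \<phi> (T x) i))"

definition pred_error ::
    "'a measure \<Rightarrow> ('a \<Rightarrow> 'a) \<Rightarrow> nat \<Rightarrow> ('a \<Rightarrow> nat \<Rightarrow> real) \<Rightarrow> real \<Rightarrow> (nat \<Rightarrow> real) \<Rightarrow> real" where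
  "pred_error \<mu> T k \<phi> \<epsilon> y =
     sqrt (1 / measure \<mu> (fibre \<mu> k \<phi> \<epsilon> y) *
       (LINT x:fibre \<mu> k \<phi> \<epsilon> y|\<mu>.
          (euclid_norm k (\<lambda>i. \<phi> (T x) i - pred_mean \<mu> T k \<phi> \<epsilon> y i))\<^sup>2))"

definition bad_set ::
    "'a measure \<Rightarrow> ('a \<Rightarrow> 'a) \<Rightarrow> nat \<Rightarrow> ('a \<Rightarrow> nat \<Rightarrow> real) \<Rightarrow> real \<Rightarrow> real \<Rightarrow> 'a set" where
  "bad_set \<mu> T k \<phi> \<epsilon> \<delta> =
     {x \<in> space \<mu>. 0 < measure \<mu> (fibre \<mu> k \<phi> \<epsilon> (\<phi> x)) \<and> \<delta> < pred_error \<mu> T k \<phi> \<epsilon> (\<phi> x)}"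

text \<open>By the next two lemmas \<open>measure \<mu> (bad_set \<dots>)\<close> is never the default value of
  a non-measurable set.\<close>

lemma bad_set_measurable:
  assumes \<mu>: "prob_space \<mu>" and T[measurable]: "T \<in> measurable \<mu> \<mu>"
    and \<phi>[measurable]: "\<And>i. (\<lambda>x. \<phi> x i) \<in> borel_measurable \<mu>"
    and \<phi>k: "\<And>x. \<phi> x \<in> topspace (Euclidean_space k)"
  shows "bad_set \<mu> T k \<phi> \<epsilon> \<delta> \<in> sets \<mu>"
proof -
  interpret prob_space \<mu> by fact
  define D where "D x z = L2_set (\<lambda>i. \<phi> z i - \<phi> x i) {..<k}" for x z
  have [measurable]: "(\<lambda>(x, z). D x z) \<in> borel_measurable (\<mu> \<Otimes>\<^sub>M \<mu>)"
    unfolding D_def L2_set_def by measurable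
  have fib: "fibre \<mu> k \<phi> \<epsilon> (\<phi> x) = {z \<in> space \<mu>. D x z < \<epsilon>}" for x
    using \<phi>k by (auto simp: fibre_def euclid_ball_def euclid_norm_def D_def)
  define I where "I x z = (if D x z < \<epsilon> then 1 else 0 :: real)" for x z
  have I[measurable]: "(\<lambda>(x, z). I x z) \<in> borel_measurable (\<mu> \<Otimes>\<^sub>M \<mu>)"
    unfolding I_def by measurable
  have ind: "indicator (fibre \<mu> k \<phi> \<epsilon> (\<phi> x)) z = I x z" if "z \<in> space \<mu>" for x z
    using that by (simp add: fib I_def)
  have set_int: "(LINT z:fibre \<mu> k \<phi> \<epsilon> (\<phi> x)|\<mu>. f z) = (LINT z|\<mu>. I x z * f z)"
    for x and f :: "'a \<Rightarrow> real"
    unfolding set_lebesgue_integral_def by (rule Bochner_Integration.integral_cong) (auto simp: ind)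
  have meas: "measure \<mu> (fibre \<mu> k \<phi> \<epsilon> (\<phi> x)) = (LINT z|\<mu>. I x z)" if "x \<in> space \<mu>" for x
  proof -
    have "fibre \<mu> k \<phi> \<epsilon> (\<phi> x) \<in> sets \<mu>"
      unfolding fib D_def L2_set_def by measurable
    then have "measure \<mu> (fibre \<mu> k \<phi> \<epsilon> (\<phi> x)) =
        (LINT z|\<mu>. indicator (fibre \<mu> k \<phi> \<epsilon> (\<phi> x)) z)" by simp
    also have "\<dots> = (LINT z|\<mu>. I x z)"
      by (rule Bochner_Integration.integral_cong) (auto simp: ind)
    finally show ?thesis .
  qed
  define m where "m x = (LINT z|\<mu>. I x z)" for x
  have [measurable]: "m \<in> borel_measurable \<mu>"
    unfolding m_def by (rule borel_measurable_lebesgue_integral) (rule I)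
  define c where "c i x = 1 / m x * (LINT z|\<mu>. I x z * \<phi> (T z) i)" for i x
  have [measurable]: "c i \<in> borel_measurable \<mu>" for i
  proof -
    have "(\<lambda>x. LINT z|\<mu>. I x z * \<phi> (T z) i) \<in> borel_measurable \<mu>"
      by (rule borel_measurable_lebesgue_integral) measurable
    then show ?thesis unfolding c_def by measurable
  qed
  define s where "s x = sqrt (1 / m x *
      (LINT z|\<mu>. I x z * (L2_set (\<lambda>i. \<phi> (T z) i - c i x) {..<k})\<^sup>2))" for x
  have "(\<lambda>x. LINT z|\<mu>. I x z * (L2_set (\<lambda>i. \<phi> (T z) i - c i x) {..<k})\<^sup>2) \<in> borel_measurable \<mu>"
    by (rule borel_measurable_lebesgue_integral) (unfold L2_set_def, measurable)
  then have [measurable]: "s \<in> borel_measurable \<mu>" unfolding s_def by measurable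
  have mean: "pred_mean \<mu> T k \<phi> \<epsilon> (\<phi> x) = (\<lambda>i. c i x)" if "x \<in> space \<mu>" for x
    unfolding pred_mean_def c_def set_int meas[OF that] m_def ..
  have err: "pred_error \<mu> T k \<phi> \<epsilon> (\<phi> x) = s x" if "x \<in> space \<mu>" for x
    unfolding pred_error_def s_def set_int meas[OF that] mean[OF that] m_def euclid_norm_def ..
  have "bad_set \<mu> T k \<phi> \<epsilon> \<delta> = {x \<in> space \<mu>. 0 < m x \<and> \<delta> < s x}"
    unfolding bad_set_def using meas err by (auto simp: m_def)
  also have "\<dots> \<in> sets \<mu>" by measurable
  finally show ?thesis .
qed

lemma lipschitz_bad_set_measurable:
  assumes sets: "sets \<mu> = sets (restrict_space borel X)" and \<mu>: "prob_space \<mu>"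
    and T: "T ` X \<subseteq> X" "L-lipschitz_on X T" and h: "h \<in> Lip X"
  shows "bad_set \<mu> T k (delay_map h T k) \<epsilon> \<delta> \<in> sets \<mu>"
proof (rule bad_set_measurable[OF \<mu>])
  have X: "space \<mu> = X" using sets_eq_imp_space_eq[OF sets] by (simp add: space_restrict_space)
  obtain M where M: "M-lipschitz_on X h" using h by (auto simp: Lip_def)
  have cT: "continuous_on X T" and ch: "continuous_on X h"
    using lipschitz_on_continuous_on[OF T(2)] lipschitz_on_continuous_on[OF M] .
  have "T \<in> restrict_space borel X \<rightarrow>\<^sub>M restrict_space borel X"
    by (rule measurable_restrict_space2)
      (use T(1) cT borel_measurable_continuous_on_restrict in \<open>auto simp: space_restrict_space\<close>)
  then show mT: "T \<in> measurable \<mu> \<mu>"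
    unfolding measurable_cong_sets[OF sets sets] .
  have mh: "h \<in> borel_measurable \<mu>"
    unfolding measurable_cong_sets[OF sets refl]
    by (rule borel_measurable_continuous_on_restrict[OF ch])
  have iter: "(T ^^ i) \<in> measurable \<mu> \<mu>" for i
  proof (induction i)
    case 0
    show ?case by (simp add: id_def)
  next
    case (Suc i)
    show ?case unfolding funpow.simps by (rule measurable_comp[OF Suc mT])
  qed
  show "(\<lambda>x. delay_map h T k x i) \<in> borel_measurable \<mu>" for i
    using measurable_compose[OF iter mh] by (cases "i < k") (simp_all add: delay_map_def)
qed (rule delay_map_in_Euclidean_space)

end

theory Submission
  imports Defs
begin

text \<open>
  The probe measure is the law of a random series \<open>\<Sum>j. 2\<^sup>-\<^sup>j * \<alpha>\<^sub>j * p\<^sub>j\<close> with independent coefficients,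
  uniform on \<open>[-1, 1]\<close>, where the \<open>p\<^sub>j\<close> are tent functions around the points of a dense sequence. One
  measure then serves all delays \<open>k\<close> at once.

  Fix \<open>v\<close> and let \<open>h\<close> be \<open>v\<close> plus the series. For \<open>x, y \<in> X\<close> consider the gaps
  \<open>h (T\<^sup>i x) - h (T\<^sup>i y)\<close>. Any linear relation among the formal differences
  \<open>T\<^sup>i x - T\<^sup>i y\<close> for \<open>i < k\<close>, pushed forward by \<open>T\<close>, shows that \<open>k\<close> vanishing gaps force the gap at time
  \<open>k\<close> to vanish. So, by compactness, when the first \<open>k\<close> gaps are small and the gap at time \<open>k\<close> is not, the
  pair \<open>(x, y)\<close> lies in a region where these differences are uniformly independent; there, by elimination
  of one coefficient per gap, all \<open>k\<close> gaps are below \<open>\<epsilon>\<close> with probability at most \<open>C * \<epsilon>\<^sup>k\<close>.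
  Covering \<open>X\<close> (for fixed \<open>x\<close>) or \<open>X \<times> X\<close> by balls of diameter \<open>\<epsilon>\<close> gives the two
  estimates. Periodic points need no separate treatment, since the claim concerns only prediction and
  not injectivity.
\<close>

section \<open>Random coefficients\<close>

text \<open>Prediction can fail only in the last coordinate: the delay vector of \<open>T x\<close>
  repeats observations already present in that of \<open>x\<close>, except at time k. So the bad
  sets lie in divergence sets, which ask for a large gap at time k alone. With N(\<epsilon>) balls,
  the union bound for a fixed x costs N(\<epsilon>) \<epsilon>^k, and for all pairs N(\<epsilon>)^2
  \<epsilon>^k. The second event shrinks with \<epsilon>, so good coverings at arbitrarily small
  scales suffice, whence the lower dimension. A rate at every scale needs the upper dimension, and
  \<theta> pays for summing over dyadic scales. The injective case is deterministic, by compactness.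

  The slab estimate cannot hold with one constant for all pairs, since on the diagonal all gaps
  vanish; restricting to pairs that diverge at time k removes such degenerate pairs. The prevalent
  set must be Borel and serve all \<delta> and \<theta>, so it is cut out by countably many
  conditions on divergence sets, which vary semicontinuously with h.\<close>

definition clip :: "real \<Rightarrow> real" where
  "clip t = max (- 1) (min 1 t)"

lemma abs_clip_le: "\<bar>clip t\<bar> \<le> 1"
  by (auto simp: clip_def)

lemma continuous_on_clip [continuous_intros]:
  "continuous_on A f \<Longrightarrow> continuous_on A (\<lambda>x. clip (f x))"
  unfolding clip_def by (intro continuous_intros)

lemma borel_measurable_clip [measurable (raw)]:
  "f \<in> borel_measurable M \<Longrightarrow> (\<lambda>x. clip (f x)) \<in> borel_measurable M"
  unfolding clip_def by (intro borel_measurable_max borel_measurable_min) auto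

definition unif :: "real measure" where
  "unif = uniform_measure lborel {-1..1}"

text \<open>The sample space consists of all real sequences, so its measurable sets are the Borel
  sets of the product topology. \<open>clip\<close> is the identity on the support [-1, 1] and makes
  the series converge for every sequence.\<close>

definition cube :: "(nat \<Rightarrow> real) measure" where
  "cube = Pi\<^sub>M UNIV (\<lambda>_. unif)"

lemma prob_space_unif: "prob_space unif"
  unfolding unif_def by (rule prob_space_uniform_measure) auto

lemma sets_unif [measurable_cong, simp]: "sets unif = sets borel"
  by (simp add: unif_def)

lemma prob_space_cube: "prob_space cube"
  unfolding cube_def by (rule prob_space_PiM) (rule prob_space_unif)

lemma sets_cube [measurable_cong]: "sets cube = sets borel"
proof -
  have "sets cube = sets (Pi\<^sub>M UNIV (\<lambda>_::nat. borel :: real measure))"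
    unfolding cube_def by (rule sets_PiM_cong) auto
  then show ?thesis by (simp add: sets_PiM_equal_borel)
qed

lemma space_cube [simp]: "space cube = UNIV"
  using sets_eq_imp_space_eq[OF sets_cube] by simp

text \<open>On the support the clip disappears and the set lies in an interval of length
  2\<epsilon>/|a|; the density 1/2 cancels the factor 2.\<close>

lemma emeasure_unif_slab:
  assumes "a \<noteq> 0"
  shows "emeasure unif {t. \<bar>b + a * (clip t - s)\<bar> < \<epsilon>} \<le> ennreal (\<epsilon> / \<bar>a\<bar>)"
proof (cases "\<epsilon> \<le> 0")
  case True
  then have "{t. \<bar>b + a * (clip t - s)\<bar> < \<epsilon>} = {}" by auto
  then show ?thesis by simp
next
  case False
  then have eps: "0 < \<epsilon>" by simp
  let ?S = "{t. \<bar>b + a * (clip t - s)\<bar> < \<epsilon>}"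
  let ?c = "s - b / a" and ?r = "\<epsilon> / \<bar>a\<bar>"
  have [measurable]: "?S \<in> sets borel"
  proof -
    have "{t \<in> space borel. \<bar>b + a * (clip t - s)\<bar> < \<epsilon>} \<in> sets borel" by measurable
    then show ?thesis by simp
  qed
  have sub: "{-1..1} \<inter> ?S \<subseteq> {?c - ?r..?c + ?r}"
  proof
    fix t assume t: "t \<in> {-1..1} \<inter> ?S"
    then have "clip t = t" by (auto simp: clip_def)
    with t have "\<bar>b + a * (t - s)\<bar> < \<epsilon>" by auto
    moreover have "b + a * (t - s) = a * (t - ?c)" using assms by (simp add: field_simps)
    ultimately have "\<bar>a\<bar> * \<bar>t - ?c\<bar> < \<epsilon>" by (simp add: abs_mult)
    then have "\<bar>t - ?c\<bar> < ?r" using assms by (simp add: field_simps)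
    then have "?c - ?r \<le> t" "t \<le> ?c + ?r" by linarith+
    then show "t \<in> {?c - ?r..?c + ?r}" by simp
  qed
  have "emeasure unif ?S = emeasure lborel ({-1..1} \<inter> ?S) / ennreal 2"
    unfolding unif_def by (subst emeasure_uniform_measure) auto
  also have "\<dots> \<le> emeasure lborel {?c - ?r..?c + ?r} / ennreal 2"
    by (intro divide_right_mono_ennreal emeasure_mono sub) auto
  also have "\<dots> = ennreal (2 * ?r) / ennreal 2"
    using eps by (subst emeasure_lborel_Icc) auto
  also have "\<dots> = ennreal ?r"
    using eps by (subst divide_ennreal) auto
  finally show ?thesis .
qed

text \<open>The coordinate \<open>j\<close> is integrated out first: \<open>A\<close> does not see it, and \<open>F\<close> is affine in it.\<close>

lemma emeasure_cube_slab:
  assumes A: "A \<in> sets cube" and indep: "\<And>\<alpha> t. \<alpha>(j := t) \<in> A \<longleftrightarrow> \<alpha> \<in> A"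
    and F[measurable]: "F \<in> borel_measurable cube"
    and slope: "\<And>\<alpha> s t. F (\<alpha>(j := t)) = F (\<alpha>(j := s)) + a * (clip t - clip s)"
    and a: "a \<noteq> 0"
  shows "emeasure cube (A \<inter> {\<alpha>. \<bar>F \<alpha>\<bar> < \<epsilon>}) \<le> ennreal (\<epsilon> / \<bar>a\<bar>) * emeasure cube A"
proof -
  let ?N = "Pi\<^sub>M (UNIV - {j}) (\<lambda>_. unif)"
  let ?f = "\<lambda>(x, X). X(j := x)"
  interpret U: prob_space unif by (rule prob_space_unif)
  interpret N: prob_space ?N by (rule prob_space_PiM) (rule prob_space_unif)
  interpret pair_sigma_finite unif ?N ..
  have ins: "insert j (UNIV - {j}) = UNIV" by auto
  \<comment> \<open>\<open>cube\<close> is the law of a sequence whose coordinate \<open>j\<close>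
    is drawn independently of the others.\<close>
  have distr: "distr (unif \<Otimes>\<^sub>M ?N) cube ?f = cube"
    using distr_pair_PiM_eq_PiM[of "UNIV - {j}" "\<lambda>_. unif" j, OF prob_space_unif prob_space_unif]
    unfolding cube_def ins by simp
  have f[measurable]: "?f \<in> unif \<Otimes>\<^sub>M ?N \<rightarrow>\<^sub>M cube"
    unfolding cube_def using measurable_fun_upd[where I=UNIV and J="UNIV - {j}" and i=j]
    by (auto simp: case_prod_beta' intro!: measurable_fun_upd[where J="UNIV - {j}"])
  have sec: "emeasure cube B = (\<integral>\<^sup>+ X. emeasure unif {x. X(j := x) \<in> B} \<partial>?N)"
    if B: "B \<in> sets cube" for B
  proof -
    have "emeasure cube B = emeasure (distr (unif \<Otimes>\<^sub>M ?N) cube ?f) B" by (simp add: distr)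
    also have "\<dots> = emeasure (unif \<Otimes>\<^sub>M ?N) (?f -` B \<inter> space (unif \<Otimes>\<^sub>M ?N))"
      by (rule emeasure_distr[OF f B])
    also have "\<dots> = (\<integral>\<^sup>+ X. emeasure unif ((\<lambda>x. (x, X)) -` (?f -` B \<inter> space (unif \<Otimes>\<^sub>M ?N))) \<partial>?N)"
      by (rule emeasure_pair_measure_alt2) (rule measurable_sets[OF f B])
    also have "\<dots> = (\<integral>\<^sup>+ X. emeasure unif {x. X(j := x) \<in> B} \<partial>?N)"
    proof (rule nn_integral_cong)
      fix X assume "X \<in> space ?N"
      moreover have "space unif = UNIV" using sets_eq_imp_space_eq[OF sets_unif] by simp
      ultimately have "(\<lambda>x. (x, X)) -` (?f -` B \<inter> space (unif \<Otimes>\<^sub>M ?N)) = {x. X(j := x) \<in> B}"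
        by (auto simp: space_pair_measure)
      then show "emeasure unif ((\<lambda>x. (x, X)) -` (?f -` B \<inter> space (unif \<Otimes>\<^sub>M ?N))) =
          emeasure unif {x. X(j := x) \<in> B}" by simp
    qed
    finally show ?thesis .
  qed
  let ?S = "{\<alpha>. \<bar>F \<alpha>\<bar> < \<epsilon>}"
  have S: "?S \<in> sets cube"
  proof -
    have "{\<alpha> \<in> space cube. \<bar>F \<alpha>\<bar> < \<epsilon>} \<in> sets cube" by measurable
    then show ?thesis by simp
  qed
  have meas: "(\<lambda>X. emeasure unif {x. X(j := x) \<in> A}) \<in> borel_measurable ?N"
  proof -
    have "(\<lambda>X. emeasure unif ((\<lambda>x. (x, X)) -` (?f -` A \<inter> space (unif \<Otimes>\<^sub>M ?N)))) \<in> borel_measurable ?N"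
      by (rule measurable_emeasure_Pair2) (rule measurable_sets[OF f A])
    moreover have "emeasure unif ((\<lambda>x. (x, X)) -` (?f -` A \<inter> space (unif \<Otimes>\<^sub>M ?N))) =
        emeasure unif {x. X(j := x) \<in> A}" if "X \<in> space ?N" for X
    proof -
      have "space unif = UNIV" using sets_eq_imp_space_eq[OF sets_unif] by simp
      with that have "(\<lambda>x. (x, X)) -` (?f -` A \<inter> space (unif \<Otimes>\<^sub>M ?N)) = {x. X(j := x) \<in> A}"
        by (auto simp: space_pair_measure)
      then show ?thesis by simp
    qed
    ultimately show ?thesis by (subst (asm) measurable_cong) auto
  qed
  have "emeasure cube (A \<inter> ?S) = (\<integral>\<^sup>+ X. emeasure unif {x. X(j := x) \<in> A \<inter> ?S} \<partial>?N)"
    using A S by (intro sec) auto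
  also have "\<dots> \<le> (\<integral>\<^sup>+ X. ennreal (\<epsilon> / \<bar>a\<bar>) * emeasure unif {x. X(j := x) \<in> A} \<partial>?N)"
  proof (rule nn_integral_mono)
    fix X
    show "emeasure unif {x. X(j := x) \<in> A \<inter> ?S} \<le> ennreal (\<epsilon> / \<bar>a\<bar>) * emeasure unif {x. X(j := x) \<in> A}"
    \<comment> \<open>By \<open>indep\<close> the section of \<open>A\<close> over \<open>X\<close>
      is the whole line or empty; in the first case only a slab in the coordinate \<open>j\<close>
      remains.\<close>
    proof (cases "X \<in> A")
      case True
      then have "{x. X(j := x) \<in> A} = space unif"
        using sets_eq_imp_space_eq[OF sets_unif] indep by auto
      moreover have "{x. X(j := x) \<in> A \<inter> ?S} = {x. \<bar>F (X(j := 0)) + a * (clip x - clip 0)\<bar> < \<epsilon>}"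
      proof (rule Collect_cong)
        fix x
        have "F (X(j := x)) = F (X(j := 0)) + a * (clip x - clip 0)" by (rule slope)
        with True indep show "X(j := x) \<in> A \<inter> ?S \<longleftrightarrow> \<bar>F (X(j := 0)) + a * (clip x - clip 0)\<bar> < \<epsilon>"
          by (metis (no_types, lifting) IntI IntD2 mem_Collect_eq)
      qed
      ultimately show ?thesis
        using emeasure_unif_slab[OF a, of "F (X(j := 0))" "clip 0" \<epsilon>] by (simp add: U.emeasure_space_1)
    next
      case False
      then show ?thesis by (simp add: indep)
    qed
  qed
  also have "\<dots> = ennreal (\<epsilon> / \<bar>a\<bar>) * emeasure cube A"
    unfolding sec[OF A] by (rule nn_integral_cmult[OF meas])
  finally show ?thesis .
qed

text \<open>Gaussian elimination: a pivot coordinate of the row \<open>i0\<close> is eliminated from the other rows, which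
  preserves their independence in the limit along \<open>G\<close>.\<close>

lemma emeasure_cube_independent_slabs:
  fixes a :: "'i \<Rightarrow> nat \<Rightarrow> 'z \<Rightarrow> real" and F :: "'i \<Rightarrow> 'z \<Rightarrow> (nat \<Rightarrow> real) \<Rightarrow> real"
  assumes "finite I"
    and "\<And>i j. i \<in> I \<Longrightarrow> (a i j \<longlongrightarrow> a0 i j) G"
    and "\<And>c. \<forall>j. (\<Sum>i\<in>I. c i * a0 i j) = 0 \<Longrightarrow> \<forall>i\<in>I. c i = 0"
    and "\<And>i z. i \<in> I \<Longrightarrow> F i z \<in> borel_measurable cube"
    and "\<And>i z \<alpha> j s t. i \<in> I \<Longrightarrow> F i z (\<alpha>(j := t)) = F i z (\<alpha>(j := s)) + a i j z * (clip t - clip s)"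
  shows "\<exists>C>0. \<forall>\<^sub>F z in G. \<forall>\<epsilon>>0. emeasure cube {\<alpha>. \<forall>i\<in>I. \<bar>F i z \<alpha>\<bar> < \<epsilon>} \<le> ennreal (C * \<epsilon> ^ card I)"
  using assms
proof (induction I arbitrary: a a0 F rule: finite_induct)
  case empty
  interpret prob_space cube by (rule prob_space_cube)
  show ?case by (intro exI[of _ 1]) (simp add: emeasure_space_1[simplified])
next
  case (insert i0 I)
  note lim = insert.prems(1) and ind = insert.prems(2) and meas = insert.prems(3)
    and slope = insert.prems(4)
  \<comment> \<open>A zero row would be a nontrivial relation by itself, so the limit row has a
    pivot.\<close>
  have "\<exists>j. a0 i0 j \<noteq> 0"
  proof (rule ccontr)
    assume "\<not> ?thesis"
    then have "\<forall>j. (\<Sum>i\<in>insert i0 I. (if i = i0 then 1 else 0) * a0 i j) = 0"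
      by (auto intro!: sum.neutral)
    from ind[OF this] show False by simp
  qed
  then obtain j where j: "a0 i0 j \<noteq> 0" by blast
  define r where "r i z = a i j z / a i0 j z" for i z
  define r0 where "r0 i = a0 i j / a0 i0 j" for i
  have r: "(r i \<longlongrightarrow> r0 i) G" if "i \<in> I" for i
    unfolding r_def[abs_def] r0_def using that j by (intro tendsto_divide lim) auto
  let ?a = "\<lambda>i l z. a i l z - r i z * a i0 l z" and ?d = "\<lambda>i l. a0 i l - r0 i * a0 i0 l"
  let ?F = "\<lambda>i z \<alpha>. F i z \<alpha> - r i z * F i0 z \<alpha>"
  have "\<exists>C>0. \<forall>\<^sub>F z in G. \<forall>\<epsilon>>0. emeasure cube {\<alpha>. \<forall>i\<in>I. \<bar>?F i z \<alpha>\<bar> < \<epsilon>} \<le> ennreal (C * \<epsilon> ^ card I)"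
  proof (rule insert.IH)
    show "(?a i l \<longlongrightarrow> ?d i l) G" if "i \<in> I" for i l
      using that by (intro tendsto_diff tendsto_mult lim r) auto
    show "\<forall>i\<in>I. c i = 0" if c: "\<forall>l. (\<Sum>i\<in>I. c i * ?d i l) = 0" for c
    proof -
      \<comment> \<open>A relation among the reduced rows becomes one among the original rows once
        \<open>i0\<close> receives the subtracted multiples as its coefficient.\<close>
      let ?c = "c(i0 := - (\<Sum>i\<in>I. c i * r0 i))"
      have "(\<Sum>i\<in>insert i0 I. ?c i * a0 i l) = 0" for l
      proof -
        have "(\<Sum>i\<in>insert i0 I. ?c i * a0 i l) = - (\<Sum>i\<in>I. c i * r0 i) * a0 i0 l + (\<Sum>i\<in>I. ?c i * a0 i l)"
          using insert.hyps by simp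
        also have "(\<Sum>i\<in>I. ?c i * a0 i l) = (\<Sum>i\<in>I. c i * a0 i l)"
          using insert.hyps by (intro sum.cong) auto
        also have "- (\<Sum>i\<in>I. c i * r0 i) * a0 i0 l + \<dots> = (\<Sum>i\<in>I. c i * ?d i l)"
          by (simp add: right_diff_distrib sum_subtractf sum_distrib_right mult.assoc)
        finally show ?thesis using c by simp
      qed
      then have "\<forall>i\<in>insert i0 I. ?c i = 0" by (intro ind) blast
      then show ?thesis using insert.hyps by (metis fun_upd_other insertCI)
    qed
    show "?F i z \<in> borel_measurable cube" if "i \<in> I" for i z
      using that by (intro borel_measurable_diff borel_measurable_times meas) auto
    show "?F i z (\<alpha>(l := t)) = ?F i z (\<alpha>(l := s)) + ?a i l z * (clip t - clip s)"
      if i: "i \<in> I" for i z \<alpha> l s t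
    proof -
      have "F i z (\<alpha>(l := t)) = F i z (\<alpha>(l := s)) + a i l z * (clip t - clip s)"
        and "F i0 z (\<alpha>(l := t)) = F i0 z (\<alpha>(l := s)) + a i0 l z * (clip t - clip s)"
        using i by - (rule slope, simp)+
      then show ?thesis by (simp only:) (simp add: algebra_simps)
    qed
  qed
  then obtain C where C: "C > 0" and ev: "\<forall>\<^sub>F z in G. \<forall>\<epsilon>>0.
      emeasure cube {\<alpha>. \<forall>i\<in>I. \<bar>?F i z \<alpha>\<bar> < \<epsilon>} \<le> ennreal (C * \<epsilon> ^ card I)" by blast
  \<comment> \<open>The sum exceeds every limit |r0 i| strictly, thanks to the summand 1, so it
    eventually bounds every |r i z|.\<close>
  define R where "R = (\<Sum>i\<in>I. \<bar>r0 i\<bar> + 1)"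
  have R0: "R \<ge> 0" unfolding R_def by (intro sum_nonneg) auto
  have evR: "\<forall>\<^sub>F z in G. \<forall>i\<in>I. \<bar>r i z\<bar> \<le> R"
  proof (intro eventually_ball_finite insert.hyps ballI)
    fix i assume i: "i \<in> I"
    have "\<bar>r0 i\<bar> + 1 \<le> R"
      unfolding R_def using i insert.hyps by (intro member_le_sum) auto
    moreover have "\<forall>\<^sub>F z in G. \<bar>r i z\<bar> < \<bar>r0 i\<bar> + 1"
      using r[OF i] by (intro order_tendstoD(2)[OF tendsto_rabs]) auto
    ultimately show "\<forall>\<^sub>F z in G. \<bar>r i z\<bar> \<le> R" by (auto elim!: eventually_mono)
  qed
  \<comment> \<open>Half of the limiting pivot is eventually a lower bound for the actual
    pivots.\<close>
  define c where "c = \<bar>a0 i0 j\<bar> / 2"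
  have c: "c > 0" using j by (simp add: c_def)
  have evc: "\<forall>\<^sub>F z in G. c < \<bar>a i0 j z\<bar>"
    using j unfolding c_def by (intro order_tendstoD(1)[OF tendsto_rabs[OF lim]]) auto
  show ?case
  proof (intro exI[of _ "C * (1 + R) ^ card I / c"] conjI)
    show "C * (1 + R) ^ card I / c > 0" using C R0 c by simp
    show "\<forall>\<^sub>F z in G. \<forall>\<epsilon>>0. emeasure cube {\<alpha>. \<forall>i\<in>insert i0 I. \<bar>F i z \<alpha>\<bar> < \<epsilon>}
        \<le> ennreal (C * (1 + R) ^ card I / c * \<epsilon> ^ card (insert i0 I))"
      using ev evR evc
    proof eventually_elim
      case (elim z)
      show ?case
      proof (intro allI impI)
        fix \<epsilon> :: real assume eps: "\<epsilon> > 0"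
        have nz: "a i0 j z \<noteq> 0" using elim(3) c by auto
        \<comment> \<open>Rows below \<epsilon> have reduced rows below (1 + R) \<epsilon>, since
          the multipliers are at most R.\<close>
        let ?A = "{\<alpha>. \<forall>i\<in>I. \<bar>?F i z \<alpha>\<bar> < (1 + R) * \<epsilon>}"
        have F0[measurable]: "F i0 z \<in> borel_measurable cube" by (rule meas) simp
        have A: "?A \<in> sets cube"
        proof -
          have "{\<alpha> \<in> space cube. \<forall>i\<in>I. \<bar>?F i z \<alpha>\<bar> < (1 + R) * \<epsilon>} \<in> sets cube"
            using insert.hyps
          proof (intro sets.sets_Collect_finite_All)
            fix i assume "i \<in> I"
            then have [measurable]: "F i z \<in> borel_measurable cube" by (intro meas) simp
            show "{\<alpha> \<in> space cube. \<bar>?F i z \<alpha>\<bar> < (1 + R) * \<epsilon>} \<in> sets cube" by measurable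
          qed
          then show ?thesis by simp
        qed
        \<comment> \<open>The quotient \<open>r\<close> is chosen to give the reduced rows slope 0
          in the pivot coordinate, so \<open>?A\<close> does not see it and the slab lemma
          applies.\<close>
        have const: "?F i z (\<alpha>(j := t)) = ?F i z \<alpha>" if i: "i \<in> I" for i \<alpha> t
        proof -
          have "F i z (\<alpha>(j := t)) = F i z (\<alpha>(j := \<alpha> j)) + a i j z * (clip t - clip (\<alpha> j))"
            and "F i0 z (\<alpha>(j := t)) = F i0 z (\<alpha>(j := \<alpha> j)) + a i0 j z * (clip t - clip (\<alpha> j))"
            using i by - (rule slope, simp)+
          then show ?thesis using nz unfolding r_def fun_upd_triv by (simp only:) (simp add: field_simps)
        qed
        have "{\<alpha>. \<forall>i\<in>insert i0 I. \<bar>F i z \<alpha>\<bar> < \<epsilon>} \<subseteq> ?A \<inter> {\<alpha>. \<bar>F i0 z \<alpha>\<bar> < \<epsilon>}"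
        proof safe
          fix \<alpha> i assume \<alpha>: "\<forall>i\<in>insert i0 I. \<bar>F i z \<alpha>\<bar> < \<epsilon>" and i: "i \<in> I"
          have "\<bar>r i z * F i0 z \<alpha>\<bar> \<le> R * \<epsilon>"
            unfolding abs_mult using elim(2) i \<alpha> R0 by (intro mult_mono) (auto simp: less_imp_le)
          moreover have "\<bar>F i z \<alpha>\<bar> < \<epsilon>" using \<alpha> i by simp
          ultimately show "\<bar>?F i z \<alpha>\<bar> < (1 + R) * \<epsilon>" by (simp add: distrib_right)
        qed auto
        then have "emeasure cube {\<alpha>. \<forall>i\<in>insert i0 I. \<bar>F i z \<alpha>\<bar> < \<epsilon>}
            \<le> emeasure cube (?A \<inter> {\<alpha>. \<bar>F i0 z \<alpha>\<bar> < \<epsilon>})"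
        proof (rule emeasure_mono)
          have "{\<alpha> \<in> space cube. \<bar>F i0 z \<alpha>\<bar> < \<epsilon>} \<in> sets cube" by measurable
          then show "?A \<inter> {\<alpha>. \<bar>F i0 z \<alpha>\<bar> < \<epsilon>} \<in> sets cube" using A by simp
        qed
        also have "\<dots> \<le> ennreal (\<epsilon> / \<bar>a i0 j z\<bar>) * emeasure cube ?A"
          by (rule emeasure_cube_slab[OF A _ F0 slope nz]) (auto simp: const)
        also have "\<dots> \<le> ennreal (\<epsilon> / c) * ennreal (C * ((1 + R) * \<epsilon>) ^ card I)"
          using elim(1,3) eps R0 c
          by (intro mult_mono ennreal_leI divide_left_mono) auto
        also have "\<dots> = ennreal (C * (1 + R) ^ card I / c * \<epsilon> ^ card (insert i0 I))"
          unfolding power_mult_distrib using eps R0 c C insert.hyps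
          by (subst ennreal_mult[symmetric]) auto
        finally show "emeasure cube {\<alpha>. \<forall>i\<in>insert i0 I. \<bar>F i z \<alpha>\<bar> < \<epsilon>}
            \<le> ennreal (C * (1 + R) ^ card I / c * \<epsilon> ^ card (insert i0 I))" .
      qed
    qed
  qed
qed

section \<open>Tent functions and the random series\<close>

text \<open>The index codes a centre \<open>D m\<close> and a radius 1/(n+1). Height equals radius,
  so every tent is 1-Lipschitz with values in [0, 1], uniformly in \<open>j\<close>.\<close>

definition tent :: "(nat \<Rightarrow> 'a::metric_space) \<Rightarrow> nat \<Rightarrow> 'a \<Rightarrow> real" where
  "tent D j x = (case prod_decode j of (m, n) \<Rightarrow> max 0 (1 / (real n + 1) - dist x (D m)))"

lemma tent_nonneg: "0 \<le> tent D j x"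
  by (simp add: tent_def split: prod.split)

lemma tent_le_1: "tent D j x \<le> 1"
proof -
  have "1 / (real n + 1) - dist x y \<le> 1" for n y
    using zero_le_dist[of x y] by (simp add: divide_le_eq add_increasing2 algebra_simps)
  then show ?thesis by (simp add: tent_def split: prod.split)
qed

lemma tent_lipschitz: "\<bar>tent D j x - tent D j y\<bar> \<le> dist x y"
proof -
  have "\<bar>max 0 (c - dist x z) - max 0 (c - dist y z)\<bar> \<le> dist x y" for c z
    using dist_triangle[of x z y] dist_triangle3[of y z x] by (auto simp: max_def dist_commute)
  then show ?thesis by (simp add: tent_def split: prod.split)
qed

lemma continuous_on_tent [continuous_intros]:
  "continuous_on A f \<Longrightarrow> continuous_on A (\<lambda>x. tent D j (f x))"
  unfolding tent_def case_prod_beta by (intro continuous_intros)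

lemma dense_sequence_exists:
  "\<exists>D :: nat \<Rightarrow> 'a::second_countable_topology. \<forall>S. open S \<longrightarrow> S \<noteq> {} \<longrightarrow> (\<exists>m. D m \<in> S)"
proof -
  obtain B :: "'a set" where B: "countable B" "\<And>S. open S \<Longrightarrow> S \<noteq> {} \<Longrightarrow> \<exists>d\<in>B. d \<in> S"
    using countable_dense_setE by metis
  have "B \<noteq> {}" using B(2)[of UNIV] by auto
  then have "range (from_nat_into B) = B" using B(1) by (rule range_from_nat_into)
  then show ?thesis using B(2) by (intro exI[of _ "from_nat_into B"]) (metis imageE)
qed

lemma tent_isolates:
  assumes D: "\<forall>S. open S \<longrightarrow> S \<noteq> {} \<longrightarrow> (\<exists>m. D m \<in> S)" and P: "finite P"
  shows "\<exists>j. 0 < tent D j w \<and> (\<forall>u\<in>P - {w}. tent D j u = 0)"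
proof -
  obtain d where d: "d > 0" "\<forall>u\<in>P. u \<noteq> w \<longrightarrow> d \<le> dist w u"
    using finite_set_avoid[OF P] by blast
  \<comment> \<open>Two radii fit into the distance \<open>d\<close>: \<open>w\<close> lies within
    one radius of the centre, so all other points stay at least one radius away from it.\<close>
  obtain n where n: "2 / d < real n" using reals_Archimedean2 by blast
  have pos: "0 < 1 / (real n + 1)" by simp
  have n': "2 / (real n + 1) \<le> d"
    using n d(1) by (simp add: field_simps)
  obtain m where m: "D m \<in> ball w (1 / (real n + 1))"
    using D[rule_format, of "ball w (1 / (real n + 1))"] pos by force
  have "0 < tent D (prod_encode (m, n)) w"
    using m by (simp add: tent_def)
  moreover have "tent D (prod_encode (m, n)) u = 0" if u: "u \<in> P - {w}" for u
  proof -
    have "2 / (real n + 1) \<le> dist w u" using d(2) u n' by force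
    also have "\<dots> \<le> dist w (D m) + dist u (D m)" by (rule dist_triangle2)
    finally have "1 / (real n + 1) + 1 / (real n + 1) \<le> dist w (D m) + dist u (D m)"
      by (simp add: add_divide_distrib[symmetric])
    then show ?thesis using m by (simp add: tent_def)
  qed
  ultimately show ?thesis by blast
qed

text \<open>Tents separate the points of any finite set, so a relation satisfied by all tents
  already holds between formal sums of points and passes to every \<open>f\<close>.\<close>

lemma tent_relation:
  fixes p q :: "'i \<Rightarrow> 'a::metric_space"
  assumes D: "\<forall>S. open S \<longrightarrow> S \<noteq> {} \<longrightarrow> (\<exists>m. D m \<in> S)" and I: "finite I"
    and rel: "\<And>j. (\<Sum>i\<in>I. c i * (tent D j (p i) - tent D j (q i))) = 0"
  shows "(\<Sum>i\<in>I. c i * (f (p i) - f (q i))) = (0::real)"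
proof -
  define P where "P = p ` I \<union> q ` I"
  have P: "finite P" using I by (simp add: P_def)
  \<comment> \<open>The net weight of the point \<open>w\<close>: several of the \<open>p i\<close>
    and \<open>q i\<close> may coincide, as on periodic or merging orbits.\<close>
  define l where "l w = (\<Sum>i\<in>I. c i * ((if p i = w then 1 else 0) - (if q i = w then 1 else 0)))" for w
  have eq: "(\<Sum>i\<in>I. c i * (f (p i) - f (q i))) = (\<Sum>w\<in>P. l w * f w)" for f :: "'a \<Rightarrow> real"
  proof -
    have "(\<Sum>w\<in>P. l w * f w) = (\<Sum>i\<in>I. c i * (\<Sum>w\<in>P. (if p i = w then f w else 0) - (if q i = w then f w else 0)))"
      unfolding l_def sum_distrib_right sum_distrib_left
      by (subst sum.swap) (intro sum.cong, auto)
    also have "\<dots> = (\<Sum>i\<in>I. c i * (f (p i) - f (q i)))"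
      using P by (intro sum.cong) (auto simp: sum_subtractf P_def)
    finally show ?thesis by simp
  qed
  have "l w = 0" if w: "w \<in> P" for w
  proof -
    obtain j where j: "0 < tent D j w" "\<forall>u\<in>P - {w}. tent D j u = 0"
      using tent_isolates[OF D P] by blast
    have "0 = (\<Sum>u\<in>P. l u * tent D j u)" using rel[of j] eq[of "tent D j"] by simp
    also have "\<dots> = l w * tent D j w" using j(2) P w by (subst sum.remove[of _ w]) auto
    finally show ?thesis using j(1) by simp
  qed
  then show ?thesis unfolding eq by simp
qed

text \<open>If \<open>m\<close> is the last index with \<open>c m \<noteq> 0\<close>, the relation is applied to \<open>h \<circ> T\<^sup>k\<^sup>-\<^sup>m\<close>: every term but
  that of \<open>m\<close> involves a time below \<open>k\<close>.\<close>

lemma orbit_relation_determines_next: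
  fixes T :: "'a::metric_space \<Rightarrow> 'a" and h :: "'a \<Rightarrow> real"
  assumes D: "\<forall>S. open S \<longrightarrow> S \<noteq> {} \<longrightarrow> (\<exists>m. D m \<in> S)"
    and rel: "\<And>j. (\<Sum>i<k. c i * (tent D j ((T ^^ i) x) - tent D j ((T ^^ i) y))) = 0"
    and nontrivial: "i0 < k" "c i0 \<noteq> 0"
    and eq: "\<And>i. i < k \<Longrightarrow> h ((T ^^ i) x) = h ((T ^^ i) y)"
  shows "h ((T ^^ k) x) = h ((T ^^ k) y)"
proof -
  define m where "m = Max {i. i < k \<and> c i \<noteq> 0}"
  have fin: "finite {i. i < k \<and> c i \<noteq> 0}" by simp
  have "m \<in> {i. i < k \<and> c i \<noteq> 0}" unfolding m_def using nontrivial by (intro Max_in fin) auto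
  then have m: "m < k" "c m \<noteq> 0" by auto
  have max: "c i = 0" if "m < i" "i < k" for i
    using Max_ge[OF fin, of i] that unfolding m_def[symmetric] by fastforce
  have comp: "(h \<circ> (T ^^ (k - m))) ((T ^^ i) z) = h ((T ^^ (i + (k - m))) z)" for i z
    unfolding add.commute[of i] funpow_add comp_def ..
  have "0 = (\<Sum>i<k. c i * ((h \<circ> (T ^^ (k - m))) ((T ^^ i) x) - (h \<circ> (T ^^ (k - m))) ((T ^^ i) y)))"
    by (rule tent_relation[OF D finite_lessThan rel, symmetric])
  also have "\<dots> = c m * (h ((T ^^ k) x) - h ((T ^^ k) y))"
  proof (subst sum.remove[of _ m])
    have "(\<Sum>i\<in>{..<k} - {m}. c i * ((h \<circ> (T ^^ (k - m))) ((T ^^ i) x) - (h \<circ> (T ^^ (k - m))) ((T ^^ i) y))) = 0"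
    proof (intro sum.neutral ballI)
      fix i assume i: "i \<in> {..<k} - {m}"
      show "c i * ((h \<circ> (T ^^ (k - m))) ((T ^^ i) x) - (h \<circ> (T ^^ (k - m))) ((T ^^ i) y)) = 0"
      proof (cases "i < m")
        case True
        then show ?thesis unfolding comp using m(1) by (simp add: eq)
      next
        case False
        then show ?thesis using i by (simp add: max)
      qed
    qed
    then show "c m * ((h \<circ> (T ^^ (k - m))) ((T ^^ m) x) - (h \<circ> (T ^^ (k - m))) ((T ^^ m) y)) +
      (\<Sum>i\<in>{..<k} - {m}. c i * ((h \<circ> (T ^^ (k - m))) ((T ^^ i) x) - (h \<circ> (T ^^ (k - m))) ((T ^^ i) y)))
      = c m * (h ((T ^^ k) x) - h ((T ^^ k) y))"
      unfolding comp using m(1) by simp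
  qed (use m in auto)
  finally show ?thesis using m(2) by simp
qed

section \<open>The random series and its dependence on coefficients and points\<close>

definition probe :: "(nat \<Rightarrow> 'a::metric_space) \<Rightarrow> (nat \<Rightarrow> real) \<Rightarrow> 'a \<Rightarrow> real" where
  "probe D \<alpha> x = (\<Sum>j. (1 / 2) ^ j * clip (\<alpha> j) * tent D j x)"

text \<open>A pseudometric on coefficients, continuous for the product topology. As tents are
  bounded by 1 and 1-Lipschitz, it dominates both the supremum and the Lipschitz constant of a
  difference of two probes.\<close>

definition clip_dist :: "(nat \<Rightarrow> real) \<Rightarrow> (nat \<Rightarrow> real) \<Rightarrow> real" where
  "clip_dist \<alpha> \<beta> = (\<Sum>j. (1 / 2) ^ j * \<bar>clip (\<alpha> j) - clip (\<beta> j)\<bar>)"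

lemma probe_term_le: "\<bar>(1 / 2) ^ j * clip (\<alpha> j) * tent D j x\<bar> \<le> (1 / 2) ^ j"
proof -
  have "\<bar>clip (\<alpha> j)\<bar> * \<bar>tent D j x\<bar> \<le> 1 * 1"
    using tent_nonneg[of D j x] tent_le_1[of D j x] by (intro mult_mono abs_clip_le) auto
  then have "(1 / 2) ^ j * (\<bar>clip (\<alpha> j)\<bar> * \<bar>tent D j x\<bar>) \<le> (1 / 2) ^ j * 1"
    by (intro mult_left_mono) simp_all
  then show ?thesis by (simp add: abs_mult mult.assoc)
qed

lemma summable_geometric_half: "summable (\<lambda>j. (1 / 2 :: real) ^ j * c)"
  by (intro summable_mult2 summable_geometric) simp

lemma summable_probe: "summable (\<lambda>j. (1 / 2) ^ j * clip (\<alpha> j) * tent D j x)"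
  by (rule summable_comparison_test'[OF summable_geometric_half[of 1], of 0])
    (simp add: probe_term_le del: abs_mult)

lemma clip_dist_term_le: "\<bar>(1 / 2) ^ j * \<bar>clip (\<alpha> j) - clip (\<beta> j)\<bar>\<bar> \<le> (1 / 2) ^ j * 2"
proof -
  have "\<bar>clip (\<alpha> j) - clip (\<beta> j)\<bar> \<le> 2"
    using abs_clip_le[of "\<alpha> j"] abs_clip_le[of "\<beta> j"] by linarith
  then show ?thesis by (simp add: abs_mult)
qed

lemma summable_clip_dist: "summable (\<lambda>j. (1 / 2) ^ j * \<bar>clip (\<alpha> j) - clip (\<beta> j)\<bar>)"
  by (rule summable_comparison_test'[OF summable_geometric_half[of 2], of 0])
    (simp only: real_norm_def clip_dist_term_le)

lemma clip_dist_nonneg: "0 \<le> clip_dist \<alpha> \<beta>"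
  unfolding clip_dist_def by (intro suminf_nonneg summable_clip_dist) simp

lemma clip_dist_le: "clip_dist \<alpha> \<beta> \<le> 4"
proof -
  have "clip_dist \<alpha> \<beta> \<le> (\<Sum>j. (1 / 2) ^ j * 2)"
    unfolding clip_dist_def
  proof (rule suminf_le[OF _ summable_clip_dist summable_geometric_half])
    show "(1 / 2) ^ j * \<bar>clip (\<alpha> j) - clip (\<beta> j)\<bar> \<le> (1 / 2) ^ j * 2" for j
      using clip_dist_term_le[of j \<alpha> \<beta>] by linarith
  qed
  also have "\<dots> = 4"
    using suminf_mult2[OF summable_geometric[of "1 / 2 :: real"], of 2]
      suminf_geometric[of "1 / 2 :: real"] by simp
  finally show ?thesis .
qed

lemma clip_dist_refl [simp]: "clip_dist \<alpha> \<alpha> = 0"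
  by (simp add: clip_dist_def)

lemma probe_zero [simp]: "probe D (\<lambda>_. 0) x = 0"
  by (simp add: probe_def clip_def)

lemma clip_clip [simp]: "clip (clip t) = clip t"
  by (simp add: clip_def)

lemma probe_clip [simp]: "probe D (\<lambda>j. clip (\<alpha> j)) x = probe D \<alpha> x"
  by (simp add: probe_def)

lemma probe_diff_le:
  "\<bar>probe D \<alpha> x - probe D \<beta> x\<bar> \<le> clip_dist \<alpha> \<beta>"
  "\<bar>(probe D \<alpha> x - probe D \<beta> x) - (probe D \<alpha> y - probe D \<beta> y)\<bar> \<le> clip_dist \<alpha> \<beta> * dist x y"
proof -
  let ?g = "\<lambda>j. (1 / 2) ^ j * (clip (\<alpha> j) - clip (\<beta> j))"
  have s: "summable (\<lambda>j. ?g j * tent D j x)" for x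
    using summable_diff[OF summable_probe summable_probe, of \<alpha> D x \<beta> D x]
    by (simp add: algebra_simps)
  have eq: "probe D \<alpha> x - probe D \<beta> x = (\<Sum>j. ?g j * tent D j x)" for x
    unfolding probe_def by (subst suminf_diff[OF summable_probe summable_probe]) (simp add: algebra_simps)
  show "\<bar>probe D \<alpha> x - probe D \<beta> x\<bar> \<le> clip_dist \<alpha> \<beta>"
    unfolding eq clip_dist_def real_norm_def[symmetric]
  proof (rule norm_suminf_le[OF _ summable_clip_dist[unfolded real_norm_def[symmetric]]])
    fix j show "norm (?g j * tent D j x) \<le> (1 / 2) ^ j * norm (clip (\<alpha> j) - clip (\<beta> j))"
      using mult_left_mono[OF tent_le_1, of "\<bar>?g j\<bar>" D j x] tent_nonneg[of D j x] by (simp add: abs_mult)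
  qed
  have "(probe D \<alpha> x - probe D \<beta> x) - (probe D \<alpha> y - probe D \<beta> y)
      = (\<Sum>j. ?g j * (tent D j x - tent D j y))"
    unfolding eq by (subst suminf_diff[OF s s]) (simp add: algebra_simps)
  also have "\<bar>\<dots>\<bar> \<le> (\<Sum>j. (1 / 2) ^ j * \<bar>clip (\<alpha> j) - clip (\<beta> j)\<bar> * dist x y)"
    unfolding real_norm_def[symmetric]
  proof (rule norm_suminf_le)
    show "summable (\<lambda>j. (1 / 2) ^ j * norm (clip (\<alpha> j) - clip (\<beta> j)) * dist x y)"
      using summable_mult2[OF summable_clip_dist] by simp
    fix j show "norm (?g j * (tent D j x - tent D j y)) \<le> (1 / 2) ^ j * norm (clip (\<alpha> j) - clip (\<beta> j)) * dist x y"
      using mult_left_mono[OF tent_lipschitz, of "\<bar>?g j\<bar>" D j x y] by (simp add: abs_mult)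
  qed
  also have "\<dots> = clip_dist \<alpha> \<beta> * dist x y"
    unfolding clip_dist_def by (rule suminf_mult2[OF summable_clip_dist, symmetric])
  finally show "\<bar>(probe D \<alpha> x - probe D \<beta> x) - (probe D \<alpha> y - probe D \<beta> y)\<bar> \<le> clip_dist \<alpha> \<beta> * dist x y" .
qed

text \<open>Comparison with the zero sequence, whose \<open>clip_dist\<close> is at most 4, the sum
  of the 2 * 2^-j. The constant is the same for all \<alpha>, so later perturbation constants are
  deterministic.\<close>

lemma probe_lipschitz: "\<bar>probe D \<alpha> x - probe D \<alpha> y\<bar> \<le> 4 * dist x y"
proof -
  have "\<bar>probe D \<alpha> x - probe D \<alpha> y\<bar> \<le> clip_dist \<alpha> (\<lambda>_. 0) * dist x y"
    using probe_diff_le(2)[of D \<alpha> x "\<lambda>_. 0" y] by simp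
  also have "\<dots> \<le> 4 * dist x y" by (intro mult_right_mono clip_dist_le) simp
  finally show ?thesis .
qed

text \<open>Only the term \<open>j\<close> changes. This is the source of the slope hypotheses of
  the slab lemmas.\<close>

lemma probe_fun_upd:
  "probe D (\<alpha>(j := t)) x = probe D (\<alpha>(j := s)) x + (1 / 2) ^ j * tent D j x * (clip t - clip s)"
proof -
  let ?f = "\<lambda>\<beta> i. (1 / 2) ^ i * clip (\<beta> i) * tent D i x"
  have "(\<lambda>i. ?f (\<alpha>(j := t)) i - ?f (\<alpha>(j := s)) i) sums (probe D (\<alpha>(j := t)) x - probe D (\<alpha>(j := s)) x)"
    unfolding probe_def by (intro sums_diff summable_sums summable_probe)
  moreover have "(\<lambda>i. ?f (\<alpha>(j := t)) i - ?f (\<alpha>(j := s)) i) =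
      (\<lambda>i. if i = j then (1 / 2) ^ i * tent D i x * (clip t - clip s) else 0)"
    by (auto simp: fun_eq_iff algebra_simps)
  ultimately have "(\<lambda>i. if i = j then (1 / 2) ^ i * tent D i x * (clip t - clip s) else 0) sums
      (probe D (\<alpha>(j := t)) x - probe D (\<alpha>(j := s)) x)" by simp
  from sums_unique2[OF this sums_single] show ?thesis by simp
qed

text \<open>A uniform limit by the M-test. Joint continuity is what the compactness argument over
  pairs and coefficients, and joint measurability, rely on.\<close>

lemma continuous_on_probe:
  fixes f :: "'b::topological_space \<Rightarrow> nat \<Rightarrow> real"
  assumes "continuous_on A f" "continuous_on A g"
  shows "continuous_on A (\<lambda>x. probe D (f x) (g x))"
proof (rule uniform_limit_theorem)
  show "uniform_limit A (\<lambda>n x. \<Sum>j<n. (1 / 2) ^ j * clip (f x j) * tent D j (g x)) (\<lambda>x. probe D (f x) (g x)) sequentially"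
    unfolding probe_def
    by (rule Weierstrass_m_test[of _ _ "\<lambda>j. (1 / 2) ^ j"]) (use probe_term_le in \<open>auto simp: summable_geometric\<close>)
  have "continuous_on A (\<lambda>x. f x j)" for j
    using assms(1) by (rule continuous_on_product_then_coordinatewise)
  then show "\<forall>\<^sub>F n in sequentially. continuous_on A (\<lambda>x. \<Sum>j<n. (1 / 2) ^ j * clip (f x j) * tent D j (g x))"
    using assms(2) by (intro always_eventually allI continuous_on_sum continuous_on_mult continuous_on_const
      continuous_on_clip continuous_on_tent)
qed simp

lemma continuous_on_clip_dist: "continuous_on UNIV (\<lambda>\<alpha>. clip_dist \<alpha> \<beta>)"
proof (rule uniform_limit_theorem)
  show "uniform_limit UNIV (\<lambda>n \<alpha>. \<Sum>j<n. (1 / 2) ^ j * \<bar>clip (\<alpha> j) - clip (\<beta> j)\<bar>) (\<lambda>\<alpha>. clip_dist \<alpha> \<beta>) sequentially"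
    unfolding clip_dist_def
    by (rule Weierstrass_m_test[of _ _ "\<lambda>j. (1 / 2) ^ j * 2"])
      (use clip_dist_term_le summable_geometric_half in auto)
  have "continuous_on UNIV (\<lambda>\<alpha> :: nat \<Rightarrow> real. \<alpha> j)" for j
    by (rule continuous_on_product_then_coordinatewise) (rule continuous_on_id)
  then show "\<forall>\<^sub>F n in sequentially. continuous_on UNIV (\<lambda>\<alpha>. \<Sum>j<n. (1 / 2) ^ j * \<bar>clip (\<alpha> j) - clip (\<beta> j)\<bar>)"
    by (intro always_eventually allI continuous_on_sum continuous_on_mult continuous_on_const
      continuous_on_rabs continuous_on_diff continuous_on_clip)
qed simp

section \<open>The probe measure on Lipschitz observables\<close>

lemma Lip_add:
  assumes "g \<in> Lip X" "h \<in> Lip X"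
  shows "(\<lambda>x. g x + h x) \<in> Lip X"
proof -
  obtain L M where "L-lipschitz_on X g" "M-lipschitz_on X h" using assms by (auto simp: Lip_def)
  then have "(L + M)-lipschitz_on X (\<lambda>x. g x + h x)" by (rule lipschitz_on_add)
  then show ?thesis using assms by (auto simp: Lip_def)
qed

lemma lip_norm_le:
  assumes "0 \<le> K" and "\<And>x. x \<in> X \<Longrightarrow> \<bar>f x\<bar> \<le> K"
    and "\<And>x y. x \<in> X \<Longrightarrow> y \<in> X \<Longrightarrow> \<bar>f x - f y\<bar> \<le> K * dist x y"
  shows "lip_norm X f \<le> 2 * K"
proof -
  have "Sup (insert 0 {\<bar>f x\<bar> | x. x \<in> X}) \<le> K"
  proof (rule cSup_least)
    fix a assume "a \<in> insert 0 {\<bar>f x\<bar> | x. x \<in> X}"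
    then show "a \<le> K" using assms(1,2) by blast
  qed simp
  moreover have "Sup (insert 0 {\<bar>f x - f y\<bar> / dist x y | x y. x \<in> X \<and> y \<in> X \<and> x \<noteq> y}) \<le> K"
  proof (rule cSup_least)
    fix a assume "a \<in> insert 0 {\<bar>f x - f y\<bar> / dist x y | x y. x \<in> X \<and> y \<in> X \<and> x \<noteq> y}"
    then consider "a = 0" | x y where "x \<in> X" "y \<in> X" "x \<noteq> y" "a = \<bar>f x - f y\<bar> / dist x y"
      by blast
    then show "a \<le> K"
      by cases (use assms(1) assms(3) in \<open>simp_all add: divide_le_eq\<close>)
  qed simp
  ultimately show ?thesis unfolding lip_norm_def by linarith
qed

section \<open>Topology and Borel sets of the space of Lipschitz observables\<close>

lemma openin_Lip_topology:
  assumes "bounded X"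
  shows "openin (Lip_topology X) U \<longleftrightarrow>
    U \<subseteq> Lip X \<and> (\<forall>h\<in>U. \<exists>r>0. \<forall>g\<in>Lip X. lip_dist X h g < r \<longrightarrow> g \<in> U)"
proof -
  interpret Metric_space "Lip X" "lip_dist X" by (rule Metric_space_Lip[OF assms])
  have "mball h r \<subseteq> U \<longleftrightarrow> (\<forall>g\<in>Lip X. lip_dist X h g < r \<longrightarrow> g \<in> U)" if "U \<subseteq> Lip X" "h \<in> U" for h r
    using that unfolding subset_iff in_mball by blast
  then show ?thesis
    unfolding Lip_topology_def openin_mtopology by metis
qed

lemma topspace_Lip_topology:
  assumes "bounded X"
  shows "topspace (Lip_topology X) = Lip X"
proof -
  interpret Metric_space "Lip X" "lip_dist X" by (rule Metric_space_Lip[OF assms])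
  show ?thesis unfolding Lip_topology_def by simp
qed

lemma Hausdorff_Lip_topology:
  assumes "bounded X"
  shows "Hausdorff_space (Lip_topology X)"
proof -
  interpret Metric_space "Lip X" "lip_dist X" by (rule Metric_space_Lip[OF assms])
  show ?thesis unfolding Lip_topology_def by (rule Hausdorff_space_mtopology)
qed

lemma abs_diff_le_lip_dist:
  assumes "bounded X" "g \<in> Lip X" "h \<in> Lip X" "x \<in> X"
  shows "\<bar>g x - h x\<bar> \<le> lip_dist X g h"
  using lip_norm_ge(2)[OF assms(1) Lip_diff[OF assms(2,3)] assms(4)] assms by (simp add: lip_dist_def)

lemma space_Lip_borel [simp]: "bounded X \<Longrightarrow> space (Lip_borel X) = Lip X"
  unfolding Lip_borel_def by (rule space_measure_of) (auto simp: openin_Lip_topology)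

lemma openin_imp_sets_Lip_borel:
  "bounded X \<Longrightarrow> openin (Lip_topology X) U \<Longrightarrow> U \<in> sets (Lip_borel X)"
  unfolding Lip_borel_def by (subst sets_measure_of) (auto simp: openin_Lip_topology)

lemma measurable_Lip_borelI:
  assumes X: "bounded X" and "f \<in> space M \<rightarrow> Lip X"
    and "\<And>U. openin (Lip_topology X) U \<Longrightarrow> f -` U \<inter> space M \<in> sets M"
  shows "f \<in> M \<rightarrow>\<^sub>M Lip_borel X"
  unfolding Lip_borel_def
  by (rule measurable_measure_of) (use assms in \<open>auto simp: openin_Lip_topology\<close>)

text \<open>Translation by \<open>v\<close> preserves \<open>lip_dist\<close>, so preimages of open
  sets are open.\<close>

lemma measurable_Lip_translate:
  assumes X: "bounded X" and v: "v \<in> Lip X"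
  shows "(\<lambda>e x. v x + e x) \<in> Lip_borel X \<rightarrow>\<^sub>M Lip_borel X"
proof (rule measurable_Lip_borelI[OF X])
  show "(\<lambda>e x. v x + e x) \<in> space (Lip_borel X) \<rightarrow> Lip X"
    using X v by (auto intro: Lip_add)
  fix U assume U: "openin (Lip_topology X) U"
  have "openin (Lip_topology X) ((\<lambda>e x. v x + e x) -` U \<inter> Lip X)"
    unfolding openin_Lip_topology[OF X]
  proof (intro conjI ballI)
    fix e assume e: "e \<in> (\<lambda>e x. v x + e x) -` U \<inter> Lip X"
    then obtain r where r: "r > 0"
        "\<And>g. g \<in> Lip X \<Longrightarrow> lip_dist X (\<lambda>x. v x + e x) g < r \<Longrightarrow> g \<in> U"
      using U unfolding openin_Lip_topology[OF X] by fastforce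
    have "(\<lambda>x. v x + g x) \<in> U" if g: "g \<in> Lip X" "lip_dist X e g < r" for g
    proof (rule r(2)[OF Lip_add[OF v g(1)]])
      have "lip_dist X (\<lambda>x. v x + e x) (\<lambda>x. v x + g x) = lip_dist X e g"
        using g e v by (simp add: lip_dist_def Lip_add)
      then show "lip_dist X (\<lambda>x. v x + e x) (\<lambda>x. v x + g x) < r" using g by simp
    qed
    then show "\<exists>r>0. \<forall>g\<in>Lip X. lip_dist X e g < r \<longrightarrow> g \<in> (\<lambda>e x. v x + e x) -` U \<inter> Lip X"
      using r(1) by blast
  qed auto
  then show "(\<lambda>e x. v x + e x) -` U \<inter> space (Lip_borel X) \<in> sets (Lip_borel X)"
    using X by (simp add: openin_imp_sets_Lip_borel)
qed

section \<open>The law of the random series and a criterion for prevalence\<close>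

definition probe_on :: "'a set \<Rightarrow> (nat \<Rightarrow> 'a::metric_space) \<Rightarrow> (nat \<Rightarrow> real) \<Rightarrow> 'a \<Rightarrow> real" where
  "probe_on X D \<alpha> x = (if x \<in> X then probe D \<alpha> x else 0)"

lemma probe_on_Lip: "probe_on X D \<alpha> \<in> Lip X"
  unfolding Lip_def
proof (intro CollectI conjI)
  have "4-lipschitz_on X (probe_on X D \<alpha>)"
    by (rule lipschitz_onI) (auto simp: probe_on_def dist_real_def probe_lipschitz)
  then show "\<exists>L. L-lipschitz_on X (probe_on X D \<alpha>)" ..
qed (simp add: probe_on_def)

lemma lip_dist_probe_on: "lip_dist X (probe_on X D \<alpha>) (probe_on X D \<beta>) \<le> 2 * clip_dist \<alpha> \<beta>"
proof -
  have "lip_norm X (\<lambda>x. probe_on X D \<alpha> x - probe_on X D \<beta> x) \<le> 2 * clip_dist \<alpha> \<beta>"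
    by (rule lip_norm_le) (auto simp: probe_on_def probe_diff_le clip_dist_nonneg)
  then show ?thesis by (simp add: lip_dist_def probe_on_Lip)
qed

lemma clip_dist_sym: "clip_dist \<alpha> \<beta> = clip_dist \<beta> \<alpha>"
  by (simp add: clip_dist_def abs_minus_commute)

text \<open>Serves twice: as continuity, for compactness of the range, and as measurability, since
  \<open>cube\<close> carries the Borel sets of the product topology.\<close>

lemma open_vimage_probe_on:
  assumes X: "bounded X" and U: "openin (Lip_topology X) U"
  shows "open (probe_on X D -` U)"
proof (subst open_subopen, intro ballI)
  fix \<beta> assume \<beta>: "\<beta> \<in> probe_on X D -` U"
  then obtain r where r: "r > 0" "\<And>g. g \<in> Lip X \<Longrightarrow> lip_dist X (probe_on X D \<beta>) g < r \<Longrightarrow> g \<in> U"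
    using U unfolding openin_Lip_topology[OF X] by (metis vimageE)
  \<comment> \<open>The radius is halved because \<open>lip_norm\<close> adds the supremum and the
    Lipschitz constant, each at most \<open>clip_dist\<close>.\<close>
  let ?V = "{\<alpha>. clip_dist \<alpha> \<beta> < r / 2}"
  have "open ?V"
    by (rule open_Collect_less[OF continuous_on_clip_dist continuous_on_const])
  moreover have "\<beta> \<in> ?V" using r(1) by simp
  moreover have "?V \<subseteq> probe_on X D -` U"
  proof
    fix \<alpha> assume "\<alpha> \<in> ?V"
    then have "lip_dist X (probe_on X D \<beta>) (probe_on X D \<alpha>) < r"
      using lip_dist_probe_on[of X D \<beta> \<alpha>] clip_dist_sym[of \<alpha> \<beta>] by simp
    then show "\<alpha> \<in> probe_on X D -` U" using r(2)[OF probe_on_Lip] by simp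
  qed
  ultimately show "\<exists>V. open V \<and> \<beta> \<in> V \<and> V \<subseteq> probe_on X D -` U" by blast
qed

lemma continuous_map_probe_on:
  assumes X: "bounded X"
  shows "continuous_map euclidean (Lip_topology X) (probe_on X D)"
  unfolding continuous_map_def
  using open_vimage_probe_on[OF X, of _ D]
  by (auto simp: topspace_Lip_topology[OF X] probe_on_Lip vimage_def)

lemma measurable_probe_on:
  assumes X: "bounded X"
  shows "probe_on X D \<in> cube \<rightarrow>\<^sub>M Lip_borel X"
  using open_vimage_probe_on[OF X, of _ D]
  by (intro measurable_Lip_borelI[OF X]) (auto simp: probe_on_Lip sets_cube)

lemma compact_unit_cube: "compact (PiE UNIV (\<lambda>_::nat. {-1..1::real}))"
  using compactin_PiE[of "\<lambda>_::nat. euclidean :: real topology" UNIV "\<lambda>_. {-1..1}"]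
  by (simp add: euclidean_product_topology)

lemma clip_in_unit_cube: "(\<lambda>j. clip (\<alpha> j)) \<in> PiE UNIV (\<lambda>_::nat. {-1..1::real})"
  using abs_clip_le by (auto simp: abs_le_iff minus_le_iff) 

text \<open>Clipping the coefficients does not change the probe, so the range is already the
  continuous image of the cube of sequences in [-1, 1], compact by Tychonoff.\<close>

lemma compactin_range_probe_on:
  assumes X: "bounded X"
  shows "compactin (Lip_topology X) (range (probe_on X D))"
proof -
  have "range (probe_on X D) = probe_on X D ` PiE UNIV (\<lambda>_. {-1..1})"
  proof (intro equalityI subsetI)
    fix e assume "e \<in> range (probe_on X D)"
    then obtain \<alpha> where "e = probe_on X D \<alpha>" by blast
    then have "e = probe_on X D (\<lambda>j. clip (\<alpha> j))" by (simp add: fun_eq_iff probe_on_def)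
    then show "e \<in> probe_on X D ` PiE UNIV (\<lambda>_. {-1..1})" using clip_in_unit_cube[of \<alpha>] by blast
  qed auto
  moreover have "compactin (Lip_topology X) (probe_on X D ` PiE UNIV (\<lambda>_. {-1..1}))"
    by (rule image_compactin[OF _ continuous_map_probe_on[OF X]]) (simp add: compact_unit_cube)
  ultimately show ?thesis by simp
qed

text \<open>The witnessing measure is the law of \<open>probe_on X D\<close>; its range is a compact
  set of full measure.\<close>

lemma prevalent_borelI:
  assumes X: "bounded X" and S: "S \<in> sets (Lip_borel X)"
    and AE: "\<And>v. v \<in> Lip X \<Longrightarrow> AE \<alpha> in cube. (\<lambda>x. v x + probe_on X D \<alpha> x) \<in> S"
  shows "prevalent_borel X S"
  unfolding prevalent_borel_def
proof (intro conjI S exI ballI)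
  interpret prob_space cube by (rule prob_space_cube)
  let ?\<nu> = "distr cube (Lip_borel X) (probe_on X D)"
  let ?K = "range (probe_on X D)"
  note meas = measurable_probe_on[OF X, of D]
  show "sets ?\<nu> = sets (Lip_borel X)" by simp
  show K: "compactin (Lip_topology X) ?K" by (rule compactin_range_probe_on[OF X])
  \<comment> \<open>The mass of \<open>?K\<close> can be computed on the sample space once
    \<open>?K\<close> is Borel; compact subsets of a Hausdorff space are closed.\<close>
  have "closedin (Lip_topology X) ?K"
    by (rule compactin_imp_closedin[OF Hausdorff_Lip_topology[OF X] K])
  then have "openin (Lip_topology X) (Lip X - ?K)"
    by (simp add: closedin_def topspace_Lip_topology[OF X])
  then have "Lip X - (Lip X - ?K) \<in> sets (Lip_borel X)"
    using openin_imp_sets_Lip_borel[OF X] sets.compl_sets[of _ "Lip_borel X"] X by auto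
  moreover have "Lip X - (Lip X - ?K) = ?K" using probe_on_Lip by blast
  ultimately have "?K \<in> sets (Lip_borel X)" by simp
  then have "emeasure ?\<nu> ?K = emeasure cube (probe_on X D -` ?K \<inter> space cube)"
    by (rule emeasure_distr[OF meas])
  also have "probe_on X D -` ?K \<inter> space cube = space cube" by auto
  finally have "emeasure ?\<nu> ?K = 1" using emeasure_space_1 by simp
  then show "0 < emeasure ?\<nu> ?K" "emeasure ?\<nu> ?K < \<infinity>" by auto
  fix v assume v: "v \<in> Lip X"
  have "{e \<in> space (Lip_borel X). (\<lambda>x. v x + e x) \<in> S} \<in> sets (Lip_borel X)"
    using measurable_sets[OF measurable_Lip_translate[OF X v] S] by (simp add: vimage_def Int_def conj_commute)
  then show "AE e in ?\<nu>. (\<lambda>x. v x + e x) \<in> S"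
    by (subst AE_distr_iff[OF meas]) (auto intro: AE[OF v])
qed

section \<open>Divergence sets\<close>

text \<open>The points whose future at time k is not determined up to \<eta> by k observations of
  accuracy \<epsilon>. Strict inequalities give openness, both in x and in h; bounds on single
  coordinates match the slab estimates.\<close>

definition divergence_set ::
    "'a set \<Rightarrow> ('a \<Rightarrow> 'a) \<Rightarrow> ('a \<Rightarrow> real) \<Rightarrow> nat \<Rightarrow> real \<Rightarrow> real \<Rightarrow> 'a set" where
  "divergence_set X T h k \<epsilon> \<eta> =
     {x \<in> X. \<exists>y\<in>X. (\<forall>i<k. \<bar>h ((T ^^ i) x) - h ((T ^^ i) y)\<bar> < \<epsilon>) \<and> \<eta> < \<bar>h ((T ^^ k) x) - h ((T ^^ k) y)\<bar>}"

lemma divergence_set_mono: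
  assumes "\<epsilon> \<le> \<epsilon>'" "\<eta>' \<le> \<eta>"
  shows "divergence_set X T h k \<epsilon> \<eta> \<subseteq> divergence_set X T h k \<epsilon>' \<eta>'"
  unfolding divergence_set_def using assms by (blast intro: less_le_trans le_less_trans)

lemma openin_Collect_all_less:
  assumes "openin U S" "\<And>i. i < k \<Longrightarrow> openin U {w \<in> S. P i w}"
  shows "openin U {w \<in> S. \<forall>i<(k::nat). P i w}"
  using assms(2)
proof (induction k)
  case 0
  then show ?case using assms(1) by simp
next
  case (Suc k)
  then have "openin U ({w \<in> S. \<forall>i<k. P i w} \<inter> {w \<in> S. P k w})" by (intro openin_Int) simp_all
  also have "{w \<in> S. \<forall>i<k. P i w} \<inter> {w \<in> S. P k w} = {w \<in> S. \<forall>i<Suc k. P i w}"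
    by (auto simp: less_Suc_eq)
  finally show ?case .
qed

text \<open>A union of open sets over \<open>y\<close>, so the existential needs no countability. It
  is used on X for a fixed observable and on pairs of coefficients and points for joint
  measurability.\<close>

lemma openin_divergence:
  fixes \<phi> :: "nat \<Rightarrow> 'y \<Rightarrow> 'w::topological_space \<Rightarrow> real"
  assumes cont: "\<And>i y. y \<in> Y \<Longrightarrow> continuous_on S (\<phi> i y)"
  shows "openin (top_of_set S) {w \<in> S. \<exists>y\<in>Y. (\<forall>i<k. \<bar>\<phi> i y w\<bar> < \<epsilon>) \<and> \<eta> < \<bar>\<phi> k y w\<bar>}"
proof -
  have "openin (top_of_set S) ({w \<in> S. \<forall>i<k. \<bar>\<phi> i y w\<bar> < \<epsilon>} \<inter> {w \<in> S. \<eta> < \<bar>\<phi> k y w\<bar>})"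
    if y: "y \<in> Y" for y
  proof (intro openin_Int openin_Collect_all_less)
    have *: "openin (top_of_set S) (S \<inter> (\<lambda>w. \<bar>\<phi> i y w\<bar>) -` B)" if "open B" for i B
      using that continuous_on_rabs[OF cont[OF y]] by (intro continuous_openin_preimage_gen)
    show "openin (top_of_set S) {w \<in> S. \<bar>\<phi> i y w\<bar> < \<epsilon>}" for i
      using *[of "{..<\<epsilon>}" i] by (simp add: vimage_def Int_def)
    show "openin (top_of_set S) {w \<in> S. \<eta> < \<bar>\<phi> k y w\<bar>}"
      using *[of "{\<eta><..}" k] by (simp add: vimage_def Int_def)
  qed simp
  then have "openin (top_of_set S)
      (\<Union>y\<in>Y. {w \<in> S. \<forall>i<k. \<bar>\<phi> i y w\<bar> < \<epsilon>} \<inter> {w \<in> S. \<eta> < \<bar>\<phi> k y w\<bar>})"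
    by (intro openin_Union) blast
  moreover have "(\<Union>y\<in>Y. {w \<in> S. \<forall>i<k. \<bar>\<phi> i y w\<bar> < \<epsilon>} \<inter> {w \<in> S. \<eta> < \<bar>\<phi> k y w\<bar>}) =
      {w \<in> S. \<exists>y\<in>Y. (\<forall>i<k. \<bar>\<phi> i y w\<bar> < \<epsilon>) \<and> \<eta> < \<bar>\<phi> k y w\<bar>}" by blast
  ultimately show ?thesis by simp
qed

section \<open>Openness and measurability of divergence sets\<close>

locale lipschitz_system =
  fixes X :: "'a::{metric_space, second_countable_topology} set" and T :: "'a \<Rightarrow> 'a" and L :: real
  assumes compact_X: "compact X" and T_maps: "T ` X \<subseteq> X" and T_lipschitz: "L-lipschitz_on X T"
begin

lemma bounded_X: "bounded X"
  using compact_X by (rule compact_imp_bounded)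

lemma iter_in: "x \<in> X \<Longrightarrow> (T ^^ i) x \<in> X"
  using T_maps by (induction i) auto

lemma iter_lipschitz: "(L ^ i)-lipschitz_on X (T ^^ i)"
proof (induction i)
  case 0
  show ?case by (rule lipschitz_onI) simp_all
next
  case (Suc i)
  have sub: "(T ^^ i) ` X \<subseteq> X" using iter_in by blast
  show ?case
    using lipschitz_on_compose[OF Suc lipschitz_on_subset[OF T_lipschitz sub]] by (simp add: comp_def)
qed

lemma continuous_on_iter: "continuous_on X (T ^^ i)"
  by (rule lipschitz_on_continuous_on[OF iter_lipschitz])

lemma continuous_on_iter_compose:
  assumes "continuous_on S f" "f ` S \<subseteq> X"
  shows "continuous_on S (\<lambda>w. (T ^^ i) (f w))"
  by (rule continuous_on_compose2[OF continuous_on_iter assms])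

lemma Lip_continuous_on_iter:
  assumes "h \<in> Lip X" "continuous_on S f" "f ` S \<subseteq> X"
  shows "continuous_on S (\<lambda>w. h ((T ^^ i) (f w)))"
proof -
  obtain M where "M-lipschitz_on X h" using assms(1) by (auto simp: Lip_def)
  then have "continuous_on X h" by (rule lipschitz_on_continuous_on)
  then show ?thesis
    by (rule continuous_on_compose2[OF _ continuous_on_iter_compose[OF assms(2,3)]])
      (use assms(3) iter_in in blast)
qed

text \<open>Makes \<open>h \<mapsto> \<mu> (divergence_set X T h k \<epsilon> \<eta>)\<close> lower semicontinuous, which is what the Borel
  measurability of the prevalent set rests on.\<close>

lemma divergence_set_perturb:
  assumes h: "h \<in> Lip X" and g: "g \<in> Lip X" and d: "lip_dist X h g \<le> r / 2"
  shows "divergence_set X T h k (\<epsilon> - r) (\<eta> + r) \<subseteq> divergence_set X T g k \<epsilon> \<eta>"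
proof -
  \<comment> \<open>Each of the two values in a gap moves by at most r/2.\<close>
  have close: "\<bar>\<bar>h ((T ^^ i) x) - h ((T ^^ i) y)\<bar> - \<bar>g ((T ^^ i) x) - g ((T ^^ i) y)\<bar>\<bar> \<le> r"
    if "x \<in> X" "y \<in> X" for x y i
    using abs_diff_le_lip_dist[OF bounded_X h g iter_in[OF that(1), of i]]
      abs_diff_le_lip_dist[OF bounded_X h g iter_in[OF that(2), of i]] d
    by linarith
  show ?thesis
  proof
    fix x assume "x \<in> divergence_set X T h k (\<epsilon> - r) (\<eta> + r)"
    then obtain y where x: "x \<in> X" and y: "y \<in> X"
      and *: "\<And>i. i < k \<Longrightarrow> \<bar>h ((T ^^ i) x) - h ((T ^^ i) y)\<bar> < \<epsilon> - r"
      and **: "\<eta> + r < \<bar>h ((T ^^ k) x) - h ((T ^^ k) y)\<bar>" unfolding divergence_set_def by blast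
    have "\<bar>g ((T ^^ i) x) - g ((T ^^ i) y)\<bar> < \<epsilon>" if "i < k" for i
      using close[OF x y, of i] *[OF that] by linarith
    moreover have "\<eta> < \<bar>g ((T ^^ k) x) - g ((T ^^ k) y)\<bar>"
      using close[OF x y, of k] ** by linarith
    ultimately show "x \<in> divergence_set X T g k \<epsilon> \<eta>" unfolding divergence_set_def using x y by blast
  qed
qed

text \<open>Finitely many strict inequalities leave some slack 1/(n+1). By
  \<open>divergence_set_perturb\<close>, half of that slack is an admissible distance between
  observables.\<close>

lemma divergence_set_UN:
  "divergence_set X T h k \<epsilon> \<eta> = (\<Union>n. divergence_set X T h k (\<epsilon> - 1 / real (Suc n)) (\<eta> + 1 / real (Suc n)))"
proof (intro equalityI subsetI)
  fix x assume "x \<in> divergence_set X T h k \<epsilon> \<eta>"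
  then obtain y where x: "x \<in> X" and y: "y \<in> X"
    and *: "\<And>i. i < k \<Longrightarrow> \<bar>h ((T ^^ i) x) - h ((T ^^ i) y)\<bar> < \<epsilon>"
    and **: "\<eta> < \<bar>h ((T ^^ k) x) - h ((T ^^ k) y)\<bar>" unfolding divergence_set_def by blast
  have l: "(\<lambda>n. 1 / real (Suc n)) \<longlonglongrightarrow> 0" by (rule LIMSEQ_Suc[OF lim_1_over_n])
  have l1: "(\<lambda>n. \<epsilon> - 1 / real (Suc n)) \<longlonglongrightarrow> \<epsilon>" and l2: "(\<lambda>n. \<eta> + 1 / real (Suc n)) \<longlonglongrightarrow> \<eta>"
    using tendsto_diff[OF tendsto_const l, of \<epsilon>] tendsto_add[OF tendsto_const l, of \<eta>] by simp_all
  have "\<forall>\<^sub>F n in sequentially. \<forall>i\<in>{..<k}. \<bar>h ((T ^^ i) x) - h ((T ^^ i) y)\<bar> < \<epsilon> - 1 / real (Suc n)"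
    by (intro eventually_ball_finite ballI order_tendstoD(1)[OF l1] *) simp_all
  moreover have "\<forall>\<^sub>F n in sequentially. \<eta> + 1 / real (Suc n) < \<bar>h ((T ^^ k) x) - h ((T ^^ k) y)\<bar>"
    by (rule order_tendstoD(2)[OF l2 **])
  ultimately have "\<forall>\<^sub>F n in sequentially. x \<in> divergence_set X T h k (\<epsilon> - 1 / real (Suc n)) (\<eta> + 1 / real (Suc n))"
    unfolding Ball_def lessThan_iff divergence_set_def by eventually_elim (use x y in blast)
  then show "x \<in> (\<Union>n. divergence_set X T h k (\<epsilon> - 1 / real (Suc n)) (\<eta> + 1 / real (Suc n)))"
    using eventually_happens'[OF sequentially_bot] by blast
next
  fix x assume "x \<in> (\<Union>n. divergence_set X T h k (\<epsilon> - 1 / real (Suc n)) (\<eta> + 1 / real (Suc n)))"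
  then obtain n where "x \<in> divergence_set X T h k (\<epsilon> - 1 / real (Suc n)) (\<eta> + 1 / real (Suc n))" by blast
  moreover have "divergence_set X T h k (\<epsilon> - 1 / real (Suc n)) (\<eta> + 1 / real (Suc n)) \<subseteq> divergence_set X T h k \<epsilon> \<eta>"
    by (rule divergence_set_mono) simp_all
  ultimately show "x \<in> divergence_set X T h k \<epsilon> \<eta>" by blast
qed

lemma openin_divergence_set:
  assumes "h \<in> Lip X"
  shows "openin (top_of_set X) (divergence_set X T h k \<epsilon> \<eta>)"
  unfolding divergence_set_def
  by (rule openin_divergence) (intro continuous_on_diff continuous_on_const
    Lip_continuous_on_iter[OF assms continuous_on_id]; simp)

lemma divergence_set_nonempty_open:
  "openin (Lip_topology X) {h \<in> Lip X. divergence_set X T h k \<epsilon> \<eta> \<noteq> {}}"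
  unfolding openin_Lip_topology[OF bounded_X]
proof (intro conjI ballI)
  fix h assume "h \<in> {h \<in> Lip X. divergence_set X T h k \<epsilon> \<eta> \<noteq> {}}"
  then have h: "h \<in> Lip X" and "divergence_set X T h k \<epsilon> \<eta> \<noteq> {}" by auto
  then obtain n where n: "divergence_set X T h k (\<epsilon> - 1 / real (Suc n)) (\<eta> + 1 / real (Suc n)) \<noteq> {}"
    using divergence_set_UN[of h k \<epsilon> \<eta>] by blast
  show "\<exists>r>0. \<forall>g\<in>Lip X. lip_dist X h g < r \<longrightarrow> g \<in> {h \<in> Lip X. divergence_set X T h k \<epsilon> \<eta> \<noteq> {}}"
  proof (intro exI[of _ "1 / real (Suc n) / 2"] conjI ballI impI)
    fix g assume g: "g \<in> Lip X" "lip_dist X h g < 1 / real (Suc n) / 2"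
    then show "g \<in> {h \<in> Lip X. divergence_set X T h k \<epsilon> \<eta> \<noteq> {}}"
      using divergence_set_perturb[OF h g(1) less_imp_le[OF g(2)], of k \<epsilon> \<eta>] n by blast
  qed simp
qed blast

end

locale lipschitz_prob_system = lipschitz_system X T L + prob_space \<mu>
  for X :: "'a::{metric_space, second_countable_topology} set" and T L and \<mu> :: "'a measure" +
  assumes sets_mu: "sets \<mu> = sets (restrict_space borel X)"
begin

lemma space_mu: "space \<mu> = X"
  using sets_eq_imp_space_eq[OF sets_mu] by (simp add: space_restrict_space)

lemma sets_divergence_set:
  assumes "h \<in> Lip X"
  shows "divergence_set X T h k \<epsilon> \<eta> \<in> sets \<mu>"
proof -
  obtain S where "open S" "divergence_set X T h k \<epsilon> \<eta> = X \<inter> S"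
    using openin_divergence_set[OF assms, of k \<epsilon> \<eta>] unfolding openin_open by blast
  then show ?thesis unfolding sets_mu sets_restrict_space by (intro image_eqI[of _ _ S]) simp_all
qed

text \<open>By continuity from below the measure still exceeds \<open>c\<close> after some slack is
  imposed on the inequalities, and the perturbation lemma transfers the smaller set to all nearby
  observables.\<close>

lemma divergence_set_measure_open:
  "openin (Lip_topology X) {h \<in> Lip X. c < measure \<mu> (divergence_set X T h k \<epsilon> \<eta>)}"
  unfolding openin_Lip_topology[OF bounded_X]
proof (intro conjI ballI)
  fix h assume "h \<in> {h \<in> Lip X. c < measure \<mu> (divergence_set X T h k \<epsilon> \<eta>)}"
  then have h: "h \<in> Lip X" and c: "c < measure \<mu> (divergence_set X T h k \<epsilon> \<eta>)" by auto
  let ?A = "\<lambda>n. divergence_set X T h k (\<epsilon> - 1 / real (Suc n)) (\<eta> + 1 / real (Suc n))"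
  have "(\<lambda>n. measure \<mu> (?A n)) \<longlonglongrightarrow> measure \<mu> (\<Union>n. ?A n)"
  proof (rule finite_Lim_measure_incseq)
    show "range ?A \<subseteq> sets \<mu>" using sets_divergence_set[OF h] by blast
    show "incseq ?A" by (rule incseq_SucI, rule divergence_set_mono) (simp_all add: field_simps)
  qed
  then have "\<forall>\<^sub>F n in sequentially. c < measure \<mu> (?A n)"
    using c unfolding divergence_set_UN[symmetric] by (rule order_tendstoD(1))
  then obtain n where n: "c < measure \<mu> (?A n)"
    using eventually_happens'[OF sequentially_bot] by blast
  show "\<exists>r>0. \<forall>g\<in>Lip X. lip_dist X h g < r \<longrightarrow> g \<in> {h \<in> Lip X. c < measure \<mu> (divergence_set X T h k \<epsilon> \<eta>)}"
  proof (intro exI[of _ "1 / real (Suc n) / 2"] conjI ballI impI)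
    fix g assume g: "g \<in> Lip X" "lip_dist X h g < 1 / real (Suc n) / 2"
    have "measure \<mu> (?A n) \<le> measure \<mu> (divergence_set X T g k \<epsilon> \<eta>)"
      by (intro finite_measure_mono divergence_set_perturb[OF h g(1) less_imp_le[OF g(2)]] sets_divergence_set g)
    then show "g \<in> {h \<in> Lip X. c < measure \<mu> (divergence_set X T h k \<epsilon> \<eta>)}" using n g(1) by simp
  qed simp
qed blast

lemma pred_divergence_set_measure [measurable]:
  "Measurable.pred (Lip_borel X) (\<lambda>h. measure \<mu> (divergence_set X T h k \<epsilon> \<eta>) \<le> c)"
proof -
  have "Measurable.pred (Lip_borel X) (\<lambda>h. c < measure \<mu> (divergence_set X T h k \<epsilon> \<eta>))"
    unfolding pred_def using openin_imp_sets_Lip_borel[OF bounded_X divergence_set_measure_open]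
    by (simp add: bounded_X)
  then have "Measurable.pred (Lip_borel X) (\<lambda>h. \<not> c < measure \<mu> (divergence_set X T h k \<epsilon> \<eta>))"
    by measurable
  then show ?thesis by (simp add: not_less)
qed

lemma pred_divergence_set_empty [measurable]:
  "Measurable.pred (Lip_borel X) (\<lambda>h. divergence_set X T h k \<epsilon> \<eta> = {})"
proof -
  have "Measurable.pred (Lip_borel X) (\<lambda>h. divergence_set X T h k \<epsilon> \<eta> \<noteq> {})"
    unfolding pred_def using openin_imp_sets_Lip_borel[OF bounded_X divergence_set_nonempty_open]
    by (simp add: bounded_X)
  then have "Measurable.pred (Lip_borel X) (\<lambda>h. \<not> divergence_set X T h k \<epsilon> \<eta> \<noteq> {})"
    by measurable
  then show ?thesis by simp
qed

end

section \<open>Uniform independence of the gaps\<close>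

text \<open>The filter keeps the point \<open>x\<close> itself, which \<open>at x within A\<close>
  omits: the neighbourhoods on which bounds hold must contain their centre in order to cover a
  compact set.\<close>

lemma continuous_on_imp_tendsto_within:
  assumes "continuous_on A f" "x \<in> A"
  shows "(f \<longlongrightarrow> f x) (inf (nhds x) (principal A))"
proof (rule topological_tendstoI)
  fix S assume S: "open S" "f x \<in> S"
  have "(f \<longlongrightarrow> f x) (at x within A)" using assms by (simp add: continuous_on)
  then have "\<forall>\<^sub>F y in nhds x. y \<noteq> x \<longrightarrow> y \<in> A \<longrightarrow> f y \<in> S"
    unfolding eventually_at_filter[symmetric] by (rule topological_tendstoD[OF _ S])
  then show "\<forall>\<^sub>F y in inf (nhds x) (principal A). f y \<in> S"
    unfolding eventually_inf_principal by (rule eventually_mono) (use S in blast)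
qed

context lipschitz_system
begin

text \<open>Built on \<open>probe\<close> and not on \<open>probe_on\<close>, so that measurability
  and the affine dependence on each clipped coefficient hold for arbitrary points;
  \<open>gap_eq\<close> relates the two on X.\<close>

definition gap :: "('a \<Rightarrow> real) \<Rightarrow> (nat \<Rightarrow> 'a) \<Rightarrow> (nat \<Rightarrow> real) \<Rightarrow> nat \<Rightarrow> 'a \<Rightarrow> 'a \<Rightarrow> real" where
  "gap v D \<alpha> i x y =
     (v ((T ^^ i) x) + probe D \<alpha> ((T ^^ i) x)) - (v ((T ^^ i) y) + probe D \<alpha> ((T ^^ i) y))"

lemma gap_eq:
  assumes "x \<in> X" "y \<in> X"
  shows "gap v D \<alpha> i x y =
    (v ((T ^^ i) x) + probe_on X D \<alpha> ((T ^^ i) x)) - (v ((T ^^ i) y) + probe_on X D \<alpha> ((T ^^ i) y))"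
  using iter_in[OF assms(1), of i] iter_in[OF assms(2), of i] by (simp add: gap_def probe_on_def)

lemma gap_clip [simp]: "gap v D (\<lambda>j. clip (\<alpha> j)) i x y = gap v D \<alpha> i x y"
  by (simp add: gap_def)

lemma continuous_on_gap:
  fixes f :: "'w::topological_space \<Rightarrow> nat \<Rightarrow> real"
  assumes v: "v \<in> Lip X" and "continuous_on S f"
    and "continuous_on S p" "p ` S \<subseteq> X" "continuous_on S q" "q ` S \<subseteq> X"
  shows "continuous_on S (\<lambda>w. gap v D (f w) i (p w) (q w))"
  unfolding gap_def
  by (intro continuous_on_diff continuous_on_add Lip_continuous_on_iter[OF v] continuous_on_probe
      continuous_on_iter_compose assms)

lemma gap_fun_upd:
  "gap v D (\<alpha>(j := t)) i x y = gap v D (\<alpha>(j := s)) i x y +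
     (1 / 2) ^ j * (tent D j ((T ^^ i) x) - tent D j ((T ^^ i) y)) * (clip t - clip s)"
  unfolding gap_def probe_fun_upd[of D \<alpha> j t _ s] by (simp only: algebra_simps)

lemma borel_measurable_gap: "(\<lambda>\<alpha>. gap v D \<alpha> i x y) \<in> borel_measurable cube"
proof -
  have "(\<lambda>\<alpha>. gap v D \<alpha> i x y) \<in> borel_measurable borel"
    unfolding gap_def
    by (intro borel_measurable_continuous_onI continuous_on_diff continuous_on_add continuous_on_const
        continuous_on_probe continuous_on_id)
  then show ?thesis by (simp add: measurable_cong_sets[OF sets_cube refl])
qed

text \<open>The transversality estimate at a single pair: the bound near 0 that a bounded density of
  the gap vector would give.\<close>

definition slab_bound :: "('a \<Rightarrow> real) \<Rightarrow> (nat \<Rightarrow> 'a) \<Rightarrow> nat \<Rightarrow> real \<Rightarrow> 'a \<times> 'a \<Rightarrow> bool" where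
  "slab_bound v D k C z \<longleftrightarrow>
     (\<forall>\<epsilon>>0. emeasure cube {\<alpha>. \<forall>i<k. \<bar>gap v D \<alpha> i (fst z) (snd z)\<bar> < \<epsilon>} \<le> ennreal (C * \<epsilon> ^ k))"

lemma slab_bound_mono: "slab_bound v D k C z \<Longrightarrow> C \<le> C' \<Longrightarrow> slab_bound v D k C' z"
  unfolding slab_bound_def
  by (meson order_trans ennreal_leI mult_right_mono zero_le_power less_imp_le)

text \<open>Elimination along the filter of neighbourhoods of \<open>z\<close> in X \<times> X: the
  slopes depend continuously on the pair, so independence at \<open>z\<close> alone yields one
  constant nearby.\<close>

lemma slab_bound_near_independent:
  assumes v: "v \<in> Lip X" and z: "z \<in> X \<times> X"
    and ind: "\<And>c. (\<And>j. (\<Sum>i<k. c i * (tent D j ((T ^^ i) (fst z)) - tent D j ((T ^^ i) (snd z)))) = 0)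
      \<Longrightarrow> \<forall>i<k. c i = 0"
  shows "\<exists>C>0. \<exists>U. open U \<and> z \<in> U \<and> (\<forall>z'\<in>U \<inter> X \<times> X. slab_bound v D k C z')"
proof -
  let ?a = "\<lambda>i j z. (1 / 2) ^ j * (tent D j ((T ^^ i) (fst z)) - tent D j ((T ^^ i) (snd z)))"
  have "\<exists>C>0. \<forall>\<^sub>F z in inf (nhds z) (principal (X \<times> X)). \<forall>\<epsilon>>0.
      emeasure cube {\<alpha>. \<forall>i\<in>{..<k}. \<bar>(\<lambda>i z \<alpha>. gap v D \<alpha> i (fst z) (snd z)) i z \<alpha>\<bar> < \<epsilon>} \<le> ennreal (C * \<epsilon> ^ card {..<k})"
  proof (rule emeasure_cube_independent_slabs[where a = ?a and ?a0.0 = "\<lambda>i j. ?a i j z"])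
    show "((\<lambda>z. ?a i j z) \<longlongrightarrow> ?a i j z) (inf (nhds z) (principal (X \<times> X)))" for i j
    proof (rule continuous_on_imp_tendsto_within[OF _ z])
      show "continuous_on (X \<times> X) (?a i j)"
        by (intro continuous_on_mult continuous_on_const continuous_on_diff continuous_on_tent
            continuous_on_iter_compose continuous_on_fst continuous_on_snd continuous_on_id) auto
    qed
    show "\<forall>i\<in>{..<k}. c i = 0" if c: "\<forall>j. (\<Sum>i<k. c i * ?a i j z) = 0" for c
    proof -
      have "(\<Sum>i<k. c i * (tent D j ((T ^^ i) (fst z)) - tent D j ((T ^^ i) (snd z)))) = 0" for j
      proof -
        have "(1 / 2) ^ j * (\<Sum>i<k. c i * (tent D j ((T ^^ i) (fst z)) - tent D j ((T ^^ i) (snd z)))) =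
            (\<Sum>i<k. c i * ?a i j z)"
          by (simp add: sum_distrib_left mult.left_commute)
        also have "\<dots> = 0" using c ..
        finally show ?thesis by simp
      qed
      from ind[OF this] show ?thesis by simp
    qed
    show "gap v D (\<alpha>(j := t)) i (fst z) (snd z) = gap v D (\<alpha>(j := s)) i (fst z) (snd z) + ?a i j z * (clip t - clip s)"
      for i z \<alpha> j s t by (rule gap_fun_upd)
  qed (auto intro: borel_measurable_gap)
  then obtain C where C: "C > 0" "\<forall>\<^sub>F z' in nhds z. z' \<in> X \<times> X \<longrightarrow> slab_bound v D k C z'"
    unfolding eventually_inf_principal slab_bound_def Ball_def lessThan_iff card_lessThan by blast
  then obtain U where "open U" "z \<in> U" "\<forall>z'\<in>U. z' \<in> X \<times> X \<longrightarrow> slab_bound v D k C z'"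
    unfolding eventually_nhds by blast
  then show ?thesis using C(1) by blast
qed

text \<open>\<open>Q\<close> consists of the pairs and coefficients with the first \<open>k\<close> gaps zero and the gap at time \<open>k\<close>
  at least \<open>\<eta>\<close>; it is the zero set of \<open>\<psi>\<close>, which is bounded below off a neighbourhood of it.\<close>

lemma slab_bound_off_divergence:
  assumes dense: "\<forall>S. open S \<longrightarrow> S \<noteq> {} \<longrightarrow> (\<exists>m. D m \<in> S)" and v: "v \<in> Lip X" and \<eta>: "\<eta> > 0"
  obtains C \<epsilon>1 where "C > 0" "\<epsilon>1 > 0"
    "\<And>x y \<alpha>. x \<in> X \<Longrightarrow> y \<in> X \<Longrightarrow> (\<And>i. i < k \<Longrightarrow> \<bar>gap v D \<alpha> i x y\<bar> < \<epsilon>1) \<Longrightarrow>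
      \<eta> < \<bar>gap v D \<alpha> k x y\<bar> \<Longrightarrow> slab_bound v D k C (x, y)"
proof -
  define K where "K = (X \<times> X) \<times> (PiE UNIV (\<lambda>_::nat. {-1..1::real}))"
  have K: "compact K" unfolding K_def by (intro compact_Times compact_X compact_unit_cube)
  define \<psi> where "\<psi> w = (\<Sum>i<k. \<bar>gap v D (snd w) i (fst (fst w)) (snd (fst w))\<bar>) +
      max 0 (\<eta> - \<bar>gap v D (snd w) k (fst (fst w)) (snd (fst w))\<bar>)" for w
  have \<psi>: "continuous_on K \<psi>"
    unfolding \<psi>_def
    by (intro continuous_on_add continuous_on_sum continuous_on_rabs continuous_on_max continuous_on_const
        continuous_on_diff continuous_on_gap[OF v] continuous_on_fst continuous_on_snd continuous_on_id)
      (auto simp: K_def)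
  have \<psi>0: "\<psi> w \<ge> 0" for w unfolding \<psi>_def by (intro add_nonneg_nonneg sum_nonneg) simp_all
  define Q where "Q = {w \<in> K. \<psi> w = 0}"
  have Q: "compact Q"
    unfolding Q_def using K continuous_closedin_preimage_constant[OF \<psi>] closedin_compact by blast
  \<comment> \<open>Over \<open>Q\<close> the orbit differences are independent: a nontrivial
    relation would force the gap at time k to vanish too, but it is at least \<eta> > 0.\<close>
  have local: "\<exists>C>0. \<exists>U. open U \<and> z \<in> U \<and> (\<forall>z'\<in>U \<inter> X \<times> X. slab_bound v D k C z')" if z: "z \<in> fst ` Q" for z
  proof -
    obtain \<alpha> where w: "(z, \<alpha>) \<in> K" "\<psi> (z, \<alpha>) = 0" using z unfolding Q_def by auto
    obtain x y where xy: "z = (x, y)" by (cases z)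
    have x: "x \<in> X" and y: "y \<in> X" using w(1) by (auto simp: K_def xy)
    have nn: "0 \<le> (\<Sum>i<k. \<bar>gap v D \<alpha> i x y\<bar>)" by (intro sum_nonneg) simp
    have "(\<Sum>i<k. \<bar>gap v D \<alpha> i x y\<bar>) + max 0 (\<eta> - \<bar>gap v D \<alpha> k x y\<bar>) = 0"
      using w(2) by (simp add: \<psi>_def xy)
    then have s: "(\<Sum>i<k. \<bar>gap v D \<alpha> i x y\<bar>) = 0" and gk: "\<eta> \<le> \<bar>gap v D \<alpha> k x y\<bar>"
      using nn by linarith+
    have gi: "gap v D \<alpha> i x y = 0" if "i < k" for i
      using s that by (subst (asm) sum_nonneg_eq_0_iff) simp_all
    let ?h = "\<lambda>x. v x + probe D \<alpha> x"
    show ?thesis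
    proof (rule slab_bound_near_independent[OF v])
      show "z \<in> X \<times> X" using x y xy by simp
      fix c assume c: "\<And>j. (\<Sum>i<k. c i * (tent D j ((T ^^ i) (fst z)) - tent D j ((T ^^ i) (snd z)))) = 0"
      show "\<forall>i<k. c i = 0"
      proof (rule ccontr)
        assume "\<not> ?thesis"
        then obtain i0 where i0: "i0 < k" "c i0 \<noteq> 0" by blast
        have "?h ((T ^^ k) x) = ?h ((T ^^ k) y)"
        proof (rule orbit_relation_determines_next[where c = c and h = ?h, OF dense _ i0])
          show "(\<Sum>i<k. c i * (tent D j ((T ^^ i) x) - tent D j ((T ^^ i) y))) = 0" for j
            using c[of j] by (simp add: xy)
          show "?h ((T ^^ i) x) = ?h ((T ^^ i) y)" if "i < k" for i
            using gi[OF that] by (simp add: gap_def)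
        qed
        then show False using gk \<eta> by (simp add: gap_def)
      qed
    qed
  qed
  then obtain C U where CU: "\<And>z. z \<in> fst ` Q \<Longrightarrow> C z > (0::real) \<and> open (U z) \<and> z \<in> U z \<and>
      (\<forall>z'\<in>U z \<inter> X \<times> X. slab_bound v D k (C z) z')" by metis
  have "compact (fst ` Q)" by (intro compact_continuous_image continuous_on_fst continuous_on_id Q)
  then obtain F where F: "F \<subseteq> fst ` Q" "finite F" "fst ` Q \<subseteq> (\<Union>z\<in>F. U z)"
    by (rule compactE_image[of _ "fst ` Q" U]) (use CU in blast)+
  have Cpos: "0 \<le> C z" if "z \<in> F" for z
    using CU[of z] F(1) that by (meson less_imp_le subsetD)
  \<comment> \<open>Majorises the finitely many local constants, and is positive even if
    \<open>F\<close> is empty.\<close>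
  define C0 where "C0 = 1 + (\<Sum>z\<in>F. C z)"
  have C0: "C0 > 0" unfolding C0_def
    by (intro add_pos_nonneg sum_nonneg Cpos) simp_all
  have bnd: "slab_bound v D k C0 z'" if z': "z' \<in> (\<Union>z\<in>F. U z) \<inter> X \<times> X" for z'
  proof -
    obtain z where z: "z \<in> F" "z' \<in> U z" using z' by blast
    have "C z \<le> (\<Sum>z\<in>F. C z)" using F(2) z by (intro member_le_sum Cpos) simp_all
    then have "C z \<le> C0" by (simp add: C0_def)
    moreover have "slab_bound v D k (C z) z'" using CU[of z] z F z' by blast
    ultimately show ?thesis by (rule slab_bound_mono[rotated])
  qed
  define K' where "K' = K - (\<Union>z\<in>F. U z) \<times> UNIV"
  have "open (\<Union>z\<in>F. U z)" by (rule open_UN) (use F(1) CU in blast)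
  then have K': "compact K'" unfolding K'_def by (intro compact_diff K open_Times) simp_all
  have "\<exists>m>0. \<forall>w\<in>K'. m \<le> \<psi> w"
  proof (cases "K' = {}")
    case True
    then show ?thesis by (intro exI[of _ 1]) simp
  next
    case False
    have "continuous_on K' \<psi>" by (rule continuous_on_subset[OF \<psi>]) (auto simp: K'_def)
    then obtain w0 where w0: "w0 \<in> K'" "\<forall>w\<in>K'. \<psi> w0 \<le> \<psi> w"
      using continuous_attains_inf[OF K' False] by blast
    have "fst w0 \<notin> (\<Union>z\<in>F. U z)" using w0(1) unfolding K'_def by (cases w0) simp
    then have "w0 \<notin> Q" using F(3) by blast
    moreover have "w0 \<in> K" using w0(1) unfolding K'_def by blast
    ultimately have "\<psi> w0 \<noteq> 0" unfolding Q_def by blast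
    then have "\<psi> w0 > 0" using \<psi>0[of w0] by simp
    then show ?thesis using w0(2) by blast
  qed
  then obtain m where m: "m > 0" "\<And>w. w \<in> K' \<Longrightarrow> m \<le> \<psi> w" by blast
  show ?thesis
  proof (rule that[OF C0])
    \<comment> \<open>A sum of k gaps below this value stays strictly below m, also for k =
      0.\<close>
    show "m / (real k + 1) > 0" using m by simp
    fix x y \<alpha> assume x: "x \<in> X" and y: "y \<in> X"
      and small: "\<And>i. i < k \<Longrightarrow> \<bar>gap v D \<alpha> i x y\<bar> < m / (real k + 1)"
      and large: "\<eta> < \<bar>gap v D \<alpha> k x y\<bar>"
    \<comment> \<open>Clipping moves the coefficients into the compact cube without changing any
      gap; the \<open>max\<close> summand vanishes because the gap at time k exceeds \<eta>.\<close>
    have "\<psi> ((x, y), \<lambda>j. clip (\<alpha> j)) = (\<Sum>i<k. \<bar>gap v D \<alpha> i x y\<bar>)"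
      using large by (simp add: \<psi>_def)
    also have "\<dots> \<le> (\<Sum>i<k. m / (real k + 1))"
      by (intro sum_mono less_imp_le small) simp
    also have "\<dots> < m" using m(1) by (simp add: field_simps)
    finally have "((x, y), \<lambda>j. clip (\<alpha> j)) \<notin> K'" using m(2) by (meson leD)
    moreover have "((x, y), \<lambda>j. clip (\<alpha> j)) \<in> K" using x y clip_in_unit_cube[of \<alpha>] by (simp add: K_def)
    ultimately have "(x, y) \<in> (\<Union>z\<in>F. U z)" unfolding K'_def by blast
    then show "slab_bound v D k C0 (x, y)" using x y by (intro bnd) simp
  qed
qed

end

section \<open>Covering estimates\<close>

text \<open>Total boundedness provides a cover, so the \<open>LEAST\<close> is attained. Balls are
  bounded, hence their diameter really bounds the distances between their points.\<close>

lemma covering_number_cover: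
  fixes X :: "'a::metric_space set"
  assumes X: "compact X" and \<delta>: "\<delta> > 0"
  obtains \<B> where "finite \<B>" "card \<B> = covering_number X \<delta>" "X \<subseteq> \<Union>\<B>"
    "\<And>B x y. B \<in> \<B> \<Longrightarrow> x \<in> B \<Longrightarrow> y \<in> B \<Longrightarrow> dist x y \<le> \<delta>"
proof -
  define P where "P n \<longleftrightarrow> (\<exists>\<B>. finite \<B> \<and> card \<B> = n \<and> X \<subseteq> \<Union>\<B> \<and>
        (\<forall>B\<in>\<B>. (\<exists>c r. B = ball c r) \<and> diameter B \<le> \<delta>))" for n
  have cov: "covering_number X \<delta> = (LEAST n. P n)" by (simp only: covering_number_def P_def)
  have "seq_compact X" using X by (simp only: compact_eq_seq_compact_metric)
  moreover have "0 < \<delta> / 2" using \<delta> by simp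
  ultimately have "\<exists>A. finite A \<and> A \<subseteq> X \<and> X \<subseteq> (\<Union>a\<in>A. ball a (\<delta> / 2))"
    by (intro seq_compact_imp_totally_bounded[rule_format])
  then obtain A where A: "finite A" "X \<subseteq> (\<Union>a\<in>A. ball a (\<delta> / 2))" by (elim exE conjE)
  have "diameter (ball a (\<delta> / 2)) \<le> \<delta>" for a :: 'a
  proof -
    have "a \<in> ball a (\<delta> / 2)" using \<delta> by simp
    then have ne: "ball a (\<delta> / 2) \<noteq> {}" by blast
    have "(SUP (x, y)\<in>ball a (\<delta> / 2) \<times> ball a (\<delta> / 2). dist x y) \<le> \<delta>"
    proof (rule cSUP_least)
      show "ball a (\<delta> / 2) \<times> ball a (\<delta> / 2) \<noteq> {}" using ne by blast
      fix p assume p_in: "p \<in> ball a (\<delta> / 2) \<times> ball a (\<delta> / 2)"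
      obtain x y where p: "p = (x, y)" by (cases p)
      have "dist a x < \<delta> / 2" "dist a y < \<delta> / 2" using p_in by (simp_all add: p)
      then have "dist x y \<le> \<delta>" using dist_triangle3[of x y a] by linarith
      then show "(case p of (x, y) \<Rightarrow> dist x y) \<le> \<delta>" by (simp add: p)
    qed
    then show ?thesis using ne by (simp add: diameter_def)
  qed
  then have "\<forall>B\<in>(\<lambda>a. ball a (\<delta> / 2)) ` A. (\<exists>c r. B = ball c r) \<and> diameter B \<le> \<delta>"
    by blast
  with A have "P (card ((\<lambda>a. ball a (\<delta> / 2)) ` A))"
    unfolding P_def by (intro exI[of _ "(\<lambda>a. ball a (\<delta> / 2)) ` A"] conjI) simp_all
  then have "P (covering_number X \<delta>)" unfolding cov by (rule LeastI)
  then obtain \<B> where \<B>: "finite \<B>" "card \<B> = covering_number X \<delta>" "X \<subseteq> \<Union>\<B>"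
    "\<forall>B\<in>\<B>. (\<exists>c r. B = ball c r) \<and> diameter B \<le> \<delta>" unfolding P_def by (elim exE conjE)
  show ?thesis
  proof (rule that[OF \<B>(1-3)])
    fix B x y assume B: "B \<in> \<B>" "x \<in> B" "y \<in> B"
    from \<B>(4) B(1) have "(\<exists>c r. B = ball c r) \<and> diameter B \<le> \<delta>" by (rule bspec)
    then obtain c r where r: "B = ball c r" and diam: "diameter B \<le> \<delta>" by (elim exE conjE)
    have "bounded B" by (simp only: r bounded_ball)
    then have "dist x y \<le> diameter B" using B(2,3) by (rule diameter_bounded_bound)
    then show "dist x y \<le> \<delta>" using diam by linarith
  qed
qed

lemma le_powr_if_ln_quotient_less:
  fixes n :: nat
  assumes "0 < \<delta>" "\<delta> < 1" "ln (real n) / (- ln \<delta>) < d"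
  shows "real n \<le> \<delta> powr (- d)"
proof (cases "n = 0")
  case False
  have "0 < - ln \<delta>" using assms(1,2) by simp
  with assms(3) have "ln (real n) < d * (- ln \<delta>)" by (simp only: pos_divide_less_eq)
  then have "exp (ln (real n)) \<le> exp (- d * ln \<delta>)" by simp
  then show ?thesis using False assms(1) by (simp add: powr_def)
qed simp

lemma upper_box_dim_covering:
  assumes "upper_box_dim X < ereal d"
  shows "\<forall>\<^sub>F \<delta> in at_right 0. real (covering_number X \<delta>) \<le> \<delta> powr (- d)"
proof -
  have "\<forall>\<^sub>F \<delta> in at_right 0. ereal (ln (real (covering_number X \<delta>)) / (- ln \<delta>)) < ereal d"
    by (rule Limsup_lessD) (use assms in \<open>simp add: upper_box_dim_def\<close>)
  moreover have "\<forall>\<^sub>F \<delta> in at_right (0::real). \<delta> \<in> {0<..<1}"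
    by (rule eventually_at_right_real) simp
  ultimately show ?thesis
    by eventually_elim (simp add: le_powr_if_ln_quotient_less)
qed

text \<open>The lower limit controls only arbitrarily small scales, hence \<open>frequently\<close>;
  this is enough for events that are monotone in the scale.\<close>

lemma lower_box_dim_covering:
  assumes "lower_box_dim X < ereal d"
  shows "\<exists>\<^sub>F \<delta> in at_right 0. 0 < \<delta> \<and> real (covering_number X \<delta>) \<le> \<delta> powr (- d)"
proof -
  have freq: "\<exists>\<^sub>F \<delta> in at_right 0. ereal (ln (real (covering_number X \<delta>)) / (- ln \<delta>)) < ereal d"
  proof (rule ccontr)
    assume "\<not> ?thesis"
    then have "\<forall>\<^sub>F \<delta> in at_right 0. ereal d \<le> ereal (ln (real (covering_number X \<delta>)) / (- ln \<delta>))"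
      unfolding frequently_def not_not not_less .
    then have "ereal d \<le> lower_box_dim X" unfolding lower_box_dim_def by (rule Liminf_bounded)
    with assms show False by simp
  qed
  have "\<forall>\<^sub>F \<delta> in at_right (0::real). \<delta> \<in> {0<..<1}"
    by (rule eventually_at_right_real) simp
  then have "\<forall>\<^sub>F \<delta> in at_right 0. ereal (ln (real (covering_number X \<delta>)) / (- ln \<delta>)) < ereal d \<longrightarrow>
      0 < \<delta> \<and> real (covering_number X \<delta>) \<le> \<delta> powr (- d)"
    by eventually_elim (simp add: le_powr_if_ln_quotient_less)
  then show ?thesis by (rule frequently_rev_mp[OF freq])
qed

section \<open>Union bounds over coverings\<close>

context lipschitz_system
begin

text \<open>The observable is Lipschitz with the constant of \<open>v\<close> plus 4, whatever
  \<alpha> is, and the iterates up to time k - 1 are Lipschitz too; so \<open>M\<close> is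
  deterministic.\<close>

lemma gap_perturb:
  assumes v: "v \<in> Lip X"
  obtains M where "M \<ge> 0"
    "\<And>\<alpha> i x y x' y'. i < k \<Longrightarrow> x \<in> X \<Longrightarrow> y \<in> X \<Longrightarrow> x' \<in> X \<Longrightarrow> y' \<in> X \<Longrightarrow>
      \<bar>gap v D \<alpha> i x y\<bar> \<le> \<bar>gap v D \<alpha> i x' y'\<bar> + M * (dist x x' + dist y y')"
proof -
  obtain K where K: "K-lipschitz_on X v" using v by (auto simp: Lip_def)
  have K0: "K \<ge> 0" by (rule lipschitz_on_nonneg[OF K])
  have L0: "L \<ge> 0" by (rule lipschitz_on_nonneg[OF T_lipschitz])
  \<comment> \<open>The sum is a common bound for all \<open>L ^ i\<close> with i < k, whether L is
    below or above 1.\<close>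
  define M where "M = (K + 4) * (\<Sum>i<k. L ^ i)"
  have M0: "M \<ge> 0" unfolding M_def using K0 L0 by (intro mult_nonneg_nonneg sum_nonneg) simp_all
  have one: "\<bar>(v ((T ^^ i) x) + probe D \<alpha> ((T ^^ i) x)) - (v ((T ^^ i) x') + probe D \<alpha> ((T ^^ i) x'))\<bar> \<le> M * dist x x'"
    if i: "i < k" and x: "x \<in> X" "x' \<in> X" for \<alpha> i x x'
  proof -
    let ?d = "dist ((T ^^ i) x) ((T ^^ i) x')"
    have "\<bar>v ((T ^^ i) x) - v ((T ^^ i) x')\<bar> \<le> K * ?d"
      using lipschitz_onD[OF K iter_in[OF x(1)] iter_in[OF x(2)]] by (simp add: dist_real_def)
    moreover have "\<bar>probe D \<alpha> ((T ^^ i) x) - probe D \<alpha> ((T ^^ i) x')\<bar> \<le> 4 * ?d"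
      by (rule probe_lipschitz)
    ultimately have "\<bar>(v ((T ^^ i) x) + probe D \<alpha> ((T ^^ i) x)) - (v ((T ^^ i) x') + probe D \<alpha> ((T ^^ i) x'))\<bar>
        \<le> K * ?d + 4 * ?d" by linarith
    also have "\<dots> = (K + 4) * ?d" by (simp only: distrib_right)
    finally have "\<bar>(v ((T ^^ i) x) + probe D \<alpha> ((T ^^ i) x)) - (v ((T ^^ i) x') + probe D \<alpha> ((T ^^ i) x'))\<bar>
        \<le> (K + 4) * ?d" .
    also have "\<dots> \<le> (K + 4) * (L ^ i * dist x x')"
      using lipschitz_onD[OF iter_lipschitz x] K0 by (intro mult_left_mono) simp_all
    also have "\<dots> \<le> (K + 4) * ((\<Sum>i<k. L ^ i) * dist x x')"
    proof (intro mult_left_mono mult_right_mono)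
      show "L ^ i \<le> (\<Sum>i<k. L ^ i)"
        by (rule member_le_sum[where f = "\<lambda>i. L ^ i"]) (use i L0 in simp_all)
    qed (use K0 in simp_all)
    also have "\<dots> = M * dist x x'" by (simp only: M_def mult.assoc)
    finally show ?thesis .
  qed
  show ?thesis
  proof (rule that[OF M0])
    fix \<alpha> i x y x' y' assume i: "i < k" and X: "x \<in> X" "y \<in> X" "x' \<in> X" "y' \<in> X"
    show "\<bar>gap v D \<alpha> i x y\<bar> \<le> \<bar>gap v D \<alpha> i x' y'\<bar> + M * (dist x x' + dist y y')"
      using one[OF i X(1,3), of \<alpha>] one[OF i X(2,4), of \<alpha>] unfolding gap_def distrib_left by linarith
  qed
qed

lemma sets_slab: "{\<alpha>. \<forall>i<k. \<bar>gap v D \<alpha> i x y\<bar> < \<epsilon>} \<in> sets cube"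
proof -
  have [measurable]: "(\<lambda>\<alpha>. gap v D \<alpha> i x y) \<in> borel_measurable cube" for i
    by (rule borel_measurable_gap)
  have "{\<alpha> \<in> space cube. \<forall>i\<in>{..<k}. \<bar>gap v D \<alpha> i x y\<bar> < \<epsilon>} \<in> sets cube"
  proof (rule sets.sets_Collect_finite_All[OF _ finite_lessThan])
    show "{\<alpha> \<in> space cube. \<bar>gap v D \<alpha> i x y\<bar> < \<epsilon>} \<in> sets cube" for i by measurable
  qed
  then show ?thesis unfolding Ball_def lessThan_iff space_cube by (simp only: UNIV_I simp_thms)
qed

text \<open>A union bound. A bad pair in a patch makes the gaps at a fixed pair of the same patch
  smaller than (1 + 2M) \<epsilon>, which explains the constant. The patches are left open in order
  to cover either one slice or all of X \<times> X.\<close>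

lemma emeasure_cover:
  assumes dense: "\<forall>S. open S \<longrightarrow> S \<noteq> {} \<longrightarrow> (\<exists>m. D m \<in> S)" and v: "v \<in> Lip X" and \<eta>: "\<eta> > 0"
  obtains C \<epsilon>1 where "C > 0" "\<epsilon>1 > 0"
    "\<And>\<C> \<epsilon> E. finite \<C> \<Longrightarrow> 0 < \<epsilon> \<Longrightarrow> \<epsilon> < \<epsilon>1 \<Longrightarrow>
      (\<And>P p q. P \<in> \<C> \<Longrightarrow> p \<in> P \<inter> X \<times> X \<Longrightarrow> q \<in> P \<inter> X \<times> X \<Longrightarrow> dist (fst p) (fst q) + dist (snd p) (snd q) \<le> 2 * \<epsilon>) \<Longrightarrow>
      (\<And>\<alpha>. \<alpha> \<in> E \<Longrightarrow> \<exists>P\<in>\<C>. \<exists>p\<in>P \<inter> X \<times> X. (\<forall>i<k. \<bar>gap v D \<alpha> i (fst p) (snd p)\<bar> < \<epsilon>) \<and> \<eta> < \<bar>gap v D \<alpha> k (fst p) (snd p)\<bar>) \<Longrightarrow>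
      emeasure cube E \<le> ennreal (real (card \<C>) * (C * \<epsilon> ^ k))"
proof -
  obtain C \<epsilon>1 where C: "C > 0" "\<epsilon>1 > 0" and sb: "\<And>x y \<alpha>. x \<in> X \<Longrightarrow> y \<in> X \<Longrightarrow>
      (\<And>i. i < k \<Longrightarrow> \<bar>gap v D \<alpha> i x y\<bar> < \<epsilon>1) \<Longrightarrow> \<eta> < \<bar>gap v D \<alpha> k x y\<bar> \<Longrightarrow> slab_bound v D k C (x, y)"
    using slab_bound_off_divergence[OF dense v \<eta>, of k] by metis
  obtain M where M: "M \<ge> 0" and pert: "\<And>\<alpha> i x y x' y'. i < k \<Longrightarrow> x \<in> X \<Longrightarrow> y \<in> X \<Longrightarrow> x' \<in> X \<Longrightarrow> y' \<in> X \<Longrightarrow>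
      \<bar>gap v D \<alpha> i x y\<bar> \<le> \<bar>gap v D \<alpha> i x' y'\<bar> + M * (dist x x' + dist y y')"
    using gap_perturb[OF v, of k D] by metis
  define C' where "C' = C * (1 + 2 * M) ^ k"
  show ?thesis
  proof (rule that)
    show "C' > 0" unfolding C'_def using C M by simp
    show "\<epsilon>1 > 0" by (rule C)
    fix \<C> :: "('a \<times> 'a) set set" and \<epsilon> :: real and E :: "(nat \<Rightarrow> real) set"
    assume fin: "finite \<C>" and \<epsilon>: "0 < \<epsilon>" "\<epsilon> < \<epsilon>1"
      and small: "\<And>P p q. P \<in> \<C> \<Longrightarrow> p \<in> P \<inter> X \<times> X \<Longrightarrow> q \<in> P \<inter> X \<times> X \<Longrightarrow>
        dist (fst p) (fst q) + dist (snd p) (snd q) \<le> 2 * \<epsilon>"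
      and E: "\<And>\<alpha>. \<alpha> \<in> E \<Longrightarrow> \<exists>P\<in>\<C>. \<exists>p\<in>P \<inter> X \<times> X.
        (\<forall>i<k. \<bar>gap v D \<alpha> i (fst p) (snd p)\<bar> < \<epsilon>) \<and> \<eta> < \<bar>gap v D \<alpha> k (fst p) (snd p)\<bar>"
    \<comment> \<open>The bad pair depends on \<alpha>, but a representative must not. Any patch
      with a bad pair contains a pair satisfying the slab bound, and one such pair is fixed per
      patch.\<close>
    define \<C>' where "\<C>' = {P \<in> \<C>. \<exists>q\<in>P \<inter> X \<times> X. slab_bound v D k C q}"
    have fin': "finite \<C>'" using fin by (simp add: \<C>'_def)
    have "\<forall>P\<in>\<C>'. \<exists>q. q \<in> P \<inter> X \<times> X \<and> slab_bound v D k C q" unfolding \<C>'_def by blast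
    from bchoice[OF this] obtain q
      where q: "\<And>P. P \<in> \<C>' \<Longrightarrow> q P \<in> P \<inter> X \<times> X \<and> slab_bound v D k C (q P)" by blast
    let ?A = "\<lambda>P. {\<alpha>. \<forall>i<k. \<bar>gap v D \<alpha> i (fst (q P)) (snd (q P))\<bar> < (1 + 2 * M) * \<epsilon>}"
    have "E \<subseteq> (\<Union>P\<in>\<C>'. ?A P)"
    proof
      fix \<alpha> assume "\<alpha> \<in> E"
      from E[OF this] obtain P p where P: "P \<in> \<C>" and p: "p \<in> P \<inter> X \<times> X"
        and g: "\<And>i. i < k \<Longrightarrow> \<bar>gap v D \<alpha> i (fst p) (snd p)\<bar> < \<epsilon>" "\<eta> < \<bar>gap v D \<alpha> k (fst p) (snd p)\<bar>" by blast
      have pX: "fst p \<in> X" "snd p \<in> X" using p by auto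
      have "slab_bound v D k C (fst p, snd p)"
        by (rule sb[OF pX _ g(2)]) (rule less_trans[OF g(1) \<epsilon>(2)])
      then have P': "P \<in> \<C>'" unfolding \<C>'_def using P p by auto
      have qX: "fst (q P) \<in> X" "snd (q P) \<in> X" and qP: "q P \<in> P \<inter> X \<times> X" using q[OF P'] by auto
      have "\<bar>gap v D \<alpha> i (fst (q P)) (snd (q P))\<bar> < (1 + 2 * M) * \<epsilon>" if i: "i < k" for i
      proof -
        have "M * (dist (fst (q P)) (fst p) + dist (snd (q P)) (snd p)) \<le> M * (2 * \<epsilon>)"
          using small[OF P qP p] M by (rule mult_left_mono)
        then show ?thesis
          using pert[OF i qX pX, of \<alpha>] g(1)[OF i] by (simp add: distrib_right)
      qed
      then show "\<alpha> \<in> (\<Union>P\<in>\<C>'. ?A P)" using P' by blast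
    qed
    then have "emeasure cube E \<le> emeasure cube (\<Union>P\<in>\<C>'. ?A P)"
      using fin' by (intro emeasure_mono sets.finite_UN sets_slab)
    also have "\<dots> \<le> (\<Sum>P\<in>\<C>'. emeasure cube (?A P))"
      using fin' sets_slab by (intro emeasure_subadditive_finite) blast+
    also have "\<dots> \<le> (\<Sum>P\<in>\<C>'. ennreal (C' * \<epsilon> ^ k))"
    proof (rule sum_mono)
      fix P assume P: "P \<in> \<C>'"
      have "0 < (1 + 2 * M) * \<epsilon>" using M \<epsilon> by simp
      then have "emeasure cube (?A P) \<le> ennreal (C * ((1 + 2 * M) * \<epsilon>) ^ k)"
        using q[OF P] unfolding slab_bound_def by blast
      then show "emeasure cube (?A P) \<le> ennreal (C' * \<epsilon> ^ k)"
        by (simp add: C'_def power_mult_distrib mult.assoc)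
    qed
    also have "\<dots> = ennreal (real (card \<C>') * (C' * \<epsilon> ^ k))"
      by (simp add: ennreal_mult' ennreal_of_nat_eq_real_of_nat)
    also have "\<dots> \<le> ennreal (real (card \<C>) * (C' * \<epsilon> ^ k))"
    proof (intro ennreal_leI mult_right_mono)
      have "card \<C>' \<le> card \<C>" unfolding \<C>'_def using fin by (intro card_mono) auto
      then show "real (card \<C>') \<le> real (card \<C>)" by simp
      show "0 \<le> C' * \<epsilon> ^ k" using \<open>C' > 0\<close> \<epsilon> by simp
    qed
    finally show "emeasure cube E \<le> ennreal (real (card \<C>) * (C' * \<epsilon> ^ k))" .
  qed
qed

definition obs :: "('a \<Rightarrow> real) \<Rightarrow> (nat \<Rightarrow> 'a) \<Rightarrow> (nat \<Rightarrow> real) \<Rightarrow> 'a \<Rightarrow> real" where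
  "obs v D \<alpha> = (\<lambda>x. v x + probe_on X D \<alpha> x)"

lemma obs_Lip: "v \<in> Lip X \<Longrightarrow> obs v D \<alpha> \<in> Lip X"
  unfolding obs_def by (rule Lip_add[OF _ probe_on_Lip])

lemma divergence_set_obs:
  "divergence_set X T (obs v D \<alpha>) k \<epsilon> \<eta> =
     {x \<in> X. \<exists>y\<in>X. (\<forall>i<k. \<bar>gap v D \<alpha> i x y\<bar> < \<epsilon>) \<and> \<eta> < \<bar>gap v D \<alpha> k x y\<bar>}"
  unfolding divergence_set_def obs_def using gap_eq[of _ _ v D \<alpha>] by (intro Collect_cong) (metis (no_types, lifting))

text \<open>For fixed x the patches are {x} \<times> B, one per covering ball; for all pairs they
  are the products A \<times> B. This is where the covering number enters once or squared.\<close>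

lemma divergence_estimates:
  assumes dense: "\<forall>S. open S \<longrightarrow> S \<noteq> {} \<longrightarrow> (\<exists>m. D m \<in> S)" and v: "v \<in> Lip X" and \<eta>: "\<eta> > 0"
  obtains C \<epsilon>1 where "C > 0" "\<epsilon>1 > 0"
    "\<And>\<epsilon> x. 0 < \<epsilon> \<Longrightarrow> \<epsilon> < \<epsilon>1 \<Longrightarrow> x \<in> X \<Longrightarrow>
      emeasure cube {\<alpha>. x \<in> divergence_set X T (obs v D \<alpha>) k \<epsilon> \<eta>} \<le>
        ennreal (real (covering_number X \<epsilon>) * (C * \<epsilon> ^ k))"
    "\<And>\<epsilon>. 0 < \<epsilon> \<Longrightarrow> \<epsilon> < \<epsilon>1 \<Longrightarrow>
      emeasure cube {\<alpha>. divergence_set X T (obs v D \<alpha>) k \<epsilon> \<eta> \<noteq> {}} \<le>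
        ennreal ((real (covering_number X \<epsilon>))\<^sup>2 * (C * \<epsilon> ^ k))"
proof -
  obtain C \<epsilon>1 where C: "C > 0" "\<epsilon>1 > 0" and
    est: "\<And>\<C> \<epsilon> E. finite \<C> \<Longrightarrow> 0 < \<epsilon> \<Longrightarrow> \<epsilon> < \<epsilon>1 \<Longrightarrow>
      (\<And>P p q. P \<in> \<C> \<Longrightarrow> p \<in> P \<inter> X \<times> X \<Longrightarrow> q \<in> P \<inter> X \<times> X \<Longrightarrow> dist (fst p) (fst q) + dist (snd p) (snd q) \<le> 2 * \<epsilon>) \<Longrightarrow>
      (\<And>\<alpha>. \<alpha> \<in> E \<Longrightarrow> \<exists>P\<in>\<C>. \<exists>p\<in>P \<inter> X \<times> X. (\<forall>i<k. \<bar>gap v D \<alpha> i (fst p) (snd p)\<bar> < \<epsilon>) \<and> \<eta> < \<bar>gap v D \<alpha> k (fst p) (snd p)\<bar>) \<Longrightarrow>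
      emeasure cube E \<le> ennreal (real (card \<C>) * (C * \<epsilon> ^ k))"
    using emeasure_cover[OF dense v \<eta>, of k] by blast
  show ?thesis
  proof (rule that[OF C])
    fix \<epsilon> x assume \<epsilon>: "0 < \<epsilon>" "\<epsilon> < \<epsilon>1" and x: "x \<in> X"
    obtain \<B> where \<B>: "finite \<B>" "card \<B> = covering_number X \<epsilon>" "X \<subseteq> \<Union>\<B>"
      and diam: "\<And>B x y. B \<in> \<B> \<Longrightarrow> x \<in> B \<Longrightarrow> y \<in> B \<Longrightarrow> dist x y \<le> \<epsilon>"
      using covering_number_cover[OF compact_X \<epsilon>(1)] by metis
    let ?C = "(\<lambda>B. {x} \<times> B) ` \<B>"
    have "emeasure cube {\<alpha>. x \<in> divergence_set X T (obs v D \<alpha>) k \<epsilon> \<eta>} \<le> ennreal (real (card ?C) * (C * \<epsilon> ^ k))"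
    proof (rule est[OF _ \<epsilon>])
      show "finite ?C" using \<B> by simp
      fix P p q assume "P \<in> ?C" "p \<in> P \<inter> X \<times> X" "q \<in> P \<inter> X \<times> X"
      then obtain B where "B \<in> \<B>" "fst p = x" "fst q = x" "snd p \<in> B" "snd q \<in> B" by auto
      then show "dist (fst p) (fst q) + dist (snd p) (snd q) \<le> 2 * \<epsilon>" using diam[of B] \<epsilon> by fastforce
    next
      fix \<alpha> assume "\<alpha> \<in> {\<alpha>. x \<in> divergence_set X T (obs v D \<alpha>) k \<epsilon> \<eta>}"
      then obtain y where y: "y \<in> X" "\<forall>i<k. \<bar>gap v D \<alpha> i x y\<bar> < \<epsilon>" "\<eta> < \<bar>gap v D \<alpha> k x y\<bar>"
        unfolding divergence_set_obs by blast
      then obtain B where B: "B \<in> \<B>" "y \<in> B" using \<B> by blast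
      show "\<exists>P\<in>?C. \<exists>p\<in>P \<inter> X \<times> X. (\<forall>i<k. \<bar>gap v D \<alpha> i (fst p) (snd p)\<bar> < \<epsilon>) \<and> \<eta> < \<bar>gap v D \<alpha> k (fst p) (snd p)\<bar>"
        by (rule bexI[of _ "{x} \<times> B"], rule bexI[of _ "(x, y)"]) (use B x y in simp_all)
    qed
    also have "\<dots> \<le> ennreal (real (covering_number X \<epsilon>) * (C * \<epsilon> ^ k))"
      using card_image_le[OF \<B>(1), of "\<lambda>B. {x} \<times> B"] \<B>(2) C \<epsilon> by (intro ennreal_leI mult_right_mono) simp_all
    finally show "emeasure cube {\<alpha>. x \<in> divergence_set X T (obs v D \<alpha>) k \<epsilon> \<eta>} \<le>
        ennreal (real (covering_number X \<epsilon>) * (C * \<epsilon> ^ k))" .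
  next
    fix \<epsilon> assume \<epsilon>: "0 < \<epsilon>" "\<epsilon> < \<epsilon>1"
    obtain \<B> where \<B>: "finite \<B>" "card \<B> = covering_number X \<epsilon>" "X \<subseteq> \<Union>\<B>"
      and diam: "\<And>B x y. B \<in> \<B> \<Longrightarrow> x \<in> B \<Longrightarrow> y \<in> B \<Longrightarrow> dist x y \<le> \<epsilon>"
      using covering_number_cover[OF compact_X \<epsilon>(1)] by metis
    let ?C = "(\<lambda>(A, B). A \<times> B) ` (\<B> \<times> \<B>)"
    have "emeasure cube {\<alpha>. divergence_set X T (obs v D \<alpha>) k \<epsilon> \<eta> \<noteq> {}} \<le> ennreal (real (card ?C) * (C * \<epsilon> ^ k))"
    proof (rule est[OF _ \<epsilon>])
      show "finite ?C" using \<B> by simp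
      fix P p q assume "P \<in> ?C" "p \<in> P \<inter> X \<times> X" "q \<in> P \<inter> X \<times> X"
      then obtain A B where "A \<in> \<B>" "B \<in> \<B>" "fst p \<in> A" "fst q \<in> A" "snd p \<in> B" "snd q \<in> B" by auto
      then show "dist (fst p) (fst q) + dist (snd p) (snd q) \<le> 2 * \<epsilon>"
        using diam[of A "fst p" "fst q"] diam[of B "snd p" "snd q"] by linarith
    next
      fix \<alpha> assume "\<alpha> \<in> {\<alpha>. divergence_set X T (obs v D \<alpha>) k \<epsilon> \<eta> \<noteq> {}}"
      then obtain x y where y: "x \<in> X" "y \<in> X" "\<forall>i<k. \<bar>gap v D \<alpha> i x y\<bar> < \<epsilon>" "\<eta> < \<bar>gap v D \<alpha> k x y\<bar>"
        unfolding divergence_set_obs by blast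
      then obtain A B where B: "A \<in> \<B>" "x \<in> A" "B \<in> \<B>" "y \<in> B" using \<B> by blast
      show "\<exists>P\<in>?C. \<exists>p\<in>P \<inter> X \<times> X. (\<forall>i<k. \<bar>gap v D \<alpha> i (fst p) (snd p)\<bar> < \<epsilon>) \<and> \<eta> < \<bar>gap v D \<alpha> k (fst p) (snd p)\<bar>"
      proof (rule bexI[of _ "A \<times> B"], rule bexI[of _ "(x, y)"])
        show "A \<times> B \<in> ?C" using B by (intro image_eqI[of _ _ "(A, B)"]) simp_all
      qed (use B y in simp_all)
    qed
    also have "\<dots> \<le> ennreal ((real (covering_number X \<epsilon>))\<^sup>2 * (C * \<epsilon> ^ k))"
    proof (intro ennreal_leI mult_right_mono)
      have "card ?C \<le> card (\<B> \<times> \<B>)" by (rule card_image_le) (use \<B> in simp)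
      also have "\<dots> = (covering_number X \<epsilon>)\<^sup>2" using \<B> by (simp add: card_cartesian_product power2_eq_square)
      finally show "real (card ?C) \<le> (real (covering_number X \<epsilon>))\<^sup>2" by (metis of_nat_le_iff of_nat_power)
      show "0 \<le> C * \<epsilon> ^ k" using C \<epsilon> by simp
    qed
    finally show "emeasure cube {\<alpha>. divergence_set X T (obs v D \<alpha>) k \<epsilon> \<eta> \<noteq> {}} \<le>
        ennreal ((real (covering_number X \<epsilon>))\<^sup>2 * (C * \<epsilon> ^ k))" .
  qed
qed

end

section \<open>Almost sure bounds\<close>

lemma powr_half_power: "((1 / 2 :: real) ^ n) powr a = ((1 / 2) powr a) ^ n"
  by (simp add: powr_power powr_realpow[symmetric] powr_powr mult.commute)

context lipschitz_prob_system
begin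

lemma measurable_obs:
  assumes "v \<in> Lip X"
  shows "obs v D \<in> cube \<rightarrow>\<^sub>M Lip_borel X"
  using measurable_compose[OF measurable_probe_on[OF bounded_X] measurable_Lip_translate[OF bounded_X assms]]
  unfolding obs_def[abs_def] .

lemma measurable_divergence_set_obs:
  assumes v: "v \<in> Lip X"
  shows "(\<lambda>\<alpha>. measure \<mu> (divergence_set X T (obs v D \<alpha>) k \<epsilon> \<eta>)) \<in> borel_measurable cube"
proof (rule borel_measurableI_le)
  fix c
  show "{\<alpha> \<in> space cube. measure \<mu> (divergence_set X T (obs v D \<alpha>) k \<epsilon> \<eta>) \<le> c} \<in> sets cube"
    using measurable_compose[OF measurable_obs[OF v, of D] pred_divergence_set_measure[of k \<epsilon> \<eta> c]]
    unfolding pred_def .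
qed

text \<open>With N(\<epsilon>) \<le> \<epsilon>^(-d) and 2d < k the bound for pairs is C
  \<epsilon>^(k - 2d), arbitrarily small along suitable scales. The events decrease with \<epsilon>,
  so their intersection is null.\<close>

lemma AE_divergence_set_empty:
  assumes dense: "\<forall>S. open S \<longrightarrow> S \<noteq> {} \<longrightarrow> (\<exists>m. D m \<in> S)" and v: "v \<in> Lip X" and \<eta>: "\<eta> > 0"
    and dim: "2 * lower_box_dim X < ereal (real k)"
  shows "AE \<alpha> in cube. \<exists>j. divergence_set X T (obs v D \<alpha>) k (1 / real (Suc j)) \<eta> = {}"
proof (rule AE_I')
  let ?E = "\<lambda>\<epsilon>. {\<alpha>. divergence_set X T (obs v D \<alpha>) k \<epsilon> \<eta> \<noteq> {}}"
  let ?N = "\<Inter>j. ?E (1 / real (Suc j))"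
  have E: "?E \<epsilon> \<in> sets cube" for \<epsilon>
  proof -
    have "Measurable.pred cube (\<lambda>\<alpha>. divergence_set X T (obs v D \<alpha>) k \<epsilon> \<eta> = {})"
      by (rule measurable_compose[OF measurable_obs[OF v, of D] pred_divergence_set_empty[of k \<epsilon> \<eta>]])
    then have "Measurable.pred cube (\<lambda>\<alpha>. divergence_set X T (obs v D \<alpha>) k \<epsilon> \<eta> \<noteq> {})" by measurable
    then show ?thesis by (simp add: pred_def)
  qed
  show "{\<alpha> \<in> space cube. \<not> (\<exists>j. divergence_set X T (obs v D \<alpha>) k (1 / real (Suc j)) \<eta> = {})} \<subseteq> ?N"
    by blast
  have N: "?N \<in> sets cube" by (intro sets.countable_INT image_subsetI E) simp
  obtain d where d: "lower_box_dim X < ereal d" "2 * d < real k"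
  proof -
    have "lower_box_dim X < ereal (real k / 2)"
      using dim lower_box_dim_nonneg[of X] by (cases "lower_box_dim X") auto
    from ereal_dense2[OF this] obtain d where "lower_box_dim X < ereal d" "ereal d < ereal (real k / 2)"
      by (elim exE conjE)
    then show ?thesis by (intro that[of d]) simp_all
  qed
  obtain C \<epsilon>1 where C: "C > 0" "\<epsilon>1 > 0" and est: "\<And>\<epsilon>. 0 < \<epsilon> \<Longrightarrow> \<epsilon> < \<epsilon>1 \<Longrightarrow>
      emeasure cube (?E \<epsilon>) \<le> ennreal ((real (covering_number X \<epsilon>))\<^sup>2 * (C * \<epsilon> ^ k))"
    using divergence_estimates[OF dense v \<eta>, of k] by metis
  have bound: "emeasure cube ?N \<le> ennreal c" if c: "c > 0" for c
  proof -
    have "((\<lambda>\<epsilon>. C * \<epsilon> powr (real k - 2 * d)) \<longlongrightarrow> C * 0) (at_right 0)"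
    proof (intro tendsto_mult tendsto_const)
      have "\<forall>\<^sub>F \<epsilon> in at_right (0::real). 0 \<le> \<epsilon>"
        using eventually_at_right_less[of "0::real"] by (rule eventually_mono) simp
      then have "((\<lambda>\<epsilon>. \<epsilon> powr (real k - 2 * d)) \<longlongrightarrow> 0 powr (real k - 2 * d)) (at_right 0)"
        using d(2) by (intro tendsto_powr'[OF tendsto_ident_at tendsto_const]) simp
      then show "((\<lambda>\<epsilon>. \<epsilon> powr (real k - 2 * d)) \<longlongrightarrow> 0) (at_right 0)" by simp
    qed
    then have "\<forall>\<^sub>F \<epsilon> in at_right 0. C * \<epsilon> powr (real k - 2 * d) < c"
      using c by (intro order_tendstoD(2)) simp_all
    moreover have "\<forall>\<^sub>F \<epsilon> in at_right (0::real). \<epsilon> \<in> {0<..<\<epsilon>1}"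
      by (rule eventually_at_right_real[OF C(2)])
    ultimately have ev: "\<forall>\<^sub>F \<epsilon> in at_right 0. C * \<epsilon> powr (real k - 2 * d) < c \<and> \<epsilon> < \<epsilon>1"
      by eventually_elim simp
    have freq: "\<exists>\<^sub>F \<epsilon> in at_right 0. (0 < \<epsilon> \<and> real (covering_number X \<epsilon>) \<le> \<epsilon> powr (- d)) \<and>
        C * \<epsilon> powr (real k - 2 * d) < c \<and> \<epsilon> < \<epsilon>1"
      by (rule frequently_eventually_frequently[OF lower_box_dim_covering[OF d(1)] ev])
    from frequently_ex[OF freq] obtain \<epsilon> where \<epsilon>: "0 < \<epsilon>" "\<epsilon> < \<epsilon>1" "real (covering_number X \<epsilon>) \<le> \<epsilon> powr (- d)"
      "C * \<epsilon> powr (real k - 2 * d) < c" by (elim exE conjE)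
    \<comment> \<open>The scales supplied by the dimension need not be of the form 1/(j+1);
      monotonicity in the scale links the two families.\<close>
    obtain j where j: "1 / real (Suc j) < \<epsilon>" by (rule nat_approx_posE[OF \<epsilon>(1)])
    have "?N \<subseteq> ?E (1 / real (Suc j))" by (rule INT_lower) simp
    also have "\<dots> \<subseteq> ?E \<epsilon>"
    proof (rule Collect_mono, rule impI)
      fix \<alpha> assume "divergence_set X T (obs v D \<alpha>) k (1 / real (Suc j)) \<eta> \<noteq> {}"
      then show "divergence_set X T (obs v D \<alpha>) k \<epsilon> \<eta> \<noteq> {}"
        using divergence_set_mono[OF less_imp_le[OF j] order_refl, of X T "obs v D \<alpha>" k \<eta>] by blast
    qed
    finally have "?N \<subseteq> ?E \<epsilon>" .
    then have "emeasure cube ?N \<le> emeasure cube (?E \<epsilon>)" by (rule emeasure_mono[OF _ E])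
    also have "\<dots> \<le> ennreal ((real (covering_number X \<epsilon>))\<^sup>2 * (C * \<epsilon> ^ k))" by (rule est[OF \<epsilon>(1,2)])
    also have "\<dots> \<le> ennreal ((\<epsilon> powr (- d))\<^sup>2 * (C * \<epsilon> ^ k))"
      using \<epsilon> C by (intro ennreal_leI mult_right_mono power_mono) simp_all
    also have "(\<epsilon> powr (- d))\<^sup>2 * (C * \<epsilon> ^ k) = C * \<epsilon> powr (real k - 2 * d)"
    proof -
      have "(\<epsilon> powr (- d))\<^sup>2 = \<epsilon> powr (- 2 * d)" using \<epsilon>(1) by (simp add: powr_power)
      moreover have "\<epsilon> ^ k = \<epsilon> powr real k" using \<epsilon>(1) by (simp add: powr_realpow)
      moreover have "\<epsilon> powr (- 2 * d) * \<epsilon> powr real k = \<epsilon> powr (real k - 2 * d)"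
        by (simp add: powr_add[symmetric])
      ultimately show ?thesis by (simp only: mult.left_commute)
    qed
    also have "ennreal (C * \<epsilon> powr (real k - 2 * d)) \<le> ennreal c" using \<epsilon>(4) by (intro ennreal_leI) simp
    finally show ?thesis .
  qed
  have "emeasure cube ?N \<le> 0"
  proof (rule ennreal_le_epsilon)
    fix c :: real assume "0 < c"
    then show "emeasure cube ?N \<le> 0 + ennreal c" unfolding add_0 by (rule bound)
  qed
  then have "emeasure cube ?N = 0" by (simp only: le_zero_eq)
  then show "?N \<in> null_sets cube" using N by (rule null_setsI)
qed

text \<open>Tonelli's theorem. The set of pairs (\<alpha>, x) is relatively open; second
  countability identifies the product \<sigma>-algebra with the Borel sets of the product, which
  gives joint measurability.\<close>

lemma nn_integral_divergence_set:
  assumes v: "v \<in> Lip X"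
  shows "(\<integral>\<^sup>+ \<alpha>. emeasure \<mu> (divergence_set X T (obs v D \<alpha>) k \<epsilon> \<eta>) \<partial>cube) =
    (\<integral>\<^sup>+ x. emeasure cube {\<alpha>. x \<in> divergence_set X T (obs v D \<alpha>) k \<epsilon> \<eta>} \<partial>\<mu>)"
proof -
  interpret C: prob_space cube by (rule prob_space_cube)
  interpret P: pair_sigma_finite cube \<mu> ..
  define E where "E = {w \<in> UNIV \<times> X. \<exists>y\<in>X. (\<forall>i<k. \<bar>gap v D (fst w) i (snd w) y\<bar> < \<epsilon>) \<and> \<eta> < \<bar>gap v D (fst w) k (snd w) y\<bar>}"
  have "openin (top_of_set (UNIV \<times> X)) E"
    unfolding E_def
    by (rule openin_divergence[where \<phi> = "\<lambda>i y w. gap v D (fst w) i (snd w) y"],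
      rule continuous_on_gap[OF v])
      (auto intro!: continuous_on_fst continuous_on_snd continuous_on_id)
  then obtain O' where O': "open O'" "E = (UNIV \<times> X) \<inter> O'" unfolding openin_open by blast
  have space: "space (cube \<Otimes>\<^sub>M \<mu>) = UNIV \<times> X" by (simp add: space_pair_measure space_mu)
  have "(\<lambda>x. x) \<in> \<mu> \<rightarrow>\<^sub>M borel"
    unfolding measurable_cong_sets[OF sets_mu refl] by (rule measurable_restrict_space1) simp
  then have "snd \<in> cube \<Otimes>\<^sub>M \<mu> \<rightarrow>\<^sub>M borel" by (rule measurable_compose[OF measurable_snd])
  moreover have "fst \<in> cube \<Otimes>\<^sub>M \<mu> \<rightarrow>\<^sub>M borel"
    using measurable_fst[of cube \<mu>] unfolding measurable_cong_sets[OF refl sets_cube] .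
  ultimately have "(\<lambda>w. (fst w, snd w)) \<in> cube \<Otimes>\<^sub>M \<mu> \<rightarrow>\<^sub>M borel \<Otimes>\<^sub>M borel" by (intro measurable_Pair)
  then have id: "(\<lambda>w. w) \<in> cube \<Otimes>\<^sub>M \<mu> \<rightarrow>\<^sub>M borel" unfolding borel_prod by simp
  have "(\<lambda>w. w) -` O' \<inter> space (cube \<Otimes>\<^sub>M \<mu>) \<in> sets (cube \<Otimes>\<^sub>M \<mu>)"
    by (rule measurable_sets[OF id]) (use O'(1) in simp)
  moreover have "(\<lambda>w. w) -` O' \<inter> space (cube \<Otimes>\<^sub>M \<mu>) = E" unfolding space O'(2) by blast
  ultimately have E: "E \<in> sets (cube \<Otimes>\<^sub>M \<mu>)" by simp
  have 1: "Pair \<alpha> -` E = divergence_set X T (obs v D \<alpha>) k \<epsilon> \<eta>" for \<alpha>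
    unfolding E_def divergence_set_obs by auto
  have 2: "(\<lambda>\<alpha>. (\<alpha>, x)) -` E = {\<alpha>. x \<in> divergence_set X T (obs v D \<alpha>) k \<epsilon> \<eta>}" for x
    unfolding E_def divergence_set_obs by auto
  show ?thesis using emeasure_pair_measure_alt[OF E] P.emeasure_pair_measure_alt2[OF E] unfolding 1 2 by simp
qed

text \<open>Exchanging integrals turns the estimate for fixed x into a bound on the mean measure of
  the divergence set at scale 2^-n. Divided by the desired rate, these means are summable.\<close>

lemma AE_divergence_set_measure:
  assumes dense: "\<forall>S. open S \<longrightarrow> S \<noteq> {} \<longrightarrow> (\<exists>m. D m \<in> S)" and v: "v \<in> Lip X" and \<eta>: "\<eta> > 0"
    and dim: "upper_box_dim X < ereal (real k)" and \<theta>: "\<theta> > 0"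
  shows "AE \<alpha> in cube. \<exists>c n0. \<forall>n\<ge>n0. measure \<mu> (divergence_set X T (obs v D \<alpha>) k ((1 / 2) ^ n) \<eta>)
    \<le> real (c::nat) * ((1 / 2) ^ n) powr (real k - real_of_ereal (upper_box_dim X) - \<theta>)"
proof -
  obtain d where d: "upper_box_dim X = ereal d"
    using dim upper_box_dim_nonneg[of X] by (cases "upper_box_dim X") auto
  define s where "s = real k - d - \<theta>"
  obtain C \<epsilon>1 where C: "C > 0" "\<epsilon>1 > 0" and est: "\<And>\<epsilon> x. 0 < \<epsilon> \<Longrightarrow> \<epsilon> < \<epsilon>1 \<Longrightarrow> x \<in> X \<Longrightarrow>
      emeasure cube {\<alpha>. x \<in> divergence_set X T (obs v D \<alpha>) k \<epsilon> \<eta>} \<le>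
        ennreal (real (covering_number X \<epsilon>) * (C * \<epsilon> ^ k))"
    using divergence_estimates[OF dense v \<eta>, of k] by metis
  let ?e = "\<lambda>n. (1 / 2 :: real) ^ n"
  have "\<forall>\<^sub>F \<epsilon> in at_right 0. real (covering_number X \<epsilon>) \<le> \<epsilon> powr (- (d + \<theta> / 2))"
    by (rule upper_box_dim_covering) (use d \<theta> in simp)
  moreover have "\<forall>\<^sub>F \<epsilon> in at_right (0::real). \<epsilon> \<in> {0<..<\<epsilon>1}"
    by (rule eventually_at_right_real[OF C(2)])
  ultimately have "\<forall>\<^sub>F \<epsilon> in at_right 0. real (covering_number X \<epsilon>) \<le> \<epsilon> powr (- (d + \<theta> / 2)) \<and> \<epsilon> < \<epsilon>1"
    by eventually_elim simp
  moreover have "filterlim ?e (at_right 0) sequentially"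
    unfolding filterlim_at using LIMSEQ_power_zero[of "1 / 2 :: real"] by simp
  ultimately have "\<forall>\<^sub>F n in sequentially. real (covering_number X (?e n)) \<le> ?e n powr (- (d + \<theta> / 2)) \<and> ?e n < \<epsilon>1"
    by (rule eventually_compose_filterlim)
  then obtain n0 where n0: "\<And>n. n \<ge> n0 \<Longrightarrow> real (covering_number X (?e n)) \<le> ?e n powr (- (d + \<theta> / 2)) \<and> ?e n < \<epsilon>1"
    unfolding eventually_sequentially by blast
  let ?m = "\<lambda>n \<alpha>. measure \<mu> (divergence_set X T (obs v D \<alpha>) k (?e n) \<eta>)"
  \<comment> \<open>The measures relative to the target rate, started at \<open>n0\<close>. Their
    sum has finite mean, so it is almost surely finite and then bounds each of its terms.\<close>
  define f where "f n \<alpha> = ennreal (?e (n + n0) powr (- s)) * ennreal (?m (n + n0) \<alpha>)" for n \<alpha>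
  \<comment> \<open>Half of \<theta> is spent on the covering number bound; the other half remains
    as the ratio of a convergent geometric series.\<close>
  define q where "q = (1 / 2 :: real) powr (\<theta> / 2)"
  have q: "0 < q" "q < 1" unfolding q_def using \<theta> by (simp_all add: powr01_less_one)
  have meas: "f n \<in> borel_measurable cube" for n
    unfolding f_def[abs_def]
    by (intro borel_measurable_times_ennreal borel_measurable_const
        measurable_compose[OF measurable_divergence_set_obs[OF v] measurable_ennreal])
  have int: "(\<integral>\<^sup>+ \<alpha>. f n \<alpha> \<partial>cube) \<le> ennreal (C * q ^ (n + n0))" for n
  proof -
    let ?\<epsilon> = "?e (n + n0)"
    have \<epsilon>0: "0 < ?\<epsilon>" by simp
    have N: "real (covering_number X ?\<epsilon>) \<le> ?\<epsilon> powr (- (d + \<theta> / 2))" and \<epsilon>1: "?\<epsilon> < \<epsilon>1" using n0[of "n + n0"] by simp_all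
    have "(\<integral>\<^sup>+ \<alpha>. ennreal (?m (n + n0) \<alpha>) \<partial>cube) =
        (\<integral>\<^sup>+ \<alpha>. emeasure \<mu> (divergence_set X T (obs v D \<alpha>) k ?\<epsilon> \<eta>) \<partial>cube)"
      by (simp only: emeasure_eq_measure)
    also have "\<dots> = (\<integral>\<^sup>+ x. emeasure cube {\<alpha>. x \<in> divergence_set X T (obs v D \<alpha>) k ?\<epsilon> \<eta>} \<partial>\<mu>)"
      by (rule nn_integral_divergence_set[OF v])
    also have "\<dots> \<le> (\<integral>\<^sup>+ x. ennreal (real (covering_number X ?\<epsilon>) * (C * ?\<epsilon> ^ k)) \<partial>\<mu>)"
      by (rule nn_integral_mono) (rule est[OF \<epsilon>0 \<epsilon>1], simp add: space_mu)
    also have "\<dots> = ennreal (real (covering_number X ?\<epsilon>) * (C * ?\<epsilon> ^ k))"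
      by (simp add: emeasure_space_1)
    also have "\<dots> \<le> ennreal (?\<epsilon> powr (- (d + \<theta> / 2)) * (C * ?\<epsilon> ^ k))"
      using N C(1) by (intro ennreal_leI mult_right_mono) simp_all
    finally have i: "(\<integral>\<^sup>+ \<alpha>. ennreal (?m (n + n0) \<alpha>) \<partial>cube) \<le> ennreal (?\<epsilon> powr (- (d + \<theta> / 2)) * (C * ?\<epsilon> ^ k))" .
    have "(\<integral>\<^sup>+ \<alpha>. f n \<alpha> \<partial>cube) = ennreal (?\<epsilon> powr (- s)) * (\<integral>\<^sup>+ \<alpha>. ennreal (?m (n + n0) \<alpha>) \<partial>cube)"
      unfolding f_def
      by (rule nn_integral_cmult) (rule measurable_compose[OF measurable_divergence_set_obs[OF v] measurable_ennreal])
    also have "\<dots> \<le> ennreal (?\<epsilon> powr (- s)) * ennreal (?\<epsilon> powr (- (d + \<theta> / 2)) * (C * ?\<epsilon> ^ k))"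
      by (rule mult_left_mono[OF i]) simp
    also have "\<dots> = ennreal (C * q ^ (n + n0))"
    proof -
      have "?\<epsilon> ^ k = ?\<epsilon> powr real k" by (rule powr_realpow[OF \<epsilon>0, symmetric])
      then have "?\<epsilon> powr (- s) * (?\<epsilon> powr (- (d + \<theta> / 2)) * (C * ?\<epsilon> ^ k)) =
          C * (?\<epsilon> powr (- s) * ?\<epsilon> powr (- (d + \<theta> / 2)) * ?\<epsilon> powr real k)" by (simp only: mult_ac)
      also have "?\<epsilon> powr (- s) * ?\<epsilon> powr (- (d + \<theta> / 2)) * ?\<epsilon> powr real k = ?\<epsilon> powr (\<theta> / 2)"
        unfolding powr_add[symmetric] s_def by (simp add: field_simps)
      also have "\<dots> = q ^ (n + n0)" unfolding q_def by (rule powr_half_power)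
      finally have eq: "?\<epsilon> powr (- s) * (?\<epsilon> powr (- (d + \<theta> / 2)) * (C * ?\<epsilon> ^ k)) = C * q ^ (n + n0)" .
      show ?thesis unfolding eq[symmetric] by (rule ennreal_mult''[symmetric]) (use C(1) in simp)
    qed
    finally show ?thesis .
  qed
  have summ: "summable (\<lambda>n. C * q ^ (n + n0))"
    using q by (intro summable_mult) (simp add: summable_iff_shift summable_geometric)
  have "(\<integral>\<^sup>+ \<alpha>. (\<Sum>n. f n \<alpha>) \<partial>cube) = (\<Sum>n. \<integral>\<^sup>+ \<alpha>. f n \<alpha> \<partial>cube)"
    by (rule nn_integral_suminf[OF meas])
  also have "\<dots> \<le> (\<Sum>n. ennreal (C * q ^ (n + n0)))"
    by (intro suminf_le int summableI)
  also have "\<dots> = ennreal (\<Sum>n. C * q ^ (n + n0))"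
    by (rule suminf_ennreal2[OF _ summ]) (use C q in simp)
  finally have "(\<integral>\<^sup>+ \<alpha>. (\<Sum>n. f n \<alpha>) \<partial>cube) \<noteq> \<infinity>" by (auto simp: top_unique)
  then have "AE \<alpha> in cube. (\<Sum>n. f n \<alpha>) \<noteq> \<infinity>"
    by (intro nn_integral_PInf_AE borel_measurable_suminf_order meas)
  then show ?thesis
  proof eventually_elim
    case (elim \<alpha>)
    then obtain r where r: "(\<Sum>n. f n \<alpha>) = ennreal r" "r \<ge> 0" by (cases "\<Sum>n. f n \<alpha>") auto
    \<comment> \<open>An integer constant keeps the quantifier over constants in
      \<open>predictable\<close> countable.\<close>
    obtain c :: nat where c: "r \<le> real c" using real_arch_simple by blast
    have "?m n \<alpha> \<le> real c * ?e n powr s" if n: "n \<ge> n0" for n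
    proof -
      have "f (n - n0) \<alpha> \<le> ennreal r"
        using sum_le_suminf[OF summableI, of "{n - n0}" "\<lambda>n. f n \<alpha>"] unfolding r(1) by simp
      then have "ennreal (?e n powr (- s) * ?m n \<alpha>) \<le> ennreal r"
        using n unfolding f_def by (simp add: ennreal_mult)
      then have "?e n powr (- s) * ?m n \<alpha> \<le> real c" using r(2) c by (simp add: ennreal_le_iff)
      then have "?e n powr s * (?e n powr (- s) * ?m n \<alpha>) \<le> ?e n powr s * real c"
        by (rule mult_left_mono) simp
      moreover have "?e n powr s * ?e n powr (- s) = 1"
        unfolding powr_add[symmetric] by simp
      ultimately show ?thesis by (simp add: mult.assoc[symmetric] mult.commute)
    qed
    then show ?case unfolding d s_def by auto
  qed
qed

end

section \<open>Prediction error and divergence sets\<close>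

context lipschitz_system
begin

text \<open>No randomness is involved: on the compact set of pairs with gap at least \<eta> at time
  k, injectivity makes the sum of the first k gaps positive, hence bounded away from 0.\<close>

lemma divergence_set_empty_if_inj:
  assumes h: "h \<in> Lip X" and inj: "inj_on (delay_map h T k) X" and \<eta>: "\<eta> > 0"
  obtains \<epsilon> where "\<epsilon> > 0" "divergence_set X T h k \<epsilon> \<eta> = {}"
proof -
  define d where "d i p = \<bar>h ((T ^^ i) (fst p)) - h ((T ^^ i) (snd p))\<bar>" for i p
  have d: "continuous_on (X \<times> X) (d i)" for i
    unfolding d_def
    by (intro continuous_on_rabs continuous_on_diff Lip_continuous_on_iter[OF h] continuous_on_fst
        continuous_on_snd continuous_on_id) auto
  define K where "K = (X \<times> X) \<inter> d k -` {\<eta>..}"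
  have "closedin (top_of_set (X \<times> X)) K"
    unfolding K_def by (rule continuous_closedin_preimage[OF d]) simp
  then have K: "compact K" using closedin_compact compact_Times[OF compact_X compact_X] by metis
  have "\<exists>m>0. \<forall>p\<in>K. m \<le> (\<Sum>i<k. d i p)"
  proof (cases "K = {}")
    case True
    then show ?thesis by (intro exI[of _ 1]) simp
  next
    case False
    have "continuous_on K (\<lambda>p. \<Sum>i<k. d i p)"
      by (intro continuous_on_sum continuous_on_subset[OF d]) (auto simp: K_def)
    then obtain p where p: "p \<in> K" "\<forall>q\<in>K. (\<Sum>i<k. d i p) \<le> (\<Sum>i<k. d i q)"
      using continuous_attains_inf[OF K False] by blast
    obtain x y where xy: "p = (x, y)" by (cases p)
    have x: "x \<in> X" and y: "y \<in> X" and far: "\<eta> \<le> d k p" using p(1) by (auto simp: K_def xy)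
    have "(\<Sum>i<k. d i p) \<noteq> 0"
    proof
      assume "(\<Sum>i<k. d i p) = 0"
      then have "d i p = 0" if "i < k" for i
        using that by (subst (asm) sum_nonneg_eq_0_iff) (simp_all add: d_def)
      then have "delay_map h T k x = delay_map h T k y"
        by (intro ext) (simp add: delay_map_def d_def xy)
      then have "x = y" using inj x y by (simp add: inj_on_eq_iff)
      then show False using far \<eta> by (simp add: d_def xy)
    qed
    moreover have "0 \<le> (\<Sum>i<k. d i p)" by (intro sum_nonneg) (simp add: d_def)
    ultimately have "0 < (\<Sum>i<k. d i p)" by linarith
    then show ?thesis using p(2) by blast
  qed
  then obtain m where m: "m > 0" "\<And>p. p \<in> K \<Longrightarrow> m \<le> (\<Sum>i<k. d i p)" by blast
  show ?thesis
  proof (rule that)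
    show "0 < m / (real k + 1)" using m by simp
    have False if x: "x \<in> X" and y: "y \<in> X"
      and small: "\<forall>i<k. \<bar>h ((T ^^ i) x) - h ((T ^^ i) y)\<bar> < m / (real k + 1)"
      and far: "\<eta> < \<bar>h ((T ^^ k) x) - h ((T ^^ k) y)\<bar>" for x y
    proof -
      have "(x, y) \<in> K" using x y far by (simp add: K_def d_def)
      then have "m \<le> (\<Sum>i<k. d i (x, y))" by (rule m(2))
      also have "\<dots> \<le> (\<Sum>i<k. m / (real k + 1))"
        using small by (intro sum_mono) (simp add: d_def less_imp_le)
      also have "\<dots> < m" using m(1) by (simp add: field_simps)
      finally show False by simp
    qed
    then show "divergence_set X T h k (m / (real k + 1)) \<eta> = {}"
      unfolding divergence_set_def by blast
  qed
qed

end

context lipschitz_prob_system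
begin

lemma borel_measurable_obs_iter:
  assumes h: "h \<in> Lip X"
  shows "(\<lambda>z. h ((T ^^ i) z)) \<in> borel_measurable \<mu>"
  unfolding measurable_cong_sets[OF sets_mu refl]
  by (rule borel_measurable_continuous_on_restrict)
    (rule Lip_continuous_on_iter[OF h continuous_on_id], simp)

text \<open>Outside the divergence set every coordinate of \<open>\<phi> \<circ> T\<close> varies by
  at most \<eta> around its value at x on the whole fibre. The fibre mean obeys the same bound, so
  deviations from it are at most 2\<eta> = \<delta>/sqrt k per coordinate, and at most \<delta> in
  norm over k coordinates.\<close>

lemma bad_set_subset_divergence_set:
  assumes h: "h \<in> Lip X" and k: "k \<ge> 1" and \<delta>: "\<delta> > 0"
    and \<epsilon>: "\<epsilon> \<le> \<delta> / (2 * sqrt (real k))"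
  shows "bad_set \<mu> T k (delay_map h T k) \<epsilon> \<delta> \<subseteq> divergence_set X T h k \<epsilon> (\<delta> / (2 * sqrt (real k)))"
proof (rule subsetI, rule ccontr)
  define \<eta> where "\<eta> = \<delta> / (2 * sqrt (real k))"
  let ?\<phi> = "delay_map h T k"
  fix x assume bad: "x \<in> bad_set \<mu> T k ?\<phi> \<epsilon> \<delta>" and "x \<notin> divergence_set X T h k \<epsilon> (\<delta> / (2 * sqrt (real k)))"
  then have x: "x \<in> X" and nd: "x \<notin> divergence_set X T h k \<epsilon> \<eta>" by (auto simp: bad_set_def space_mu \<eta>_def)
  define F where "F = fibre \<mu> k ?\<phi> \<epsilon> (?\<phi> x)"
  define m where "m = measure \<mu> F"
  have m: "m > 0" and err: "\<delta> < pred_error \<mu> T k ?\<phi> \<epsilon> (?\<phi> x)"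
    using bad by (auto simp: bad_set_def m_def F_def)
  have \<eta>0: "\<eta> > 0" using \<delta> k by (simp add: \<eta>_def)
  note [measurable] = borel_measurable_obs_iter[OF h]
  have F_eq: "F = {z \<in> space \<mu>. L2_set (\<lambda>i. h ((T ^^ i) z) - h ((T ^^ i) x)) {..<k} < \<epsilon>}"
  proof -
    have eq: "L2_set (\<lambda>i. ?\<phi> z i - ?\<phi> x i) {..<k} = L2_set (\<lambda>i. h ((T ^^ i) z) - h ((T ^^ i) x)) {..<k}" for z
      by (rule L2_set_cong) (simp_all add: delay_map_def)
    show ?thesis
      unfolding F_def fibre_def euclid_ball_def euclid_norm_def
      by (rule set_eqI) (simp add: eq delay_map_in_Euclidean_space conj_commute)
  qed
  have F[measurable]: "F \<in> sets \<mu>" unfolding F_eq L2_set_def by measurable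
  have step: "?\<phi> (T z) i = h ((T ^^ Suc i) z)" if "i < k" for z i
    using that by (simp add: delay_map_def funpow_swap1)
  have close: "\<bar>h ((T ^^ Suc i) z) - h ((T ^^ Suc i) x)\<bar> \<le> \<eta>" if z: "z \<in> F" and i: "i < k" for z i
  proof -
    have zX: "z \<in> X" and l2: "L2_set (\<lambda>i. h ((T ^^ i) z) - h ((T ^^ i) x)) {..<k} < \<epsilon>"
      using z by (simp_all add: F_eq space_mu)
    have le: "\<bar>h ((T ^^ j) x) - h ((T ^^ j) z)\<bar> < \<epsilon>" if "j < k" for j
    proof -
      have "\<bar>h ((T ^^ j) z) - h ((T ^^ j) x)\<bar> \<le> L2_set (\<lambda>i. \<bar>h ((T ^^ i) z) - h ((T ^^ i) x)\<bar>) {..<k}"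
        by (rule member_le_L2_set) (use that in simp_all)
      also have "\<dots> = L2_set (\<lambda>i. h ((T ^^ i) z) - h ((T ^^ i) x)) {..<k}" by (simp add: L2_set_def)
      also have "\<dots> < \<epsilon>" by (rule l2)
      finally show ?thesis by (subst abs_minus_commute)
    qed
    show ?thesis
    \<comment> \<open>Times 1, ..., k - 1 are already controlled by membership in the fibre, where
      \<epsilon> \<le> \<eta> is used; only i = k - 1 reaches time k, where x is known not to
      diverge.\<close>
    proof (cases "Suc i < k")
      case True
      then show ?thesis using le[OF True] \<epsilon> unfolding \<eta>_def by (subst abs_minus_commute) linarith
    next
      case False
      then have "Suc i = k" using i by simp
      moreover have "\<bar>h ((T ^^ k) x) - h ((T ^^ k) z)\<bar> \<le> \<eta>"
      proof (rule leI, rule notI)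
        assume far: "\<eta> < \<bar>h ((T ^^ k) x) - h ((T ^^ k) z)\<bar>"
        have "x \<in> divergence_set X T h k \<epsilon> \<eta>"
          unfolding divergence_set_def
          by (intro CollectI conjI bexI[OF _ zX] allI impI x far) (rule le)
        with nd show False ..
      qed
      ultimately show ?thesis by (subst abs_minus_commute) (simp only:)
    qed
  qed
  define t where "t i = h ((T ^^ Suc i) x)" for i
  define g where "g i z = h ((T ^^ Suc i) z)" for i z
  have g[measurable]: "g i \<in> borel_measurable \<mu>" for i
    unfolding g_def by (rule borel_measurable_obs_iter[OF h])
  define c where "c = pred_mean \<mu> T k ?\<phi> \<epsilon> (?\<phi> x)"
  \<comment> \<open>An average of values within \<eta> of \<open>t i\<close> is within \<eta> of
    \<open>t i\<close>; this second error accounts for the 2 in the definition of \<eta>.\<close>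
  have mean: "\<bar>c i - t i\<bar> \<le> \<eta>" if i: "i < k" for i
  proof -
    have bnd: "\<bar>g i z - t i\<bar> \<le> \<eta>" if "z \<in> F" for z using close[OF that i] by (simp only: g_def t_def)
    have "integrable \<mu> (\<lambda>z. indicator F z *\<^sub>R g i z)"
    proof (rule integrable_const_bound[of _ "\<bar>t i\<bar> + \<eta>"])
      show "AE z in \<mu>. norm (indicator F z *\<^sub>R g i z) \<le> \<bar>t i\<bar> + \<eta>"
      proof (rule AE_I2)
        fix z show "norm (indicator F z *\<^sub>R g i z) \<le> \<bar>t i\<bar> + \<eta>"
          using bnd[of z] \<eta>0 by (cases "z \<in> F") auto
      qed
    qed measurable
    then have int: "set_integrable \<mu> F (g i)" unfolding set_integrable_def .
    have const: "set_integrable \<mu> F (\<lambda>_. r)" for r :: real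
      unfolding set_integrable_def by (rule integrable_const_bound[of _ "\<bar>r\<bar>"]) (auto simp: indicator_def)
    have const_eq: "(LINT z:F|\<mu>. r) = m * r" for r :: real
      unfolding m_def by (simp add: set_integral_const[OF F])
    let ?I = "LINT z:F|\<mu>. g i z"
    have "m * (t i - \<eta>) \<le> ?I"
      unfolding const_eq[symmetric] by (rule set_integral_mono[OF const int]) (use bnd in \<open>simp add: abs_le_iff algebra_simps\<close>)
    moreover have "?I \<le> m * (t i + \<eta>)"
      unfolding const_eq[symmetric] by (rule set_integral_mono[OF int const]) (use bnd in \<open>simp add: abs_le_iff algebra_simps\<close>)
    moreover have "c i = ?I / m"
      unfolding c_def pred_mean_def F_def[symmetric] m_def[symmetric] using i by (simp add: step g_def del: funpow.simps)
    ultimately have "m * (t i - \<eta>) \<le> m * c i" "m * c i \<le> m * (t i + \<eta>)"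
      using m by simp_all
    then have "t i - \<eta> \<le> c i" "c i \<le> t i + \<eta>"
      using m by (simp_all only: mult_le_cancel_left_pos)
    then show ?thesis by (simp add: abs_le_iff)
  qed
  have sq: "(euclid_norm k (\<lambda>i. ?\<phi> (T z) i - c i))\<^sup>2 \<le> \<delta>\<^sup>2" if z: "z \<in> F" for z
  proof -
    have "(euclid_norm k (\<lambda>i. ?\<phi> (T z) i - c i))\<^sup>2 = (\<Sum>i<k. (?\<phi> (T z) i - c i)\<^sup>2)"
      unfolding euclid_norm_def L2_set_def by (intro real_sqrt_pow2 sum_nonneg) simp
    also have "\<dots> \<le> (\<Sum>i<k. (2 * \<eta>)\<^sup>2)"
    proof (rule sum_mono)
      fix i assume "i \<in> {..<k}"
      then have i: "i < k" by simp
      have "\<bar>?\<phi> (T z) i - c i\<bar> \<le> 2 * \<eta>"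
        using close[OF z i] mean[OF i] unfolding step[OF i] t_def by linarith
      then show "(?\<phi> (T z) i - c i)\<^sup>2 \<le> (2 * \<eta>)\<^sup>2" using \<eta>0 by (intro abs_le_square_iff[THEN iffD1]) simp
    qed
    also have "\<dots> = real k * (\<delta> / sqrt (real k))\<^sup>2" by (simp add: \<eta>_def)
    also have "\<dots> = \<delta>\<^sup>2" using k by (simp add: power_divide)
    finally show ?thesis .
  qed
  have "(LINT z:F|\<mu>. (euclid_norm k (\<lambda>i. ?\<phi> (T z) i - c i))\<^sup>2) \<le> m * \<delta>\<^sup>2"
  proof -
    have "(LINT z|\<mu>. indicator F z *\<^sub>R (euclid_norm k (\<lambda>i. ?\<phi> (T z) i - c i))\<^sup>2) \<le> (LINT z|\<mu>. indicator F z *\<^sub>R \<delta>\<^sup>2)"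
    \<comment> \<open>The majorant is integrable and nonnegative, so the comparison is also
      consistent with the default integral 0 on the left.\<close>
    proof (rule integral_mono')
      show "integrable \<mu> (\<lambda>z. indicator F z *\<^sub>R \<delta>\<^sup>2)"
        by (rule integrable_const_bound[of _ "\<delta>\<^sup>2"]) (auto simp: indicator_def)
      show "indicator F z *\<^sub>R (euclid_norm k (\<lambda>i. ?\<phi> (T z) i - c i))\<^sup>2 \<le> indicator F z *\<^sub>R \<delta>\<^sup>2" for z
        using sq[of z] by (cases "z \<in> F") simp_all
    qed simp
    also have "\<dots> = m * \<delta>\<^sup>2" 
      unfolding m_def set_lebesgue_integral_def[symmetric] by (simp add: set_integral_const[OF F])
    finally show ?thesis unfolding set_lebesgue_integral_def .
  qed
  then have "1 / m * (LINT z:F|\<mu>. (euclid_norm k (\<lambda>i. ?\<phi> (T z) i - c i))\<^sup>2) \<le> \<delta>\<^sup>2"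
    using m by (simp add: field_simps)
  then have "pred_error \<mu> T k ?\<phi> \<epsilon> (?\<phi> x) \<le> sqrt (\<delta>\<^sup>2)"
    unfolding pred_error_def F_def[symmetric] m_def[symmetric] c_def[symmetric] by (rule real_sqrt_le_mono)
  then show False using err \<delta> by simp
qed

end

section \<open>A prevalent set of predictable observables\<close>

context lipschitz_prob_system
begin

text \<open>Thresholds 1/(n+1), losses 1/(m+1), dyadic scales and integer constants leave only
  countable quantifiers, through which both Borel measurability and almost sure statements pass.
  Divergence sets stand in for prediction errors because their dependence on h is
  semicontinuous.\<close>

definition predictable :: "('a \<Rightarrow> real) set" where
  "predictable = {h \<in> Lip X.
     (\<forall>k n m. upper_box_dim X < ereal (real k) \<longrightarrow>
       (\<exists>c n0. \<forall>j\<ge>n0. measure \<mu> (divergence_set X T h k ((1 / 2) ^ j) (1 / real (Suc n))) \<le>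
         real (c::nat) * ((1 / 2) ^ j) powr (real k - real_of_ereal (upper_box_dim X) - 1 / real (Suc m)))) \<and>
     (\<forall>k n. 2 * lower_box_dim X < ereal (real k) \<longrightarrow>
       (\<exists>j. divergence_set X T h k (1 / real (Suc j)) (1 / real (Suc n)) = {}))}"

lemma prevalent_predictable: "prevalent_borel X predictable"
proof -
  obtain D :: "nat \<Rightarrow> 'a" where dense: "\<forall>S. open S \<longrightarrow> S \<noteq> {} \<longrightarrow> (\<exists>m. D m \<in> S)"
    using dense_sequence_exists by blast
  have "Measurable.pred (Lip_borel X) (\<lambda>h.
     (\<forall>k n m. upper_box_dim X < ereal (real k) \<longrightarrow>
       (\<exists>c n0. \<forall>j. n0 \<le> j \<longrightarrow> measure \<mu> (divergence_set X T h k ((1 / 2) ^ j) (1 / real (Suc n))) \<le>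
         real (c::nat) * ((1 / 2) ^ j) powr (real k - real_of_ereal (upper_box_dim X) - 1 / real (Suc m)))) \<and>
     (\<forall>k n. 2 * lower_box_dim X < ereal (real k) \<longrightarrow>
       (\<exists>j. divergence_set X T h k (1 / real (Suc j)) (1 / real (Suc n)) = {})))"
    by (intro pred_intros_logic(3) pred_intros_countable pred_intros_imp'
        pred_divergence_set_measure pred_divergence_set_empty)
  then have "predictable \<in> sets (Lip_borel X)"
    unfolding pred_def space_Lip_borel[OF bounded_X] predictable_def .
  then show ?thesis
  proof (rule prevalent_borelI[OF bounded_X])
    fix v assume v: "v \<in> Lip X"
    have "AE \<alpha> in cube. \<forall>k n m. upper_box_dim X < ereal (real k) \<longrightarrow>
       (\<exists>c n0. \<forall>j\<ge>n0. measure \<mu> (divergence_set X T (obs v D \<alpha>) k ((1 / 2) ^ j) (1 / real (Suc n))) \<le>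
         real (c::nat) * ((1 / 2) ^ j) powr (real k - real_of_ereal (upper_box_dim X) - 1 / real (Suc m)))"
      unfolding AE_all_countable
    proof (intro allI)
      fix k n m
      show "AE \<alpha> in cube. upper_box_dim X < ereal (real k) \<longrightarrow>
       (\<exists>c n0. \<forall>j\<ge>n0. measure \<mu> (divergence_set X T (obs v D \<alpha>) k ((1 / 2) ^ j) (1 / real (Suc n))) \<le>
         real (c::nat) * ((1 / 2) ^ j) powr (real k - real_of_ereal (upper_box_dim X) - 1 / real (Suc m)))"
      proof (cases "upper_box_dim X < ereal (real k)")
        case True
        have "0 < 1 / real (Suc n)" "0 < 1 / real (Suc m)" by simp_all
        from AE_divergence_set_measure[OF dense v this(1) True this(2)] show ?thesis
          by (rule eventually_mono) blast
      qed simp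
    qed
    moreover have "AE \<alpha> in cube. \<forall>k n. 2 * lower_box_dim X < ereal (real k) \<longrightarrow>
       (\<exists>j. divergence_set X T (obs v D \<alpha>) k (1 / real (Suc j)) (1 / real (Suc n)) = {})"
      unfolding AE_all_countable
    proof (intro allI)
      fix k n
      show "AE \<alpha> in cube. 2 * lower_box_dim X < ereal (real k) \<longrightarrow>
        (\<exists>j. divergence_set X T (obs v D \<alpha>) k (1 / real (Suc j)) (1 / real (Suc n)) = {})"
      proof (cases "2 * lower_box_dim X < ereal (real k)")
        case True
        have "0 < 1 / real (Suc n)" by simp
        from AE_divergence_set_empty[OF dense v this True] show ?thesis
          by (rule eventually_mono) blast
      qed simp
    qed
    ultimately have "AE \<alpha> in cube. obs v D \<alpha> \<in> predictable"
      unfolding predictable_def mem_Collect_eq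
      by eventually_elim (intro conjI obs_Lip[OF v], assumption+)
    then show "AE \<alpha> in cube. (\<lambda>x. v x + probe_on X D \<alpha> x) \<in> predictable" unfolding obs_def .
  qed
qed

lemma bad_set_empty_if_divergence_set_empty:
  assumes h: "h \<in> Lip X" and k: "k \<ge> 1" and \<delta>: "\<delta> > 0" and \<epsilon>0: "\<epsilon>0 > 0"
    and empty: "divergence_set X T h k \<epsilon>0 \<eta> = {}" and \<eta>: "\<eta> \<le> \<delta> / (2 * sqrt (real k))"
  shows "\<exists>\<epsilon>\<^sub>0>0. \<forall>\<epsilon>. 0 < \<epsilon> \<and> \<epsilon> < \<epsilon>\<^sub>0 \<longrightarrow> bad_set \<mu> T k (delay_map h T k) \<epsilon> \<delta> = {}"
proof (intro exI[of _ "min \<epsilon>0 (\<delta> / (2 * sqrt (real k)))"] conjI allI impI)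
  show "0 < min \<epsilon>0 (\<delta> / (2 * sqrt (real k)))" using \<epsilon>0 \<delta> k by simp
  fix \<epsilon> assume "0 < \<epsilon> \<and> \<epsilon> < min \<epsilon>0 (\<delta> / (2 * sqrt (real k)))"
  then have \<epsilon>: "\<epsilon> \<le> \<epsilon>0" "\<epsilon> \<le> \<delta> / (2 * sqrt (real k))" by simp_all
  have "bad_set \<mu> T k (delay_map h T k) \<epsilon> \<delta> \<subseteq> divergence_set X T h k \<epsilon> (\<delta> / (2 * sqrt (real k)))"
    by (rule bad_set_subset_divergence_set[OF h k \<delta> \<epsilon>(2)])
  also have "\<dots> \<subseteq> divergence_set X T h k \<epsilon>0 \<eta>" by (rule divergence_set_mono[OF \<epsilon>(1) \<eta>])
  finally show "bad_set \<mu> T k (delay_map h T k) \<epsilon> \<delta> = {}" unfolding empty by simp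
qed

lemma predictable_bad_set_empty:
  assumes h: "h \<in> predictable" and k: "k \<ge> 1" and \<delta>: "\<delta> > 0"
    and cond: "ereal (real k) > 2 * lower_box_dim X \<or> inj_on (delay_map h T k) X"
  shows "\<exists>\<epsilon>\<^sub>0>0. \<forall>\<epsilon>. 0 < \<epsilon> \<and> \<epsilon> < \<epsilon>\<^sub>0 \<longrightarrow> bad_set \<mu> T k (delay_map h T k) \<epsilon> \<delta> = {}"
proof -
  have hL: "h \<in> Lip X" using h by (simp add: predictable_def)
  have \<eta>: "0 < \<delta> / (2 * sqrt (real k))" using \<delta> k by simp
  from cond show ?thesis
  proof
    assume dim: "ereal (real k) > 2 * lower_box_dim X"
    obtain n where n: "1 / real (Suc n) < \<delta> / (2 * sqrt (real k))" by (rule nat_approx_posE[OF \<eta>])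
    obtain j where "divergence_set X T h k (1 / real (Suc j)) (1 / real (Suc n)) = {}"
      using h dim unfolding predictable_def by blast
    then show ?thesis
      by (intro bad_set_empty_if_divergence_set_empty[OF hL k \<delta> _ _ less_imp_le[OF n]]) simp_all
  next
    assume "inj_on (delay_map h T k) X"
    then obtain \<epsilon> where "\<epsilon> > 0" "divergence_set X T h k \<epsilon> (\<delta> / (2 * sqrt (real k))) = {}"
      by (rule divergence_set_empty_if_inj[OF hL _ \<eta>])
    then show ?thesis by (rule bad_set_empty_if_divergence_set_empty[OF hL k \<delta> _ _ order_refl])
  qed
qed

text \<open>Interpolation between dyadic scales: \<epsilon> is within a factor 2 of the next scale
  2^-j above it, divergence sets are monotone, and the factor costs at most 2^|s|. Adding 1 to
  \<open>c\<close> keeps the constant positive.\<close>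

lemma predictable_bad_set_measure:
  assumes h: "h \<in> predictable" and k: "k \<ge> 1" and \<delta>: "\<delta> > 0" and \<theta>: "\<theta> > 0"
    and dim: "upper_box_dim X < ereal (real k)"
  shows "\<exists>C>0. \<exists>\<epsilon>\<^sub>0>0. \<forall>\<epsilon>. 0 < \<epsilon> \<and> \<epsilon> < \<epsilon>\<^sub>0 \<longrightarrow>
    measure \<mu> (bad_set \<mu> T k (delay_map h T k) \<epsilon> \<delta>)
      \<le> C * \<epsilon> powr (real k - real_of_ereal (upper_box_dim X) - \<theta>)"
proof -
  have hL: "h \<in> Lip X" using h by (simp add: predictable_def)
  define \<eta> where "\<eta> = \<delta> / (2 * sqrt (real k))"
  have \<eta>: "0 < \<eta>" using \<delta> k by (simp add: \<eta>_def)
  obtain n where n: "1 / real (Suc n) < \<eta>" by (rule nat_approx_posE[OF \<eta>])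
  obtain m where m: "1 / real (Suc m) < \<theta>" by (rule nat_approx_posE[OF \<theta>])
  define s where "s = real k - real_of_ereal (upper_box_dim X) - 1 / real (Suc m)"
  let ?s = "real k - real_of_ereal (upper_box_dim X) - \<theta>"
  have s: "?s \<le> s" using m by (simp add: s_def)
  obtain c n0 where c: "\<And>j. j \<ge> n0 \<Longrightarrow>
      measure \<mu> (divergence_set X T h k ((1 / 2) ^ j) (1 / real (Suc n))) \<le> real (c::nat) * ((1 / 2) ^ j) powr s"
    using h dim unfolding predictable_def s_def by blast
  have "\<exists>\<epsilon>\<^sub>0>0. \<forall>\<epsilon>. 0 < \<epsilon> \<and> \<epsilon> < \<epsilon>\<^sub>0 \<longrightarrow>
      measure \<mu> (bad_set \<mu> T k (delay_map h T k) \<epsilon> \<delta>) \<le> (real c + 1) * 2 powr \<bar>s\<bar> * \<epsilon> powr ?s"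
  proof (intro exI[of _ "min \<eta> ((1 / 2) ^ n0)"] conjI allI impI)
    show "0 < min \<eta> ((1 / 2) ^ n0)" using \<eta> by simp
    fix \<epsilon> assume "0 < \<epsilon> \<and> \<epsilon> < min \<eta> ((1 / 2) ^ n0)"
    then have \<epsilon>: "0 < \<epsilon>" "\<epsilon> < \<eta>" "\<epsilon> < (1 / 2) ^ n0" by simp_all
    have "(1 / 2 :: real) ^ n0 \<le> 1" by (intro power_le_one) simp_all
    then have \<epsilon>1: "\<epsilon> < 1" using \<epsilon>(3) by linarith
    have lim: "\<exists>j. (1 / 2) ^ j < \<epsilon>" by (rule real_arch_pow_inv) (use \<epsilon> in simp_all)
    \<comment> \<open>The first dyadic scale strictly below \<epsilon>; its predecessor j = J - 1
      then lies between \<epsilon> and 2\<epsilon>, and \<epsilon> < 2^-n0 gives j \<ge> n0.\<close>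
    define J where "J = (LEAST j. (1 / 2) ^ j < \<epsilon>)"
    have J: "(1 / 2) ^ J < \<epsilon>" unfolding J_def by (rule LeastI_ex[OF lim])
    have "\<not> J \<le> n0"
    proof
      assume "J \<le> n0"
      then have "(1 / 2 :: real) ^ n0 \<le> (1 / 2) ^ J" by (intro power_decreasing) simp_all
      then show False using J \<epsilon>(3) by linarith
    qed
    then obtain j where j: "J = Suc j" "n0 \<le> j" by (cases J) auto
    have "\<not> (1 / 2) ^ j < \<epsilon>" by (rule not_less_Least) (use j in \<open>simp add: J_def[symmetric]\<close>)
    then have lo: "\<epsilon> \<le> (1 / 2) ^ j" by simp
    have hi: "(1 / 2) ^ j \<le> 2 * \<epsilon>" using J j(1) by simp
    have "bad_set \<mu> T k (delay_map h T k) \<epsilon> \<delta> \<subseteq> divergence_set X T h k \<epsilon> \<eta>"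
      unfolding \<eta>_def by (rule bad_set_subset_divergence_set[OF hL k \<delta>]) (use \<epsilon> in \<open>simp add: \<eta>_def\<close>)
    also have "\<dots> \<subseteq> divergence_set X T h k ((1 / 2) ^ j) (1 / real (Suc n))"
      by (rule divergence_set_mono[OF lo less_imp_le[OF n]])
    finally have "measure \<mu> (bad_set \<mu> T k (delay_map h T k) \<epsilon> \<delta>)
        \<le> measure \<mu> (divergence_set X T h k ((1 / 2) ^ j) (1 / real (Suc n)))"
      by (intro finite_measure_mono sets_divergence_set hL)
    also have "\<dots> \<le> real c * ((1 / 2) ^ j) powr s" by (rule c[OF j(2)])
    also have "\<dots> \<le> (real c + 1) * (2 powr \<bar>s\<bar> * \<epsilon> powr s)"
    proof (rule mult_mono)
      \<comment> \<open>The exponent can be negative, hence |s|: in that case the bound comes from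
        \<epsilon> \<le> 2^-j and not from 2^-j \<le> 2\<epsilon>.\<close>
      show "((1 / 2) ^ j) powr s \<le> 2 powr \<bar>s\<bar> * \<epsilon> powr s"
      proof (cases "s \<ge> 0")
        case True
        then have "((1 / 2) ^ j) powr s \<le> (2 * \<epsilon>) powr s" by (intro powr_mono2 hi) simp_all
        then show ?thesis using True \<epsilon> by (simp add: powr_mult)
      next
        case False
        have "((1 / 2) ^ j) powr s \<le> \<epsilon> powr s" by (rule powr_mono2'[OF _ \<epsilon>(1) lo]) (use False in simp)
        also have "\<dots> \<le> 2 powr \<bar>s\<bar> * \<epsilon> powr s"
          using mult_right_mono[OF ge_one_powr_ge_zero[of 2 "\<bar>s\<bar>"], of "\<epsilon> powr s"] by simp
        finally show ?thesis .
      qed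
    qed simp_all
    also have "\<dots> \<le> (real c + 1) * (2 powr \<bar>s\<bar> * \<epsilon> powr ?s)"
      using powr_mono'[OF s] \<epsilon>(1) \<epsilon>1 by (intro mult_left_mono) simp_all
    finally show "measure \<mu> (bad_set \<mu> T k (delay_map h T k) \<epsilon> \<delta>)
        \<le> (real c + 1) * 2 powr \<bar>s\<bar> * \<epsilon> powr ?s" by (simp only: mult.assoc)
  qed
  moreover have "0 < (real c + 1) * 2 powr \<bar>s\<bar>" by simp
  ultimately show ?thesis by blast
qed

end

theorem theorem1p7:
  fixes X :: "(real ^ 'n) set"
    and \<mu> :: "(real ^ 'n) measure"
    and T :: "real ^ 'n \<Rightarrow> real ^ 'n"
  assumes "compact X"
    and "prob_space \<mu>" and "sets \<mu> = sets (restrict_space borel X)"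
    and "T ` X \<subseteq> X" and "\<exists>L. L-lipschitz_on X T"
  shows "\<exists>S. prevalent X S \<and>
    (\<forall>h\<in>S. \<forall>k\<ge>1. \<forall>\<delta>>0. \<forall>\<theta>>0. \<exists>C>0. \<exists>\<epsilon>\<^sub>0>0. \<forall>\<epsilon>. 0 < \<epsilon> \<and> \<epsilon> < \<epsilon>\<^sub>0 \<longrightarrow>
      (ereal (real k) > upper_box_dim X \<longrightarrow>
         measure \<mu> (bad_set \<mu> T k (delay_map h T k) \<epsilon> \<delta>)
           \<le> C * \<epsilon> powr (real k - real_of_ereal (upper_box_dim X) - \<theta>)) \<and>
      (ereal (real k) > 2 * lower_box_dim X \<or> inj_on (delay_map h T k) X \<longrightarrow>
         bad_set \<mu> T k (delay_map h T k) \<epsilon> \<delta> = {}))"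
proof -
  obtain L where L: "L-lipschitz_on X T" using assms(5) by blast
  interpret prob_space \<mu> by (rule assms(2))
  interpret lipschitz_prob_system X T L \<mu> by unfold_locales (fact assms L)+
  show ?thesis
  proof (intro exI[of _ predictable] conjI ballI allI impI)
    show "prevalent X predictable"
      unfolding prevalent_def using prevalent_predictable by (auto simp: predictable_def)
    fix h and k :: nat and \<delta> \<theta> :: real
    assume h: "h \<in> predictable" and k: "1 \<le> k" and \<delta>: "0 < \<delta>" and \<theta>: "0 < \<theta>"
    let ?M = "\<lambda>C \<epsilon>. ereal (real k) > upper_box_dim X \<longrightarrow>
         measure \<mu> (bad_set \<mu> T k (delay_map h T k) \<epsilon> \<delta>)
           \<le> C * \<epsilon> powr (real k - real_of_ereal (upper_box_dim X) - \<theta>)"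
    let ?E = "\<lambda>\<epsilon>. ereal (real k) > 2 * lower_box_dim X \<or> inj_on (delay_map h T k) X \<longrightarrow>
         bad_set \<mu> T k (delay_map h T k) \<epsilon> \<delta> = {}"
    \<comment> \<open>The constants may depend on which hypotheses hold: a false one makes its
      implication vacuous and any choice serves. The two thresholds are merged by their
      minimum.\<close>
    have "\<exists>C>0. \<exists>e>0. \<forall>\<epsilon>. 0 < \<epsilon> \<and> \<epsilon> < e \<longrightarrow> ?M C \<epsilon>"
    proof (cases "ereal (real k) > upper_box_dim X")
      case True
      then show ?thesis using predictable_bad_set_measure[OF h k \<delta> \<theta> True] by simp
    next
      case False
      then show ?thesis by (intro exI[of _ 1] conjI allI impI) simp_all
    qed
    then obtain C e1 where C: "C > 0" "e1 > 0" "\<forall>\<epsilon>. 0 < \<epsilon> \<and> \<epsilon> < e1 \<longrightarrow> ?M C \<epsilon>" by (elim exE conjE)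
    have "\<exists>e>0. \<forall>\<epsilon>. 0 < \<epsilon> \<and> \<epsilon> < e \<longrightarrow> ?E \<epsilon>"
    proof (cases "ereal (real k) > 2 * lower_box_dim X \<or> inj_on (delay_map h T k) X")
      case True
      then show ?thesis using predictable_bad_set_empty[OF h k \<delta> True] by simp
    next
      case False
      then show ?thesis by (intro exI[of _ 1] conjI allI impI) simp_all
    qed
    then obtain e2 where e2: "e2 > 0" "\<forall>\<epsilon>. 0 < \<epsilon> \<and> \<epsilon> < e2 \<longrightarrow> ?E \<epsilon>" by (elim exE conjE)
    show "\<exists>C>0. \<exists>\<epsilon>\<^sub>0>0. \<forall>\<epsilon>. 0 < \<epsilon> \<and> \<epsilon> < \<epsilon>\<^sub>0 \<longrightarrow> ?M C \<epsilon> \<and> ?E \<epsilon>"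
      by (rule exI[of _ C], rule conjI[OF C(1)], rule exI[of _ "min e1 e2"])
        (use C e2 in \<open>simp only: min_less_iff_conj\<close>, blast)
  qed
qed

end
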